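(* Let $K$ be an F-finite field of characteristic $3$, let $S=K[x,y,z,u,v,w]_{\mathfrak n}$, where $\mathfrak n=(x,y,z,u,v,w)$, and let $R=S/I$, where $I$ is the ideal generated by the size two minors of the matrix $$\begin{bmatrix} x^2+v^5 & y & u\\ z & x^2 & y^2-u\end{bmatrix}.$$ Then $R/(v)$ is strongly F-regular, but $R/(v-w^N)$ is not F-pure for any $N\geq1$. In particular, strong F-regularity and F-purity are not stable in $R$: there is no integer $N$ such that $R/(v+\delta)$ is F-pure (respectively, strongly F-regular) for all $\delta\in\mathfrak m^N$, where $\mathfrak m$ is the maximal ideal of $R$.
   Context: A field $K$ of characteristic $p$ is F-finite if $[K:K^p]<\infty$. For a ring $R$ of characteristic $p$ with Frobenius endomorphism $F$, a $p^{-e}$-linear map is an additive map $\varphi\colon R\to R$ with $\varphi(r^{p^e}s)=r\varphi(s)$ for all $r,s\in R$. An F-finite local ring $R$ is F-pure if there is a $p^{-1}$-linear map $\varphi$ with $\varphi\circ F=\mathrm{id}_R$. It is strongly F-regular if for every $c\in R$ not in any minimal prime there exist $e$ and a $p^{-e}$-linear map $\varphi$ with $\varphi\circ(cF^e)=\mathrm{id}_R$. *)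

theory Defs
  imports
    "HOL-Library.Poly_Mapping"
    "HOL-Computational_Algebra.Fraction_Field"
    "HOL-Algebra.Algebra"
    "HOL-Algebra.Algebraic_Closure_Type"
    "Jordan_Normal_Form.Determinant"
    "Jordan_Normal_Form.DL_Submatrix"
begin

definition F_finite_field :: "'k::field itself \<Rightarrow> bool" where
  "F_finite_field _ \<longleftrightarrow>
     ring.finite_dimension (ring_of_type_algebra :: 'k ring)
       (range (\<lambda>a. a ^ CHAR('k))) UNIV"

text \<open>In the next definitions \<open>p\<close> stands for the characteristic of the commutative ring \<open>R\<close>.
  Maps are only considered on the carrier of \<open>R\<close>.\<close>

definition p_linear_map :: "nat \<Rightarrow> nat \<Rightarrow> ('a, 'b) ring_scheme \<Rightarrow> ('a \<Rightarrow> 'a) \<Rightarrow> bool" where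
  "p_linear_map p e R \<phi> \<longleftrightarrow>
     \<phi> \<in> hom (add_monoid R) (add_monoid R) \<and>
     (\<forall>r\<in>carrier R. \<forall>s\<in>carrier R. \<phi> (r [^]\<^bsub>R\<^esub> (p ^ e) \<otimes>\<^bsub>R\<^esub> s) = r \<otimes>\<^bsub>R\<^esub> \<phi> s)"

text \<open>The notions below are used for F-finite local rings of characteristic \<open>p\<close>. This is not made
  part of the predicates, so that their negations only deny the existence of splittings.\<close>

definition F_pure :: "nat \<Rightarrow> ('a, 'b) ring_scheme \<Rightarrow> bool" where
  "F_pure p R \<longleftrightarrow>
     (\<exists>\<phi>. p_linear_map p 1 R \<phi> \<and> (\<forall>r\<in>carrier R. \<phi> (r [^]\<^bsub>R\<^esub> p) = r))"

definition minimal_prime :: "'a set \<Rightarrow> ('a, 'b) ring_scheme \<Rightarrow> bool" where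
  "minimal_prime P R \<longleftrightarrow>
     primeideal P R \<and> (\<forall>Q. primeideal Q R \<and> Q \<subseteq> P \<longrightarrow> Q = P)"

text \<open>The exponent \<open>e\<close> is positive: with \<open>e = 0\<close> allowed, every Artinian local ring would be
  strongly F-regular.\<close>

definition strongly_F_regular :: "nat \<Rightarrow> ('a, 'b) ring_scheme \<Rightarrow> bool" where
  "strongly_F_regular p R \<longleftrightarrow>
     (\<forall>c\<in>carrier R. (\<forall>P. minimal_prime P R \<longrightarrow> c \<notin> P) \<longrightarrow>
       (\<exists>e\<ge>1. \<exists>\<phi>. p_linear_map p e R \<phi> \<and>
          (\<forall>r\<in>carrier R. \<phi> (c \<otimes>\<^bsub>R\<^esub> r [^]\<^bsub>R\<^esub> (p ^ e)) = r)))"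

text \<open>The maximal ideal of a local ring (unspecified if \<open>R\<close> is not local).\<close>

definition the_maxideal :: "('a, 'b) ring_scheme \<Rightarrow> 'a set" where
  "the_maxideal R = (THE m. maximalideal m R)"

text \<open>The localization of a domain at a prime ideal, as a subring of the fraction field.\<close>

definition localization_at :: "'a::idom set \<Rightarrow> 'a fract ring" where
  "localization_at P = ring_of_type_algebra \<lparr>carrier := {Fract a b | a b. b \<notin> P}\<rparr>"

definition minors :: "nat \<Rightarrow> 'a::comm_ring_1 mat \<Rightarrow> 'a set" where
  "minors k A = {det (submatrix A I J) | I J.
     I \<subseteq> {..<dim_row A} \<and> J \<subseteq> {..<dim_col A} \<and> card I = k \<and> card J = k}"

datatype var = VX | VY | VZ | VU | VV | VW

text \<open>The order on the variables plays no role, but the library only proves that a polynomial ring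
  is a domain when its variables are linearly ordered.\<close>

primrec var_index :: "var \<Rightarrow> nat" where
  "var_index VX = 0"
| "var_index VY = 1"
| "var_index VZ = 2"
| "var_index VU = 3"
| "var_index VV = 4"
| "var_index VW = 5"

lemma var_index_inject: "var_index i = var_index j \<longleftrightarrow> i = j"
  by (cases i; cases j) simp_all

instantiation var :: linorder
begin

definition less_eq_var :: "var \<Rightarrow> var \<Rightarrow> bool" where
  "i \<le> j \<longleftrightarrow> var_index i \<le> var_index j"

definition less_var :: "var \<Rightarrow> var \<Rightarrow> bool" where
  "i < j \<longleftrightarrow> var_index i < var_index j"

instance
  by standard (auto simp: less_eq_var_def less_var_def var_index_inject)

end

type_synonym 'k poly6 = "(var \<Rightarrow>\<^sub>0 nat) \<Rightarrow>\<^sub>0 'k"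

definition pvar :: "var \<Rightarrow> 'k::field poly6" where
  "pvar i = Poly_Mapping.single (Poly_Mapping.single i 1) 1"

end

theory Submission
  imports Defs
begin

text \<open>
  The two halves of the statement have unrelated reasons.

  \<^bold>\<open>The special fibre.\<close> Give \<open>x, y, z, u\<close> the degrees \<open>1, 2, 2, 4\<close>. With \<open>s = y / x\<^sup>2\<close> the minors
  for \<open>v = 0\<close> say that \<open>y = x\<^sup>2 s\<close>, \<open>z = x\<^sup>2 / s\<close> and \<open>u = x^4 s^3 / (1 + s)\<close>, so that they define the
  section ring of the \<open>\<rat>\<close>-divisor \<open>1/2 (0) + 1/2 (\<infinity>) + 1/4 (-1)\<close> on the projective line. An orbifold
  line of type \<open>(2, 2, 4)\<close> is the quotient of a projective line by a dihedral group of order 8, and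
  hence the section ring is a ring of invariants in \<open>K[a, b]\<close> of a finite group \<open>G\<close> of order 80, prime
  to the characteristic. Explicitly, put \<open>g = a b\<close>, \<open>\<alpha> = a^4 + b^4\<close>, \<open>\<beta> = a^4 - b^4\<close>; in characteristic 3
  these satisfy \<open>g^4 = \<alpha>\<^sup>2 - \<beta>\<^sup>2\<close>, and
  \<open>x \<mapsto> g \<alpha> \<beta>\<close>, \<open>y \<mapsto> - g\<^sup>2 \<alpha>^4\<close>, \<open>z \<mapsto> - g\<^sup>2 \<beta>^4\<close>, \<open>u \<mapsto> \<alpha>^10\<close>, \<open>v \<mapsto> 0\<close>, \<open>w \<mapsto> w\<close>
  is a homomorphism \<open>cover\<close> into \<open>K[a, b, w]\<close>. Its kernel is generated by the minors and \<open>v\<close>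
  (lemma \<open>cover_eq_0_iff\<close>), and its range contains the values of the Reynolds operator of \<open>G\<close>
  (lemma \<open>reynolds_in_range\<close>), so that the range is a direct summand of a polynomial ring. In a
  polynomial ring every nonzero \<open>c\<close> is sent to \<open>1\<close> by some \<open>p^(-e)\<close>-linear map: read off one monomial of
  \<open>c\<close>, with \<open>p^e\<close> larger than all its exponents (lemma \<open>polynomial_frobenius_splitting\<close>). Composing
  with the Reynolds operator gives the same for the range, and localizing gives it for \<open>R / (v)\<close>.

  \<^bold>\<open>The deformations.\<close> Modulo the minors one has \<open>(y\<^sup>2 v^4)^3 \<in> (x^3, u^3)\<close> (lemma
  \<open>frobenius_power_identity\<close>). A map \<open>\<phi>\<close> that splits the Frobenius endomorphism would then give
  \<open>y\<^sup>2 v^4 \<in> (x, u)\<close>. This fails in \<open>R / (v - w^N)\<close>: modulo \<open>x\<close> and \<open>u\<close> only the relations \<open>y z = 0\<close>,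
  \<open>w^(5N) y\<^sup>2 = 0\<close> and \<open>y^3 = 0\<close> remain, and they do not imply \<open>w^(4N) y\<^sup>2 = 0\<close>.

  The perturbation \<open>\<delta> = - w^N\<close> lies in \<open>m^N\<close>, and strong F-regularity implies F-purity; this gives
  the statements on stability.
\<close>

section \<open>Polynomials as linear combinations of monomials\<close>

lemma poly_mapping_eq_sum_single:
  "f = (\<Sum>m\<in>Poly_Mapping.keys f. Poly_Mapping.single m (Poly_Mapping.lookup f m))"
  by (rule poly_mapping_eqI)
     (auto simp: lookup_sum lookup_single when_def in_keys_iff)

text \<open>
  Additive statements about polynomials, such as the equality of two additive maps, only have to be
  checked on terms.
\<close>

lemma poly_mapping_additive_induct [case_names single add]:
  assumes single: "\<And>m c. P (Poly_Mapping.single m c)"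
    and add: "\<And>f g. P f \<Longrightarrow> P g \<Longrightarrow> P (f + g)"
  shows "P (f :: 'm \<Rightarrow>\<^sub>0 'c::comm_monoid_add)"
proof -
  have "P (\<Sum>m\<in>A. Poly_Mapping.single m (Poly_Mapping.lookup f m))" if "finite A" for A
    using that
  proof (induction A)
    case empty
    show ?case using single[of _ 0] by simp
  qed (simp add: single add)
  from this[of "Poly_Mapping.keys f"] show ?thesis
    by (metis finite_keys poly_mapping_eq_sum_single)
qed

lemma var_UNIV: "(UNIV :: var set) = {VX, VY, VZ, VU, VV, VW}"
  using var.exhaust by auto

instance var :: finite
  by standard (simp add: var_UNIV)

lemma prod_var: "(\<Prod>i\<in>(UNIV :: var set). h i) = h VX * h VY * h VZ * h VU * h VV * (h VW :: 'a::comm_monoid_mult)"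
  by (simp add: var_UNIV mult.assoc)

text \<open>
  The evaluation homomorphism that sends the coefficients through \<open>\<iota>\<close> and the variable \<open>i\<close> to \<open>g i\<close>. It
  is used for all the homomorphisms from the polynomial ring that occur below.
\<close>

definition eval_poly :: "('k \<Rightarrow> 'a) \<Rightarrow> ('v \<Rightarrow> 'a) \<Rightarrow> (('v::finite \<Rightarrow>\<^sub>0 nat) \<Rightarrow>\<^sub>0 'k::comm_ring_1) \<Rightarrow> 'a::comm_ring_1"
  where "eval_poly \<iota> g f =
    (\<Sum>m\<in>Poly_Mapping.keys f. \<iota> (Poly_Mapping.lookup f m) * (\<Prod>i\<in>UNIV. g i ^ Poly_Mapping.lookup m i))"

lemma (in comm_ring_hom) eval_poly_single:
  "eval_poly hom g (Poly_Mapping.single m c) = hom c * (\<Prod>i\<in>UNIV. g i ^ Poly_Mapping.lookup m i)"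
  by (simp add: eval_poly_def)

lemma (in comm_ring_hom) eval_poly_add: "eval_poly hom g (f + h) = eval_poly hom g f + eval_poly hom g h"
  unfolding eval_poly_def
  by (rule setsum_keys_plus_distrib) (simp_all add: hom_add distrib_right)

lemma (in comm_ring_hom) eval_poly_mult: "eval_poly hom g (f * h) = eval_poly hom g f * eval_poly hom g h"
proof (induction f rule: poly_mapping_additive_induct)
  case (single m c)
  show ?case
  proof (induction h rule: poly_mapping_additive_induct)
    case (single n d)
    show ?case
      by (simp add: mult_single eval_poly_single hom_mult lookup_add power_add
          prod.distrib mult_ac)
  qed (simp add: distrib_left eval_poly_add)
qed (simp add: distrib_right eval_poly_add)

lemma (in comm_ring_hom) comm_ring_hom_eval_poly: "comm_ring_hom (eval_poly hom g)"
proof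
  show "eval_poly hom g 1 = 1"
    by (simp add: eval_poly_single flip: single_one)
  show "eval_poly hom g 0 = 0"
    by (simp add: eval_poly_def)
qed (simp_all add: eval_poly_add eval_poly_mult)

lemma comm_ring_hom_single: "comm_ring_hom (Poly_Mapping.single (0 :: 'm::comm_monoid_add))"
  by standard (simp_all add: single_add mult_single)

lemma eval_poly_comp:
  assumes h: "comm_ring_hom h"
  shows "h (eval_poly \<iota> g f) = eval_poly (\<lambda>c. h (\<iota> c)) (\<lambda>i. h (g i)) f"
proof -
  interpret comm_ring_hom h by fact
  show ?thesis
    by (simp add: eval_poly_def hom_sum hom_mult hom_prod hom_power)
qed

lemma eval_poly_var:
  assumes "comm_ring_hom \<iota>"
  shows "eval_poly \<iota> g (pvar i) = g i"
proof -
  interpret comm_ring_hom \<iota> by fact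
  show ?thesis
    by (cases i) (simp_all add: pvar_def eval_poly_single hom_one prod_var lookup_single when_def)
qed

lemma pvar_power: "pvar i ^ n = Poly_Mapping.single (Poly_Mapping.single i n) (1 :: 'k::field)"
  by (induction n) (simp_all add: pvar_def mult_single flip: single_add)

lemma single_eq_monomial:
  "Poly_Mapping.single m (c :: 'k::field) = Poly_Mapping.single 0 c * (\<Prod>i\<in>UNIV. pvar i ^ Poly_Mapping.lookup m i)"
proof -
  have m: "Poly_Mapping.single VX (Poly_Mapping.lookup m VX) + Poly_Mapping.single VY (Poly_Mapping.lookup m VY)
       + Poly_Mapping.single VZ (Poly_Mapping.lookup m VZ) + Poly_Mapping.single VU (Poly_Mapping.lookup m VU)
       + Poly_Mapping.single VV (Poly_Mapping.lookup m VV) + Poly_Mapping.single VW (Poly_Mapping.lookup m VW) = m"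
    by (rule poly_mapping_eqI, rename_tac i, case_tac i) (simp_all add: lookup_add lookup_single when_def)
  show ?thesis
    by (simp add: prod_var pvar_power mult_single m)
qed

lemma CHAR_poly_mapping: "CHAR(('m::comm_monoid_add) \<Rightarrow>\<^sub>0 'k::comm_ring_1) = CHAR('k)"
proof (rule CHAR_eqI)
  show "of_nat CHAR('k) = (0 :: 'm \<Rightarrow>\<^sub>0 'k)"
    by (metis of_nat_CHAR single_of_nat single_zero)
  show "CHAR('k) dvd n" if "of_nat n = (0 :: 'm \<Rightarrow>\<^sub>0 'k)" for n
  proof -
    have "of_nat n = Poly_Mapping.lookup (of_nat n :: 'm \<Rightarrow>\<^sub>0 'k) 0"
      by (simp add: lookup_of_nat)
    also have "\<dots> = 0"
      by (subst that) simp
    finally show ?thesis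
      by (simp only: of_nat_eq_0_iff_char_dvd)
  qed
qed

lemma CHAR_fract: "CHAR('a::idom fract) = CHAR('a)"
proof (rule CHAR_eqI)
  have of_nat: "of_nat n = Fract (of_nat n :: 'a) 1" for n
    by (simp add: of_nat_fract)
  show "of_nat CHAR('a) = (0 :: 'a fract)"
    by (simp add: of_nat Zero_fract_def)
  show "CHAR('a) dvd n" if "of_nat n = (0 :: 'a fract)" for n
    using that by (simp add: of_nat Zero_fract_def eq_fract of_nat_eq_0_iff_char_dvd)
qed

section \<open>Frobenius splittings of polynomial rings\<close>

text \<open>
  The field acts on itself through the \<open>e\<close>-th power of Frobenius, \<open>r \<cdot> s = r^(p^e) s\<close>, and a map that is
  \<open>p^(-e)\<close>-linear is a linear form for this structure. Such a form is prescribed freely on a nonzero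
  vector.
\<close>

lemma exists_frobenius_linear_form:
  fixes c :: "'k::field"
  assumes p: "Factorial_Ring.prime CHAR('k)" and c: "c \<noteq> 0"
  obtains l :: "'k \<Rightarrow> 'k" where "\<And>a b. l (a + b) = l a + l b"
    "\<And>r s. l (r ^ (CHAR('k) ^ e) * s) = r * l s" "l c = 1"
proof -
  define q where "q = CHAR('k) ^ e"
  have dream: "(a + b) ^ q = a ^ q + b ^ q" for a b :: 'k
    unfolding q_def by (rule freshmans_dream'[OF p refl])
  interpret F: vector_space "\<lambda>r s. r ^ q * s :: 'k"
    by standard (simp_all only: distrib_left distrib_right dream power_mult_distrib mult.assoc
        power_one mult_1)
  interpret vector_space_pair "\<lambda>r s. r ^ q * s :: 'k" "(*) :: 'k \<Rightarrow> 'k \<Rightarrow> 'k"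
    by standard (simp_all only: distrib_left distrib_right mult.assoc mult_1)
  have "F.independent {c}"
    using c by simp
  then obtain g where g: "Vector_Spaces.linear (\<lambda>r s. r ^ q * s :: 'k) (*) g" "g c = 1"
    using linear_independent_extend[of "{c}" "\<lambda>_. 1"] by auto
  interpret g: Vector_Spaces.linear "\<lambda>r s. r ^ q * s :: 'k" "(*)" g
    by (rule g(1))
  show thesis
    by (rule that[of g]) (simp_all add: g.add g.scale g(2) flip: q_def)
qed

definition scale_exponents :: "nat \<Rightarrow> ('v \<Rightarrow>\<^sub>0 nat) \<Rightarrow> 'v \<Rightarrow>\<^sub>0 nat" where
  "scale_exponents q = Poly_Mapping.map ((*) q)"

lemma lookup_scale_exponents:
  "Poly_Mapping.lookup (scale_exponents q m) i = q * Poly_Mapping.lookup m i"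
  by (simp add: scale_exponents_def Poly_Mapping.map.rep_eq when_def)

lemma single_power:
  "Poly_Mapping.single m (c :: 'k::comm_ring_1) ^ q = Poly_Mapping.single (scale_exponents q m) (c ^ q)"
proof (induction q)
  case 0
  have "scale_exponents 0 m = 0"
    by (rule poly_mapping_eqI) (simp add: lookup_scale_exponents)
  thus ?case by simp
next
  case (Suc q)
  have "m + scale_exponents q m = scale_exponents (Suc q) m"
    by (rule poly_mapping_eqI) (simp add: lookup_scale_exponents lookup_add)
  with Suc show ?case
    by (simp add: mult_single)
qed

text \<open>
  Choose \<open>q = p^e\<close> larger than all exponents in \<open>c\<close> and a monomial \<open>\<alpha>\<close> of \<open>c\<close>. Let \<open>\<phi>\<close> send the
  term \<open>d X^(\<alpha> + q k)\<close> to \<open>l(d) X^k\<close> and kill the other terms, where \<open>l\<close> is a \<open>p^(-e)\<close>-linear form on the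
  field. No other monomial of \<open>c\<close> is congruent to \<open>\<alpha>\<close> modulo \<open>q\<close>, so \<open>\<phi>\<close> sees a single coefficient
  of \<open>c\<close>.
\<close>

lemma polynomial_frobenius_splitting:
  fixes c :: "('v::finite \<Rightarrow>\<^sub>0 nat) \<Rightarrow>\<^sub>0 'k::field"
  assumes p: "Factorial_Ring.prime CHAR('k)" and c: "c \<noteq> 0"
  obtains e \<phi> where "e \<ge> 1" "\<And>f g. \<phi> (f + g) = \<phi> f + \<phi> g"
    "\<And>r s. \<phi> (r ^ (CHAR('k) ^ e) * s) = r * \<phi> s" "\<phi> c = 1"
proof -
  define B where "B = (\<Sum>m\<in>Poly_Mapping.keys c. \<Sum>i\<in>UNIV. Poly_Mapping.lookup m i)"
  define e where "e = Suc B"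
  define q where "q = CHAR('k) ^ e"
  have "B < 2 ^ e"
    unfolding e_def by (meson lessI less_exp less_trans)
  also have "2 ^ e \<le> q"
    unfolding q_def using prime_ge_2_nat[OF p] by (rule power_mono) simp
  finally have Bq: "B < q" .
  have small: "Poly_Mapping.lookup m i < q" if "m \<in> Poly_Mapping.keys c" for m i
  proof -
    have "Poly_Mapping.lookup m i \<le> (\<Sum>i\<in>UNIV. Poly_Mapping.lookup m i)"
      by (rule member_le_sum) auto
    also have "\<dots> \<le> B"
      unfolding B_def by (rule member_le_sum) (use that in auto)
    finally show ?thesis using Bq by simp
  qed
  obtain \<alpha> where \<alpha>: "\<alpha> \<in> Poly_Mapping.keys c"
    using c by (metis ex_in_conv keys_eq_empty)
  then have "Poly_Mapping.lookup c \<alpha> \<noteq> 0"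
    by (simp add: in_keys_iff)
  then obtain l where l: "\<And>a b. l (a + b) = l a + l b" "\<And>r s. l (r ^ q * s) = r * l s"
    "l (Poly_Mapping.lookup c \<alpha>) = 1"
    by (rule exists_frobenius_linear_form[OF p, where e = e, folded q_def]) (rule that)
  have "q > 0"
    using Bq by simp
  have l0: "l 0 = 0"
    using l(2)[of 0 0] \<open>q > 0\<close> by (simp add: power_0_left)
  define shift where "shift k = \<alpha> + scale_exponents q k" for k
  have lookup_shift: "Poly_Mapping.lookup (shift k) i = Poly_Mapping.lookup \<alpha> i + q * Poly_Mapping.lookup k i" for k i
    by (simp add: shift_def lookup_add lookup_scale_exponents)
  have shift_inj: "inj shift"
  proof (rule injI, rule poly_mapping_eqI)
    fix k k' i assume "shift k = shift k'"
    hence "Poly_Mapping.lookup (shift k) i = Poly_Mapping.lookup (shift k') i" by simp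
    thus "Poly_Mapping.lookup k i = Poly_Mapping.lookup k' i"
      using \<open>q > 0\<close> by (simp add: lookup_shift)
  qed
  define \<phi> where "\<phi> f = Poly_Mapping.map l (Poly_Mapping.map_key shift f)" for f
  have lookup_\<phi>: "Poly_Mapping.lookup (\<phi> f) k = l (Poly_Mapping.lookup f (shift k))" for f k
    by (simp add: \<phi>_def Poly_Mapping.map.rep_eq Poly_Mapping.map_key.rep_eq[OF shift_inj] when_def l0)
  have add: "\<phi> (f + g) = \<phi> f + \<phi> g" for f g
    by (rule poly_mapping_eqI) (simp add: lookup_\<phi> lookup_add l(1))
  have \<phi>_single: "\<phi> (Poly_Mapping.single (shift k) d) = Poly_Mapping.single k (l d)" for k d
    using shift_inj by (intro poly_mapping_eqI) (auto simp: lookup_\<phi> lookup_single when_def l0 inj_eq)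
  have \<phi>_single_0: "\<phi> (Poly_Mapping.single m d) = 0" if "\<And>k. m \<noteq> shift k" for m d
    using that by (intro poly_mapping_eqI) (auto simp: lookup_\<phi> lookup_single when_def l0)
  have single_case: "\<phi> (Poly_Mapping.single m a ^ q * Poly_Mapping.single n d)
      = Poly_Mapping.single m a * \<phi> (Poly_Mapping.single n d)" for m n a d
  proof (cases "\<exists>k. n = shift k")
    case True
    then obtain k where k: "n = shift k" by blast
    have "scale_exponents q m + n = shift (m + k)"
      by (rule poly_mapping_eqI) (simp add: k lookup_shift lookup_add lookup_scale_exponents algebra_simps)
    thus ?thesis
      by (simp add: single_power mult_single \<phi>_single l(2) k)
  next
    case False
    \<comment> \<open>The exponents of \<open>\<alpha>\<close> are below \<open>q\<close>, so \<open>\<alpha>\<close> can be subtracted from every monomial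
       congruent to it.\<close>
    have "scale_exponents q m + n \<noteq> shift k" for k
    proof
      assume eq: "scale_exponents q m + n = shift k"
      have eq': "q * Poly_Mapping.lookup m i + Poly_Mapping.lookup n i
          = Poly_Mapping.lookup \<alpha> i + q * Poly_Mapping.lookup k i" for i
        using arg_cong[OF eq, of "\<lambda>h. Poly_Mapping.lookup h i"]
        by (simp add: lookup_add lookup_scale_exponents lookup_shift)
      have "Poly_Mapping.lookup m i \<le> Poly_Mapping.lookup k i" for i
      proof (rule ccontr)
        assume "\<not> ?thesis"
        hence "q * Suc (Poly_Mapping.lookup k i) \<le> q * Poly_Mapping.lookup m i"
          by (intro mult_le_mono) auto
        thus False
          using eq'[of i] small[OF \<alpha>, of i] by simp
      qed
      hence le: "q * Poly_Mapping.lookup m i \<le> q * Poly_Mapping.lookup k i" for i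
        by simp
      have "n = shift (k - m)"
      proof (rule poly_mapping_eqI)
        fix i
        show "Poly_Mapping.lookup n i = Poly_Mapping.lookup (shift (k - m)) i"
          using eq'[of i] le[of i] by (simp add: lookup_shift lookup_minus diff_mult_distrib2)
      qed
      with False show False by blast
    qed
    thus ?thesis
      using False by (simp add: single_power mult_single \<phi>_single_0)
  qed
  have frob: "(f + g) ^ q = f ^ q + g ^ q" for f g :: "('v \<Rightarrow>\<^sub>0 nat) \<Rightarrow>\<^sub>0 'k"
    unfolding q_def by (rule freshmans_dream') (simp_all add: CHAR_poly_mapping p)
  have linear: "\<phi> (r ^ q * s) = r * \<phi> s" for r s
  proof (induction r rule: poly_mapping_additive_induct)
    case (single m a)
    show ?case
      by (induction s rule: poly_mapping_additive_induct) (simp_all add: single_case distrib_left add)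
  qed (simp add: frob distrib_right add)
  have "\<phi> c = 1"
  proof (rule poly_mapping_eqI)
    fix k
    show "Poly_Mapping.lookup (\<phi> c) k = Poly_Mapping.lookup 1 k"
    proof (cases "k = 0")
      case True
      have "shift 0 = \<alpha>"
        by (rule poly_mapping_eqI) (simp add: lookup_shift)
      thus ?thesis by (simp add: lookup_\<phi> True l(3))
    next
      case False
      then obtain i where "Poly_Mapping.lookup k i \<noteq> 0"
        by (metis lookup_zero poly_mapping_eqI)
      hence "q \<le> Poly_Mapping.lookup (shift k) i"
        by (simp add: lookup_shift trans_le_add2)
      hence "shift k \<notin> Poly_Mapping.keys c"
        using small leD by blast
      thus ?thesis
        using False by (simp add: lookup_\<phi> in_keys_iff l0 lookup_one)
    qed
  qed
  show thesis
    by (rule that[of e \<phi>]) (use add linear \<open>\<phi> c = 1\<close> in \<open>simp_all add: e_def q_def\<close>)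
qed

section \<open>The quotient presentation\<close>

abbreviation const :: "'k::comm_ring_1 \<Rightarrow> ('m::comm_monoid_add) \<Rightarrow>\<^sub>0 'k" where
  "const \<equiv> Poly_Mapping.single 0"

text \<open>
  The target of the homomorphism \<open>cover\<close> is the polynomial ring in \<open>a, b, w\<close>, realised inside the given
  polynomial ring with \<open>a\<close>, \<open>b\<close>, \<open>w\<close> in the places of the variables \<open>VX\<close>, \<open>VY\<close>, \<open>VW\<close>. The three forms
  \<open>ab\<close>, \<open>a^4 + b^4\<close>, \<open>a^4 - b^4\<close> are the semi-invariants of the dihedral group of order 8, and vanish on
  its three special orbits.
\<close>

definition edge_form :: "'k::field poly6" where
  "edge_form = pvar VX * pvar VY"

definition plus_form :: "'k::field poly6" where
  "plus_form = pvar VX ^ 4 + pvar VY ^ 4"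

definition minus_form :: "'k::field poly6" where
  "minus_form = pvar VX ^ 4 - pvar VY ^ 4"

primrec cover_var :: "var \<Rightarrow> 'k::field poly6" where
  "cover_var VX = edge_form * plus_form * minus_form"
| "cover_var VY = - (edge_form\<^sup>2 * plus_form ^ 4)"
| "cover_var VZ = - (edge_form\<^sup>2 * minus_form ^ 4)"
| "cover_var VU = plus_form ^ 10"
| "cover_var VV = 0"
| "cover_var VW = pvar VW"

definition cover :: "'k::field poly6 \<Rightarrow> 'k poly6" where
  "cover = eval_poly const cover_var"

interpretation cover: comm_ring_hom "cover :: 'k::field poly6 \<Rightarrow> 'k poly6"
  unfolding cover_def
  by (rule comm_ring_hom.comm_ring_hom_eval_poly[OF comm_ring_hom_single])

lemma cover_pvar: "cover (pvar i) = cover_var i"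
  unfolding cover_def by (rule eval_poly_var[OF comm_ring_hom_single])

lemma cover_const: "cover (const c) = const c"
  unfolding cover_def
  by (simp add: comm_ring_hom.eval_poly_single[OF comm_ring_hom_single])

lemma three_eq_0: "CHAR('k::comm_ring_1) = 3 \<Longrightarrow> 3 = (0 :: ('m::comm_monoid_add) \<Rightarrow>\<^sub>0 'k)"
  by (metis CHAR_poly_mapping of_nat_CHAR of_nat_numeral)

text \<open>
  This is \<open>(A + B)\<^sup>2 - (A - B)\<^sup>2 = 4 A B\<close> with \<open>A = a^4\<close> and \<open>B = b^4\<close>; in characteristic 3 the factor
  4 disappears.
\<close>

lemma edge_form_power_4:
  assumes "CHAR('k::field) = 3"
  shows "edge_form ^ 4 = plus_form\<^sup>2 - (minus_form :: 'k poly6)\<^sup>2"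
proof -
  have "plus_form\<^sup>2 - minus_form\<^sup>2 = edge_form ^ 4 + 3 * (edge_form :: 'k poly6) ^ 4"
    unfolding edge_form_def plus_form_def minus_form_def by Groebner_Basis.algebra
  thus ?thesis by (simp add: three_eq_0[OF assms])
qed

lemma range_cover_add: "f \<in> range cover \<Longrightarrow> g \<in> range cover \<Longrightarrow> f + g \<in> range cover"
  by (auto simp flip: cover.hom_add)

lemma range_cover_diff: "f \<in> range cover \<Longrightarrow> g \<in> range cover \<Longrightarrow> f - g \<in> range cover"
  by (auto simp flip: cover.hom_minus)

lemma range_cover_uminus: "f \<in> range cover \<Longrightarrow> - f \<in> range cover"
  by (auto simp flip: cover.hom_uminus)

lemma range_cover_mult: "f \<in> range cover \<Longrightarrow> g \<in> range cover \<Longrightarrow> f * g \<in> range cover"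
  by (auto simp flip: cover.hom_mult)

lemma range_cover_power: "f \<in> range cover \<Longrightarrow> f ^ n \<in> range cover"
  by (auto simp flip: cover.hom_power)

lemma range_cover_one: "1 \<in> range cover"
  by (metis cover.hom_one rangeI)

lemma range_cover_zero: "0 \<in> range cover"
  by (metis cover.hom_zero rangeI)

lemma range_cover_const: "const c \<in> range cover"
  by (metis cover_const rangeI)

lemmas range_cover_closed = range_cover_add range_cover_diff range_cover_uminus range_cover_mult
  range_cover_power range_cover_one range_cover_zero range_cover_const

lemma cover_var_in_range: "cover_var i \<in> range cover"
  by (metis cover_pvar rangeI)

text \<open>
  The range contains \<open>\<alpha>^10\<close>. The relation \<open>g^4 = \<alpha>\<^sup>2 - \<beta>\<^sup>2\<close> lets one trade \<open>\<alpha>\<^sup>2\<close> for \<open>\<beta>\<^sup>2\<close> at the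
  cost of a term divisible by \<open>g^4\<close>, and at each step that term is a monomial in the images of
  \<open>x, y, z\<close>.
\<close>

lemma forms_of_degree_10_in_range:
  assumes "CHAR('k::field) = 3"
  shows "plus_form ^ 8 * minus_form ^ 2 \<in> range (cover :: 'k poly6 \<Rightarrow> _)" (is ?P8)
    and "plus_form ^ 6 * minus_form ^ 4 \<in> range (cover :: 'k poly6 \<Rightarrow> _)" (is ?P6)
    and "plus_form ^ 4 * minus_form ^ 6 \<in> range (cover :: 'k poly6 \<Rightarrow> _)" (is ?P4)
    and "plus_form ^ 2 * minus_form ^ 8 \<in> range (cover :: 'k poly6 \<Rightarrow> _)" (is ?P2)
    and "minus_form ^ 10 \<in> range (cover :: 'k poly6 \<Rightarrow> _)" (is ?P0)
proof -
  note closed = range_cover_closed cover_var_in_range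
  let ?x = "cover_var VX :: 'k poly6" and ?y = "cover_var VY :: 'k poly6"
    and ?z = "cover_var VZ :: 'k poly6" and ?u = "cover_var VU :: 'k poly6"
  note e4 = edge_form_power_4[OF assms]
  have "plus_form ^ 8 * minus_form ^ 2 = ?u - ?y\<^sup>2"
    using e4 by simp Groebner_Basis.algebra
  thus P8: ?P8 by (simp only: closed)
  have "plus_form ^ 6 * minus_form ^ 4 = plus_form ^ 8 * minus_form ^ 2 + ?x\<^sup>2 * ?y"
    using e4 by simp Groebner_Basis.algebra
  thus P6: ?P6 by (simp only: closed P8)
  have "plus_form ^ 4 * minus_form ^ 6 = plus_form ^ 6 * minus_form ^ 4 - ?x ^ 4"
    using e4 by simp Groebner_Basis.algebra
  thus P4: ?P4 by (simp only: closed P6)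
  have "plus_form ^ 2 * minus_form ^ 8 = plus_form ^ 4 * minus_form ^ 6 + ?x\<^sup>2 * ?z"
    using e4 by simp Groebner_Basis.algebra
  thus P2: ?P2 by (simp only: closed P4)
  have "minus_form ^ 10 = plus_form ^ 2 * minus_form ^ 8 - ?z\<^sup>2"
    using e4 by simp Groebner_Basis.algebra
  thus P0: ?P0 by (simp only: closed P2)
qed

text \<open>
  Split off factors \<open>\<alpha>^10\<close> and \<open>\<beta>^10\<close> until both exponents are less than 10; their sum is then 10 or 0.
\<close>

lemma even_forms_in_range:
  assumes "CHAR('k::field) = 3" "s + t = 10 * m" "even s"
  shows "plus_form ^ s * minus_form ^ t \<in> range (cover :: 'k poly6 \<Rightarrow> _)"
  using assms(2,3)
proof (induction m arbitrary: s t)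
  case 0
  thus ?case by (simp add: range_cover_closed)
next
  case (Suc m)
  have "even t"
    using Suc.prems by presburger
  consider "s \<ge> 10" | "t \<ge> 10" | "s < 10" "t < 10" by linarith
  thus ?case
  proof cases
    case 1
    define s' where "s' = s - 10"
    have s: "s = 10 + s'" using 1 by (simp add: s'_def)
    have "plus_form ^ s' * minus_form ^ t \<in> range (cover :: 'k poly6 \<Rightarrow> _)"
      by (rule Suc.IH) (use Suc.prems s in auto)
    hence "cover_var VU * (plus_form ^ s' * minus_form ^ t) \<in> range (cover :: 'k poly6 \<Rightarrow> _)"
      by (rule range_cover_mult[OF cover_var_in_range])
    thus ?thesis by (simp add: s power_add mult_ac)
  next
    case 2
    define t' where "t' = t - 10"
    have t: "t = 10 + t'" using 2 by (simp add: t'_def)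
    have "plus_form ^ s * minus_form ^ t' \<in> range (cover :: 'k poly6 \<Rightarrow> _)"
      by (rule Suc.IH) (use Suc.prems t in auto)
    hence "minus_form ^ 10 * (plus_form ^ s * minus_form ^ t') \<in> range (cover :: 'k poly6 \<Rightarrow> _)"
      by (rule range_cover_mult[OF forms_of_degree_10_in_range(5)[OF assms(1)]])
    thus ?thesis by (simp add: t power_add mult_ac)
  next
    case 3
    hence "(s, t) = (8, 2) \<or> (s, t) = (6, 4) \<or> (s, t) = (4, 6) \<or> (s, t) = (2, 8)"
    proof -
      obtain a b where ab: "s = 2 * a" "t = 2 * b"
        using Suc.prems \<open>even t\<close> by (meson evenE)
      have "a < 5" "b < 5" "a + b = 5 + 5 * m"
        using 3 Suc.prems(1) by (simp_all add: ab)
      moreover from this have "m = 0"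
        by (cases m) simp_all
      ultimately have "a + b = 5" by simp
      hence "a = 4 \<and> b = 1 \<or> a = 3 \<and> b = 2 \<or> a = 2 \<and> b = 3 \<or> a = 1 \<and> b = 4"
        using \<open>a < 5\<close> \<open>b < 5\<close> by linarith
      thus ?thesis by (auto simp: ab)
    qed
    thus ?thesis
      using forms_of_degree_10_in_range[OF assms(1)] by auto
  qed
qed

text \<open>
  The congruences say that the group fixes this monomial in \<open>g, \<alpha>, \<beta>\<close>; the bound on \<open>r\<close> is harmless
  because \<open>g^4\<close> is a polynomial in \<open>\<alpha>\<close> and \<open>\<beta>\<close>. An odd \<open>r\<close> allows to split off the image \<open>g \<alpha> \<beta>\<close> of \<open>x\<close>, and \<open>r = 2\<close> the image of \<open>y\<close>, of \<open>z\<close> or of \<open>x\<^sup>2\<close>.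
\<close>

lemma forms_in_range:
  assumes char: "CHAR('k::field) = 3" and "r \<le> 3" and st: "(s + t) mod 10 = 2 * r" and s: "s mod 2 = r mod 2"
  shows "edge_form ^ r * plus_form ^ s * minus_form ^ t \<in> range (cover :: 'k poly6 \<Rightarrow> _)"
proof -
  define m where "m = (s + t) div 10"
  have eq: "s + t = 10 * m + 2 * r"
    using st by (metis m_def div_mod_decomp_int div_mult_mod_eq mult.commute)
  have two: "edge_form ^ 2 * plus_form ^ s * minus_form ^ t \<in> range (cover :: 'k poly6 \<Rightarrow> _)"
    if eq: "s + t = 10 * m + 4" and s: "even s" for s t
  proof -
    have "even t"
      using that by presburger
    have "(s = 2 \<and> t = 2 \<or> 4 \<le> s) \<or> 4 \<le> t"
    proof (rule ccontr)
      assume *: "\<not> ?thesis"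
      hence "s < 4" "t < 4" by auto
      moreover have "s \<noteq> 3" "t \<noteq> 3"
        using s \<open>even t\<close> by auto
      ultimately have "s \<le> 2" "t \<le> 2"
        by linarith+
      with eq * show False by linarith
    qed
    then consider "s = 2" "t = 2" | "4 \<le> s" | "4 \<le> t" by blast
    thus ?thesis
    proof cases
      case 1
      have "(cover_var VX)\<^sup>2 \<in> range (cover :: 'k poly6 \<Rightarrow> _)"
        by (intro range_cover_closed cover_var_in_range)
      thus ?thesis by (simp add: 1 power_mult_distrib)
    next
      case 2
      define s' where "s' = s - 4"
      have s': "s = 4 + s'" using 2 by (simp add: s'_def)
      have "plus_form ^ s' * minus_form ^ t \<in> range (cover :: 'k poly6 \<Rightarrow> _)"
        by (rule even_forms_in_range[OF char, of _ _ m]) (use eq s s' in auto)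
      hence "- (cover_var VY * (plus_form ^ s' * minus_form ^ t)) \<in> range (cover :: 'k poly6 \<Rightarrow> _)"
        by (intro range_cover_uminus range_cover_mult[OF cover_var_in_range])
      thus ?thesis by (simp add: s' power_add mult_ac)
    next
      case 3
      define t' where "t' = t - 4"
      have t': "t = 4 + t'" using 3 by (simp add: t'_def)
      have "plus_form ^ s * minus_form ^ t' \<in> range (cover :: 'k poly6 \<Rightarrow> _)"
        by (rule even_forms_in_range[OF char, of _ _ m]) (use eq s t' in auto)
      hence "- (cover_var VZ * (plus_form ^ s * minus_form ^ t')) \<in> range (cover :: 'k poly6 \<Rightarrow> _)"
        by (intro range_cover_uminus range_cover_mult[OF cover_var_in_range])
      thus ?thesis by (simp add: t' power_add mult_ac)
    qed
  qed
  consider "r = 0" | "r = 1" | "r = 2" | "r = 3"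
    using \<open>r \<le> 3\<close> by linarith
  thus ?thesis
  proof cases
    case 1
    thus ?thesis
      using even_forms_in_range[OF char, of s t m] eq s by (simp add: even_iff_mod_2_eq_zero)
  next
    case 3
    thus ?thesis
      using two[of s t] eq s by (simp add: even_iff_mod_2_eq_zero)
  next
    case 2
    have "odd s"
      using s 2 by (simp add: odd_iff_mod_2_eq_one)
    moreover have "odd t"
      using eq 2 \<open>odd s\<close> by presburger
    ultimately obtain s' t' where s': "s = Suc s'" "even s'" and t': "t = Suc t'"
      by (metis odd_Suc_minus_one even_Suc)
    have "plus_form ^ s' * minus_form ^ t' \<in> range (cover :: 'k poly6 \<Rightarrow> _)"
      by (rule even_forms_in_range[OF char, of _ _ m]) (use eq s' t' 2 in auto)
    hence "cover_var VX * (plus_form ^ s' * minus_form ^ t') \<in> range (cover :: 'k poly6 \<Rightarrow> _)"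
      by (rule range_cover_mult[OF cover_var_in_range])
    thus ?thesis by (simp add: 2 s' t' mult_ac)
  next
    case 4
    have "odd s"
      using s 4 by (simp add: odd_iff_mod_2_eq_one)
    moreover have "odd t"
      using eq 4 \<open>odd s\<close> by presburger
    ultimately obtain s' t' where s': "s = Suc s'" "even s'" and t': "t = Suc t'"
      by (metis odd_Suc_minus_one even_Suc)
    have "edge_form ^ 2 * plus_form ^ s' * minus_form ^ t' \<in> range (cover :: 'k poly6 \<Rightarrow> _)"
      by (rule two) (use eq s' t' 4 in auto)
    hence "cover_var VX * (edge_form ^ 2 * plus_form ^ s' * minus_form ^ t') \<in> range (cover :: 'k poly6 \<Rightarrow> _)"
      by (rule range_cover_mult[OF cover_var_in_range])
    thus ?thesis by (simp add: 4 s' t' mult_ac power3_eq_cube power2_eq_square)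
  qed
qed

section \<open>The invariants and their Reynolds operator\<close>

text \<open>
  The span of the monomials \<open>\<alpha>^s \<beta>^t\<close> of degree \<open>s + t = D\<close> with \<open>t\<close> of the same parity as \<open>\<epsilon>\<close>. Exchanging
  \<open>a\<close> and \<open>b\<close> fixes \<open>\<alpha>\<close> and negates \<open>\<beta>\<close>, so these are its eigenspaces on the forms of degree \<open>D\<close> in
  \<open>a^4\<close> and \<open>b^4\<close>.
\<close>

inductive_set parity_forms :: "nat \<Rightarrow> nat \<Rightarrow> 'k::field poly6 set" for D \<epsilon> where
  zero: "0 \<in> parity_forms D \<epsilon>"
| form: "s + t = D \<Longrightarrow> even (t + \<epsilon>) \<Longrightarrow> plus_form ^ s * minus_form ^ t \<in> parity_forms D \<epsilon>"
| add: "f \<in> parity_forms D \<epsilon> \<Longrightarrow> g \<in> parity_forms D \<epsilon> \<Longrightarrow> f + g \<in> parity_forms D \<epsilon>"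
| uminus: "f \<in> parity_forms D \<epsilon> \<Longrightarrow> - f \<in> parity_forms D \<epsilon>"

lemma parity_forms_plus: "f \<in> parity_forms D \<epsilon> \<Longrightarrow> plus_form * f \<in> parity_forms (Suc D) \<epsilon>"
proof (induction rule: parity_forms.induct)
  case (form s t)
  thus ?case using parity_forms.form[of "Suc s" t "Suc D" \<epsilon>] by (simp add: mult_ac)
qed (auto simp: distrib_left intro: parity_forms.intros)

lemma parity_forms_minus: "f \<in> parity_forms D \<epsilon> \<Longrightarrow> even (\<epsilon> + Suc \<epsilon>') \<Longrightarrow> minus_form * f \<in> parity_forms (Suc D) \<epsilon>'"
proof (induction rule: parity_forms.induct)
  case (form s t)
  hence "even (Suc t + \<epsilon>')" by presburger
  thus ?case using form parity_forms.form[of s "Suc t" "Suc D" \<epsilon>'] by (simp add: mult_ac)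
qed (auto simp: distrib_left intro: parity_forms.intros)

lemma parity_forms_diff:
  "f \<in> parity_forms D \<epsilon> \<Longrightarrow> g \<in> parity_forms D \<epsilon> \<Longrightarrow> f - g \<in> parity_forms D \<epsilon>"
  using parity_forms.add[OF _ parity_forms.uminus, of f D \<epsilon> g] by simp

text \<open>
  The forms \<open>f\<close> and \<open>g\<close> are exchanged by \<open>\<beta> \<mapsto> - \<beta>\<close>; the decomposition into eigenvectors is part of the
  definition because it is what the relation is used for.
\<close>

definition conjugate_forms :: "nat \<Rightarrow> 'k::field poly6 \<Rightarrow> 'k poly6 \<Rightarrow> bool" where
  "conjugate_forms D f g \<longleftrightarrow>
    (\<exists>h0\<in>parity_forms D 0. \<exists>h1\<in>parity_forms D 1. f = h0 + h1 \<and> g = h0 - h1)"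

lemma conjugate_formsI:
  "h0 \<in> parity_forms D 0 \<Longrightarrow> h1 \<in> parity_forms D 1 \<Longrightarrow> f = h0 + h1 \<Longrightarrow> g = h0 - h1 \<Longrightarrow>
    conjugate_forms D f g"
  unfolding conjugate_forms_def by blast

lemma conjugate_forms_step:
  assumes "conjugate_forms D f g"
  shows "conjugate_forms (Suc D) ((plus_form + minus_form) * f) ((plus_form - minus_form) * g)"
    and "conjugate_forms (Suc D) ((plus_form - minus_form) * f) ((plus_form + minus_form) * g)"
proof -
  from assms obtain h0 h1 where h: "h0 \<in> parity_forms D 0" "h1 \<in> parity_forms D 1" "f = h0 + h1" "g = h0 - h1"
    unfolding conjugate_forms_def by blast
  have p: "plus_form * h0 \<in> parity_forms (Suc D) 0" "plus_form * h1 \<in> parity_forms (Suc D) 1"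
    by (intro parity_forms_plus h)+
  have m: "minus_form * h1 \<in> parity_forms (Suc D) 0" "minus_form * h0 \<in> parity_forms (Suc D) 1"
    by (rule parity_forms_minus[OF h(2)] parity_forms_minus[OF h(1)]; simp)+
  show "conjugate_forms (Suc D) ((plus_form + minus_form) * f) ((plus_form - minus_form) * g)"
    by (rule conjugate_formsI[OF parity_forms.add[OF p(1) m(1)] parity_forms.add[OF p(2) m(2)]])
       (simp_all add: h algebra_simps)
  show "conjugate_forms (Suc D) ((plus_form - minus_form) * f) ((plus_form + minus_form) * g)"
    by (rule conjugate_formsI[OF parity_forms_diff[OF p(1) m(1)] parity_forms_diff[OF p(2) m(2)]])
       (simp_all add: h algebra_simps)
qed

lemma conjugate_forms_powers:
  "conjugate_forms (i + j) ((plus_form + minus_form) ^ i * (plus_form - minus_form) ^ j)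
     ((plus_form - minus_form) ^ i * (plus_form + minus_form) ^ j)"
proof (induction i)
  case 0
  show ?case
  proof (induction j)
    case 0
    have "1 \<in> parity_forms 0 0"
      using parity_forms.form[of 0 0 0 0] by simp
    thus ?case
      by (intro conjugate_formsI[OF _ parity_forms.zero]) auto
  next
    case (Suc j)
    from conjugate_forms_step(2)[OF this] show ?case by (simp add: mult_ac)
  qed
next
  case (Suc i)
  from conjugate_forms_step(1)[OF this] show ?case by (simp add: mult_ac)
qed

lemma parity_forms_in_range:
  assumes char: "CHAR('k::field) = 3" and r: "r \<le> 3" "D mod 10 = 2 * r"
    and f: "f \<in> parity_forms D \<epsilon>" and \<epsilon>: "even (r + \<epsilon>)"
  shows "edge_form ^ r * f \<in> range (cover :: 'k poly6 \<Rightarrow> _)"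
  using f
proof (induction rule: parity_forms.induct)
  case (form s t)
  have "even D"
    using r(2) by presburger
  hence "even (s + t)"
    using form by simp
  hence "s mod 2 = r mod 2"
    using form(2) \<epsilon> by presburger
  thus ?case
    using forms_in_range[OF char r(1), of s t] form r by (simp add: mult.assoc)
qed (simp_all add: distrib_left range_cover_closed)

text \<open>
  The congruence says that \<open>a^i b^j\<close> is fixed by the cyclic group of order 40 acting with weights
  \<open>1\<close> and \<open>31 = -9\<close>; the sum symmetrizes it under the quarter turn \<open>a \<mapsto> b\<close>, \<open>b \<mapsto> - a\<close>. Write it as
  \<open>g^r\<close> times a form in \<open>a^4 = - (\<alpha> + \<beta>)\<close> and \<open>b^4 = - (\<alpha> - \<beta>)\<close> (characteristic 3 again): the
  symmetrization leaves only one parity of the exponent of \<open>\<beta>\<close>, and what remains was found in the range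
  already.
\<close>

lemma symmetrized_monomial_in_range:
  assumes char: "CHAR('k::field) = 3" and ij: "(i + 31 * j) mod 40 = 0"
  shows "pvar VX ^ i * pvar VY ^ j + pvar VY ^ i * (- pvar VX) ^ j \<in> range (cover :: 'k poly6 \<Rightarrow> _)"
proof -
  define r i' j' where "r = j mod 4" and "i' = i div 4" and "j' = j div 4"
  have "(i + 31 * j) mod 4 = 0"
    using mod_mod_cancel[of 4 40 "i + 31 * j"] ij by simp
  hence "((i + 31 * j) + j) mod 4 = r"
    unfolding r_def by (subst mod_add_left_eq [symmetric]) simp
  moreover have "(i + 31 * j) + j = i + 8 * j * 4"
    by simp
  ultimately have "i mod 4 = r"
    by (simp only: mod_mult_self1)
  hence i: "i = r + 4 * i'"
    using div_mult_mod_eq[of i 4] unfolding i'_def by linarith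
  have j: "j = r + 4 * j'"
    using div_mult_mod_eq[of j 4] unfolding r_def j'_def by linarith
  have r: "r \<le> 3"
    using mod_less_divisor[of 4 j] by (simp add: r_def)
  have "4 * (8 * r + i' + 31 * j') mod (4 * 10) = 0"
    using ij unfolding i j by (simp add: algebra_simps)
  hence "(8 * r + i' + 31 * j') mod 10 = 0"
    by (simp only: mult_mod_right [symmetric])
  moreover have "8 * r + i' + 31 * j' = 8 * r + (i' + j') + 3 * j' * 10"
    by simp
  ultimately have "(8 * r + (i' + j')) mod 10 = 0"
    by (simp only: mod_mult_self1)
  then obtain k where k: "8 * r + (i' + j') = 10 * k"
    by (auto simp: mod_eq_0_iff_dvd elim: dvdE)
  have "r \<le> k"
    using k r by linarith
  hence n: "i' + j' = 2 * r + 10 * (k - r)"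
    using k by simp
  have D: "(i' + j') mod 10 = 2 * r"
    unfolding n using r by simp
  have "even (i' + j')"
    unfolding n by simp
  let ?a = "pvar VX :: 'k poly6" and ?b = "pvar VY :: 'k poly6"
  have three: "3 * h = 0" for h :: "'k poly6"
    by (simp add: three_eq_0[OF char])
  have "?a ^ 4 + (plus_form + minus_form) = 3 * ?a ^ 4"
    "?b ^ 4 + (plus_form - minus_form) = 3 * ?b ^ 4"
    unfolding plus_form_def minus_form_def by Groebner_Basis.algebra+
  hence a4: "?a ^ 4 = - (plus_form + minus_form)" and b4: "?b ^ 4 = - (plus_form - minus_form)"
    unfolding three by (simp_all only: eq_neg_iff_add_eq_0)
  obtain h0 h1 :: "'k poly6" where h: "h0 \<in> parity_forms (i' + j') 0" "h1 \<in> parity_forms (i' + j') 1"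
    "(plus_form + minus_form) ^ i' * (plus_form - minus_form) ^ j' = h0 + h1"
    "(plus_form - minus_form) ^ i' * (plus_form + minus_form) ^ j' = h0 - h1"
    using conjugate_forms_powers[of i' j'] unfolding conjugate_forms_def
    by (elim bexE conjE) (rule that)
  have neg: "(- f) ^ i' * (- g) ^ j' = f ^ i' * g ^ j'" for f g :: "'k poly6"
    using \<open>even (i' + j')\<close> by (cases "even i'") auto
  have "?a ^ i * ?b ^ j + ?b ^ i * (- ?a) ^ j =
      edge_form ^ r * ((?a ^ 4) ^ i' * (?b ^ 4) ^ j' + (- 1) ^ r * ((?b ^ 4) ^ i' * (?a ^ 4) ^ j'))"
  proof -
    have sign: "(- 1) ^ j = ((- 1) ^ r :: 'k poly6)"
      unfolding j by (simp add: power_add power_mult)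
    have pow: "f ^ (r + 4 * n) = f ^ r * (f ^ 4) ^ n" for f :: "'k poly6" and n
      by (simp only: power_add power_mult)
    show ?thesis
      unfolding power_minus[of ?a j] sign edge_form_def
      by (simp only: i j pow power_mult_distrib) (simp only: distrib_left mult_ac)
  qed
  also have "\<dots> = edge_form ^ r * (h0 + h1 + (- 1) ^ r * (h0 - h1))"
    by (simp only: a4 b4 neg h)
  also have "\<dots> \<in> range (cover :: 'k poly6 \<Rightarrow> _)"
  proof (cases "even r")
    case True
    have "edge_form ^ r * h0 \<in> range cover"
      by (rule parity_forms_in_range[OF char r D h(1)]) (use True in simp)
    from range_cover_add[OF this this] show ?thesis
      using True by (simp add: algebra_simps)
  next
    case False
    have "edge_form ^ r * h1 \<in> range cover"
      by (rule parity_forms_in_range[OF char r D h(2)]) (use False in simp)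
    from range_cover_add[OF this this] show ?thesis
      using False by (simp add: algebra_simps)
  qed
  finally show ?thesis .
qed

text \<open>
  Monomials fixed by the cyclic group of order 40. The variables \<open>VZ, VU, VV\<close> are excluded, so that the
  projection onto these monomials lands in the polynomial ring in \<open>a, b, w\<close>.
\<close>

definition invariant_monomial :: "(var \<Rightarrow>\<^sub>0 nat) \<Rightarrow> bool" where
  "invariant_monomial m \<longleftrightarrow>
     (Poly_Mapping.lookup m VX + 31 * Poly_Mapping.lookup m VY) mod 40 = 0 \<and>
     Poly_Mapping.lookup m VZ = 0 \<and> Poly_Mapping.lookup m VU = 0 \<and> Poly_Mapping.lookup m VV = 0"

text \<open>
  Homogeneity for the \<open>\<int>/40\<close>-grading in which \<open>a\<close> has weight 1, \<open>b\<close> has weight \<open>31\<close> and \<open>w\<close> has weight 0.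
\<close>

definition has_weight :: "nat \<Rightarrow> 'k::field poly6 \<Rightarrow> bool" where
  "has_weight d f \<longleftrightarrow> (\<forall>m\<in>Poly_Mapping.keys f.
     (Poly_Mapping.lookup m VX + 31 * Poly_Mapping.lookup m VY) mod 40 = d mod 40 \<and>
     Poly_Mapping.lookup m VZ = 0 \<and> Poly_Mapping.lookup m VU = 0 \<and> Poly_Mapping.lookup m VV = 0)"

lemma has_weight_add: "has_weight d f \<Longrightarrow> has_weight d g \<Longrightarrow> has_weight d (f + g)"
  unfolding has_weight_def using keys_add[of f g] by blast

lemma has_weight_uminus: "has_weight d f \<Longrightarrow> has_weight d (- f)"
  unfolding has_weight_def by (simp add: in_keys_iff)

lemma has_weight_mult:
  assumes "has_weight d f" "has_weight d' g"
  shows "has_weight (d + d') (f * g)"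
  unfolding has_weight_def
proof
  fix m assume "m \<in> Poly_Mapping.keys (f * g)"
  then obtain a b where m: "m = a + b" "a \<in> Poly_Mapping.keys f" "b \<in> Poly_Mapping.keys g"
    using keys_mult[of f g] by blast
  let ?wt = "\<lambda>m. Poly_Mapping.lookup m VX + 31 * Poly_Mapping.lookup m VY"
  have "?wt m = ?wt a + ?wt b"
    by (simp add: m lookup_add)
  moreover have "?wt a mod 40 = d mod 40" "?wt b mod 40 = d' mod 40"
    using assms m unfolding has_weight_def by simp_all
  ultimately have "?wt m mod 40 = (d + d') mod 40"
    by (metis mod_add_eq)
  thus "?wt m mod 40 = (d + d') mod 40 \<and> Poly_Mapping.lookup m VZ = 0 \<and>
      Poly_Mapping.lookup m VU = 0 \<and> Poly_Mapping.lookup m VV = 0"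
    using assms m unfolding has_weight_def by (simp add: lookup_add)
qed

lemma has_weight_const: "has_weight 0 (const c)"
  by (simp add: has_weight_def)

lemma has_weight_power: "has_weight d f \<Longrightarrow> has_weight (n * d) (f ^ n)"
proof (induction n)
  case 0
  show ?case using has_weight_const[of 1] by simp
next
  case (Suc n)
  from has_weight_mult[OF Suc.prems Suc.IH[OF Suc.prems]] show ?case by simp
qed

lemma has_weight_mod: "has_weight d f \<Longrightarrow> d mod 40 = d' mod 40 \<Longrightarrow> has_weight d' f"
  by (simp add: has_weight_def)

text \<open>
  The forms \<open>g, \<alpha>, \<beta>\<close> have weights \<open>32, 4, 4\<close>, because \<open>4 \<cdot> 31\<close> is 4 modulo 40.
\<close>

lemma has_weight_cover_var: "has_weight 0 (cover_var i)"
proof -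
  have a: "has_weight 1 (pvar VX)" and b: "has_weight 31 (pvar VY)" and w: "has_weight 0 (pvar VW)"
    by (simp_all add: has_weight_def pvar_def lookup_single when_def)
  have g: "has_weight 32 edge_form"
    unfolding edge_form_def using has_weight_mult[OF a b] by simp
  have a4: "has_weight 4 (pvar VX ^ 4)"
    using has_weight_power[OF a, of 4] by simp
  have b4: "has_weight 4 (pvar VY ^ 4)"
    using has_weight_mod[OF has_weight_power[OF b, of 4], of 4] by simp
  have p: "has_weight 4 plus_form"
    unfolding plus_form_def by (rule has_weight_add[OF a4 b4])
  have m: "has_weight 4 minus_form"
    unfolding minus_form_def using has_weight_add[OF a4 has_weight_uminus[OF b4]] by simp
  show ?thesis
  proof (cases i)
    case VX
    have "has_weight (32 + 4 + 4) (edge_form * plus_form * minus_form)"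
      by (intro has_weight_mult g p m)
    from has_weight_mod[OF this, of 0] show ?thesis by (simp add: VX)
  next
    case VY
    have "has_weight (2 * 32 + 4 * 4) (- (edge_form\<^sup>2 * plus_form ^ 4))"
      by (intro has_weight_uminus has_weight_mult has_weight_power g p)
    from has_weight_mod[OF this, of 0] show ?thesis by (simp add: VY)
  next
    case VZ
    have "has_weight (2 * 32 + 4 * 4) (- (edge_form\<^sup>2 * minus_form ^ 4))"
      by (intro has_weight_uminus has_weight_mult has_weight_power g m)
    from has_weight_mod[OF this, of 0] show ?thesis by (simp add: VZ)
  next
    case VU
    have "has_weight (10 * 4) (plus_form ^ 10)"
      by (intro has_weight_power p)
    from has_weight_mod[OF this, of 0] show ?thesis by (simp add: VU)
  next
    case VV
    thus ?thesis by (simp add: has_weight_def)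
  next
    case VW
    thus ?thesis by (simp add: w)
  qed
qed

lemma has_weight_cover: "has_weight 0 (cover f)"
proof (induction f rule: poly_mapping_additive_induct)
  case (single m c)
  have pow: "has_weight 0 (cover_var i ^ n)" for i n
    using has_weight_power[OF has_weight_cover_var[of i], of n] by simp
  have "has_weight (0 + (0 + 0 + 0 + 0 + 0 + 0)) (const c * (\<Prod>i\<in>UNIV. cover_var i ^ Poly_Mapping.lookup m i))"
    unfolding prod_var by (intro has_weight_mult has_weight_const pow)
  thus ?case
    by (simp add: cover_def comm_ring_hom.eval_poly_single[OF comm_ring_hom_single])
qed (simp add: cover.hom_add has_weight_add)

text \<open>
  The component of weight 0: the Reynolds operator of the cyclic group, in a form that needs no roots of
  unity in the field.
\<close>

definition weight_part :: "'k::field poly6 \<Rightarrow> 'k poly6" where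
  "weight_part f = (\<Sum>m\<in>Poly_Mapping.keys f.
     if invariant_monomial m then Poly_Mapping.single m (Poly_Mapping.lookup f m) else 0)"

lemma weight_part_add: "weight_part (f + g) = weight_part f + weight_part g"
  unfolding weight_part_def by (rule setsum_keys_plus_distrib) (simp_all add: single_add)

lemma weight_part_single:
  "weight_part (Poly_Mapping.single m c) = (if invariant_monomial m then Poly_Mapping.single m c else 0)"
  by (simp add: weight_part_def)

lemma weight_part_zero: "weight_part 0 = 0"
  by (simp add: weight_part_def)

lemma weight_part_sum: "weight_part (sum h A) = (\<Sum>i\<in>A. weight_part (h i))"
  by (induction A rule: infinite_finite_induct) (simp_all add: weight_part_zero weight_part_add)

lemma invariant_monomial_add_iff:
  assumes "invariant_monomial m"
  shows "invariant_monomial (m + n) \<longleftrightarrow> invariant_monomial n"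
proof -
  let ?wt = "\<lambda>m. Poly_Mapping.lookup m VX + 31 * Poly_Mapping.lookup m VY"
  have "?wt (m + n) = ?wt m + ?wt n"
    by (simp add: lookup_add)
  moreover have "?wt m mod 40 = 0"
    using assms by (simp add: invariant_monomial_def)
  ultimately have "?wt (m + n) mod 40 = ?wt n mod 40"
    by (metis mod_add_left_eq add_0)
  thus ?thesis
    using assms unfolding invariant_monomial_def by (simp add: lookup_add)
qed

lemma weight_part_mult:
  assumes "has_weight 0 f"
  shows "weight_part (f * g) = f * weight_part g"
proof -
  have single: "weight_part (Poly_Mapping.single m c * g) = Poly_Mapping.single m c * weight_part g"
    if m: "m \<in> Poly_Mapping.keys f" for m c
  proof (induction g rule: poly_mapping_additive_induct)
    case (single n d)
    have "invariant_monomial m"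
      using assms m by (simp add: has_weight_def invariant_monomial_def)
    thus ?case
      by (simp add: mult_single weight_part_single invariant_monomial_add_iff)
  qed (simp add: distrib_left weight_part_add)
  have "weight_part (f * g)
      = weight_part (\<Sum>m\<in>Poly_Mapping.keys f. Poly_Mapping.single m (Poly_Mapping.lookup f m) * g)"
    by (subst poly_mapping_eq_sum_single[of f]) (simp add: sum_distrib_right)
  also have "\<dots> = (\<Sum>m\<in>Poly_Mapping.keys f. Poly_Mapping.single m (Poly_Mapping.lookup f m) * weight_part g)"
    by (simp add: weight_part_sum single)
  also have "\<dots> = f * weight_part g"
    by (subst (3) poly_mapping_eq_sum_single[of f]) (simp add: sum_distrib_right)
  finally show ?thesis .
qed

text \<open>
  Together with the cyclic group of order 40, the quarter turn generates a group of order 80: its square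
  is \<open>-1\<close>, which belongs to the cyclic group.
\<close>

definition quarter_turn_var :: "var \<Rightarrow> 'k::field poly6" where
  "quarter_turn_var i = (if i = VX then pvar VY else if i = VY then - pvar VX else pvar i)"

definition quarter_turn :: "'k::field poly6 \<Rightarrow> 'k poly6" where
  "quarter_turn = eval_poly const quarter_turn_var"

interpretation quarter_turn: comm_ring_hom "quarter_turn :: 'k::field poly6 \<Rightarrow> 'k poly6"
  unfolding quarter_turn_def
  by (rule comm_ring_hom.comm_ring_hom_eval_poly[OF comm_ring_hom_single])

lemma quarter_turn_pvar: "quarter_turn (pvar i) = quarter_turn_var i"
  unfolding quarter_turn_def by (rule eval_poly_var[OF comm_ring_hom_single])

lemma quarter_turn_const: "quarter_turn (const c) = const c"
  unfolding quarter_turn_def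
  by (simp add: comm_ring_hom.eval_poly_single[OF comm_ring_hom_single])

lemma quarter_turn_cover: "quarter_turn (cover f) = cover (f :: 'k::field poly6)"
proof -
  have "quarter_turn edge_form = - (edge_form :: 'k poly6)" "quarter_turn plus_form = (plus_form :: 'k poly6)"
    "quarter_turn minus_form = - (minus_form :: 'k poly6)"
    by (simp_all add: edge_form_def plus_form_def minus_form_def quarter_turn.hom_mult quarter_turn.hom_add
        quarter_turn.hom_minus quarter_turn.hom_power quarter_turn_pvar quarter_turn_var_def)
  hence "quarter_turn (cover_var i) = (cover_var i :: 'k poly6)" for i
    by (cases i) (simp_all add: quarter_turn.hom_mult quarter_turn.hom_uminus quarter_turn.hom_power quarter_turn.hom_zero quarter_turn_pvar quarter_turn_var_def)
  thus ?thesis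
    unfolding cover_def eval_poly_comp[OF quarter_turn.comm_ring_hom_axioms] by (simp add: quarter_turn_const)
qed

text \<open>
  The average over the quarter turn and the identity; \<open>-1\<close> is the inverse of 2 in characteristic 3.
\<close>

definition reynolds :: "'k::field poly6 \<Rightarrow> 'k poly6" where
  "reynolds f = - (weight_part f + quarter_turn (weight_part f))"

lemma reynolds_add: "reynolds (f + g) = reynolds f + reynolds g"
  by (simp add: reynolds_def weight_part_add quarter_turn.hom_add)

text \<open>
  Both averaging steps are linear over the range of \<open>cover\<close>: its elements have weight 0 and are fixed by
  the quarter turn.
\<close>

lemma reynolds_mult: "reynolds (cover f * g) = cover f * reynolds g"
  unfolding reynolds_def weight_part_mult[OF has_weight_cover] quarter_turn.hom_mult quarter_turn_cover
  by (simp add: algebra_simps)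

lemma reynolds_one:
  assumes "CHAR('k::field) = 3"
  shows "reynolds 1 = (1 :: 'k poly6)"
proof -
  have "weight_part 1 = (1 :: 'k poly6)"
    using weight_part_single[of 0 "1 :: 'k"] by (simp add: invariant_monomial_def)
  hence "reynolds 1 = (1 :: 'k poly6) - 3"
    by (simp add: reynolds_def quarter_turn.hom_one)
  thus ?thesis by (simp add: three_eq_0[OF assms])
qed

lemma reynolds_in_range:
  assumes char: "CHAR('k::field) = 3"
  shows "reynolds (f :: 'k poly6) \<in> range cover"
proof (induction f rule: poly_mapping_additive_induct)
  case (single m c)
  show ?case
  proof (cases "invariant_monomial m")
    case True
    define i j where "i = Poly_Mapping.lookup m VX" and "j = Poly_Mapping.lookup m VY"
    have ij: "(i + 31 * j) mod 40 = 0"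
      using True by (simp add: invariant_monomial_def i_def j_def)
    have mono: "Poly_Mapping.single m c = const c * (pvar VX ^ i * pvar VY ^ j) * pvar VW ^ Poly_Mapping.lookup m VW"
      using True by (subst single_eq_monomial) (simp add: prod_var invariant_monomial_def i_def j_def mult_ac)
    have "reynolds (Poly_Mapping.single m c) = - (const c * (pvar VX ^ i * pvar VY ^ j + pvar VY ^ i * (- pvar VX) ^ j)
        * pvar VW ^ Poly_Mapping.lookup m VW)"
      unfolding reynolds_def weight_part_single if_P[OF True] unfolding mono
      by (simp add: quarter_turn.hom_mult quarter_turn.hom_power quarter_turn_const quarter_turn_pvar quarter_turn_var_def algebra_simps)
    moreover have "pvar VW \<in> range (cover :: 'k poly6 \<Rightarrow> _)"
      using cover_var_in_range[of VW] by simp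
    ultimately show ?thesis
      using symmetrized_monomial_in_range[OF char ij]
      by (simp only: range_cover_closed)
  next
    case False
    thus ?thesis
      by (simp add: reynolds_def weight_part_single quarter_turn.hom_zero range_cover_zero)
  qed
qed (simp add: reynolds_add range_cover_add)

text \<open>
  A direct summand inherits the splittings of the polynomial ring: compose them with the Reynolds
  operator.
\<close>

lemma cover_range_frobenius_splitting:
  assumes char: "CHAR('k::field) = 3" and f: "f \<noteq> (0 :: 'k poly6)"
  obtains e \<psi> where "e \<ge> 1" "\<And>g h. \<psi> (g + h) = \<psi> g + \<psi> h" "\<And>g. \<psi> g \<in> range cover"
    "\<And>r s. r \<in> range cover \<Longrightarrow> \<psi> (r ^ (3 ^ e) * s) = r * \<psi> s" "\<psi> f = 1"
proof -
  have p: "Factorial_Ring.prime CHAR('k)"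
    by (simp add: char)
  obtain e \<phi> where \<phi>: "e \<ge> 1" "\<And>g h. \<phi> (g + h) = \<phi> g + \<phi> h"
    "\<And>r s. \<phi> (r ^ (CHAR('k) ^ e) * s) = r * \<phi> s" "\<phi> f = 1"
    by (rule polynomial_frobenius_splitting[OF p f]) (rule that)
  show thesis
  proof (rule that[of e "\<lambda>g. reynolds (\<phi> g)"])
    show "reynolds (\<phi> (r ^ (3 ^ e) * s)) = r * reynolds (\<phi> s)" if "r \<in> range cover" for r s
      using that \<phi>(3)[of r s] by (auto simp: char reynolds_mult)
  qed (use \<phi>(1) in \<open>auto simp: \<phi>(2,4) reynolds_add reynolds_in_range[OF char] reynolds_one[OF char]\<close>)
qed

section \<open>The kernel of the quotient presentation\<close>

definition minor_12 :: "'k::field poly6" where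
  "minor_12 = (pvar VX ^ 2 + pvar VV ^ 5) * pvar VX ^ 2 - pvar VY * pvar VZ"

definition minor_13 :: "'k::field poly6" where
  "minor_13 = (pvar VX ^ 2 + pvar VV ^ 5) * (pvar VY ^ 2 - pvar VU) - pvar VU * pvar VZ"

definition minor_23 :: "'k::field poly6" where
  "minor_23 = pvar VY * (pvar VY ^ 2 - pvar VU) - pvar VU * pvar VX ^ 2"

definition fibre_ideal :: "'k::field poly6 set" where
  "fibre_ideal = {a * minor_12 + b * minor_13 + c * minor_23 + d * pvar VV | a b c d. True}"

lemma fibre_idealI:
  "f = a * minor_12 + b * minor_13 + c * minor_23 + d * pvar VV \<Longrightarrow> f \<in> fibre_ideal"
  unfolding fibre_ideal_def by blast

lemma fibre_idealE:
  assumes "f \<in> fibre_ideal"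
  obtains a b c d where "f = a * minor_12 + b * minor_13 + c * minor_23 + d * pvar VV"
  using assms unfolding fibre_ideal_def by blast

lemma fibre_ideal_add:
  assumes "f \<in> fibre_ideal" "g \<in> fibre_ideal"
  shows "f + g \<in> fibre_ideal"
proof -
  obtain a b c d where f: "f = a * minor_12 + b * minor_13 + c * minor_23 + d * pvar VV"
    using assms(1) by (rule fibre_idealE)
  obtain a' b' c' d' where g: "g = a' * minor_12 + b' * minor_13 + c' * minor_23 + d' * pvar VV"
    using assms(2) by (rule fibre_idealE)
  show ?thesis
    by (rule fibre_idealI[of _ "a + a'" "b + b'" "c + c'" "d + d'"]) (simp add: f g algebra_simps)
qed

lemma fibre_ideal_mult:
  assumes "f \<in> fibre_ideal"
  shows "h * f \<in> fibre_ideal"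
proof -
  obtain a b c d where f: "f = a * minor_12 + b * minor_13 + c * minor_23 + d * pvar VV"
    using assms by (rule fibre_idealE)
  show ?thesis
    by (rule fibre_idealI[of _ "h * a" "h * b" "h * c" "h * d"]) (simp add: f algebra_simps)
qed

text \<open>
  Modulo \<open>v\<close> the three minors allow to rewrite \<open>x^4\<close>, \<open>y^3\<close> and \<open>x\<^sup>2 y\<^sup>2\<close>.
\<close>

lemma fibre_relations:
  shows "pvar VX ^ 4 - pvar VZ * pvar VY \<in> fibre_ideal"
    and "pvar VY ^ 3 - (pvar VU * pvar VX ^ 2 + pvar VU * pvar VY) \<in> fibre_ideal"
    and "pvar VX ^ 2 * pvar VY ^ 2 - (pvar VU * pvar VX ^ 2 + pvar VU * pvar VZ) \<in> fibre_ideal"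
proof -
  show "pvar VX ^ 4 - pvar VZ * pvar VY \<in> fibre_ideal"
    by (rule fibre_idealI[of _ 1 0 0 "- (pvar VV ^ 4 * pvar VX ^ 2)"])
       (simp add: minor_12_def algebra_simps eval_nat_numeral)
  show "pvar VY ^ 3 - (pvar VU * pvar VX ^ 2 + pvar VU * pvar VY) \<in> fibre_ideal"
    by (rule fibre_idealI[of _ 0 0 1 0])
       (simp add: minor_23_def algebra_simps eval_nat_numeral)
  show "pvar VX ^ 2 * pvar VY ^ 2 - (pvar VU * pvar VX ^ 2 + pvar VU * pvar VZ) \<in> fibre_ideal"
    by (rule fibre_idealI[of _ 0 1 0 "- (pvar VV ^ 4 * (pvar VY ^ 2 - pvar VU))"])
       (simp add: minor_13_def algebra_simps eval_nat_numeral)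
qed

definition normal_monomial :: "(var \<Rightarrow>\<^sub>0 nat) \<Rightarrow> bool" where
  "normal_monomial m \<longleftrightarrow> Poly_Mapping.lookup m VV = 0 \<and>
     Poly_Mapping.lookup m VX \<le> 3 \<and> Poly_Mapping.lookup m VY \<le> 2 \<and>
     (Poly_Mapping.lookup m VX \<le> 1 \<or> Poly_Mapping.lookup m VY \<le> 1)"

definition has_normal_form :: "'k::field poly6 \<Rightarrow> bool" where
  "has_normal_form f \<longleftrightarrow> (\<exists>g. f - g \<in> fibre_ideal \<and> (\<forall>m\<in>Poly_Mapping.keys g. normal_monomial m))"

lemma has_normal_form_cong: "f - g \<in> fibre_ideal \<Longrightarrow> has_normal_form g \<Longrightarrow> has_normal_form f"
proof -
  assume fg: "f - g \<in> fibre_ideal" and "has_normal_form g"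
  then obtain h where h: "g - h \<in> fibre_ideal" "\<forall>m\<in>Poly_Mapping.keys h. normal_monomial m"
    unfolding has_normal_form_def by blast
  have "f - h \<in> fibre_ideal"
    using fibre_ideal_add[OF fg h(1)] by simp
  with h(2) show "has_normal_form f"
    unfolding has_normal_form_def by blast
qed

lemma has_normal_form_add:
  assumes "has_normal_form f" "has_normal_form g"
  shows "has_normal_form (f + g)"
proof -
  obtain f' g' where "f - f' \<in> fibre_ideal" "\<forall>m\<in>Poly_Mapping.keys f'. normal_monomial m"
     "g - g' \<in> fibre_ideal" "\<forall>m\<in>Poly_Mapping.keys g'. normal_monomial m"
    using assms unfolding has_normal_form_def by blast
  thus ?thesis
    unfolding has_normal_form_def using fibre_ideal_add[of "f - f'" "g - g'"] keys_add[of f' g']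
    by (intro exI[of _ "f' + g'"]) (auto simp: add_diff_add)
qed

lemma has_normal_form_mult_single:
  assumes f: "has_normal_form f"
    and n: "Poly_Mapping.lookup n VX = 0" "Poly_Mapping.lookup n VY = 0" "Poly_Mapping.lookup n VV = 0"
  shows "has_normal_form (Poly_Mapping.single n c * f)"
proof -
  obtain g where g: "f - g \<in> fibre_ideal" "\<forall>m\<in>Poly_Mapping.keys g. normal_monomial m"
    using f unfolding has_normal_form_def by blast
  have "normal_monomial m" if m: "m \<in> Poly_Mapping.keys (Poly_Mapping.single n c * g)" for m
  proof -
    obtain a b where "m = a + b" "a \<in> Poly_Mapping.keys (Poly_Mapping.single n c)" "b \<in> Poly_Mapping.keys g"
      using m keys_mult[of "Poly_Mapping.single n c" g] by blast
    moreover from this have "a = n"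
      by (simp split: if_splits)
    ultimately show ?thesis
      using g(2) n by (simp add: normal_monomial_def lookup_add)
  qed
  thus ?thesis
    unfolding has_normal_form_def using fibre_ideal_mult[OF g(1), of "Poly_Mapping.single n c"]
    by (intro exI[of _ "Poly_Mapping.single n c * g"]) (simp add: right_diff_distrib)
qed

lemma has_normal_form_mult_pvar:
  assumes "has_normal_form f" "i \<in> {VZ, VU, VW}"
  shows "has_normal_form (pvar i * f)"
  unfolding pvar_def using assms
  by (intro has_normal_form_mult_single) (auto simp: lookup_single)

text \<open>
  Every rewriting step lowers the total degree in \<open>x\<close> and \<open>y\<close>, counting \<open>z\<close> and \<open>u\<close> as constants.
\<close>

lemma has_normal_form_xy: "has_normal_form (pvar VX ^ i * pvar VY ^ j :: 'k::field poly6)"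
proof (induction "i + j" arbitrary: i j rule: less_induct)
  case less
  note mult_rel = fibre_relations[THEN fibre_ideal_mult]
  consider "i \<ge> 4" | "j \<ge> 3" | "i \<ge> 2" "j \<ge> 2" | "i \<le> 3" "j \<le> 2" "i \<le> 1 \<or> j \<le> 1"
    by linarith
  thus ?case
  proof cases
    case 1
    then obtain i' where i: "i = 4 + i'"
      using le_Suc_ex by blast
    show ?thesis
    proof (rule has_normal_form_cong)
      show "pvar VX ^ i * pvar VY ^ j - pvar VZ * (pvar VX ^ i' * pvar VY ^ Suc j) \<in> fibre_ideal"
        using mult_rel(1)[of "pvar VX ^ i' * pvar VY ^ j"] by (simp add: i power_add algebra_simps)
      show "has_normal_form (pvar VZ * (pvar VX ^ i' * pvar VY ^ Suc j) :: 'k poly6)"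
        by (rule has_normal_form_mult_pvar[OF less.hyps]) (simp_all add: i)
    qed
  next
    case 2
    then obtain j' where j: "j = 3 + j'"
      using le_Suc_ex by blast
    show ?thesis
    proof (rule has_normal_form_cong)
      show "pvar VX ^ i * pvar VY ^ j - (pvar VU * (pvar VX ^ (i + 2) * pvar VY ^ j') +
          pvar VU * (pvar VX ^ i * pvar VY ^ Suc j')) \<in> fibre_ideal"
        using mult_rel(2)[of "pvar VX ^ i * pvar VY ^ j'"] by (simp add: j power_add power2_eq_square algebra_simps)
      show "has_normal_form (pvar VU * (pvar VX ^ (i + 2) * pvar VY ^ j') + pvar VU * (pvar VX ^ i * pvar VY ^ Suc j') :: 'k poly6)"
        by (intro has_normal_form_add has_normal_form_mult_pvar less.hyps) (simp_all add: j)
    qed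
  next
    case 3
    then obtain i' j' where ij: "i = 2 + i'" "j = 2 + j'"
      using le_Suc_ex by blast
    show ?thesis
    proof (rule has_normal_form_cong)
      show "pvar VX ^ i * pvar VY ^ j - (pvar VU * (pvar VX ^ i * pvar VY ^ j') +
          pvar VU * (pvar VZ * (pvar VX ^ i' * pvar VY ^ j'))) \<in> fibre_ideal"
        using mult_rel(3)[of "pvar VX ^ i' * pvar VY ^ j'"] by (simp add: ij power_add power2_eq_square algebra_simps)
      show "has_normal_form (pvar VU * (pvar VX ^ i * pvar VY ^ j') + pvar VU * (pvar VZ * (pvar VX ^ i' * pvar VY ^ j')) :: 'k poly6)"
        by (intro has_normal_form_add has_normal_form_mult_pvar less.hyps) (simp_all add: ij)
    qed
  next
    case 4
    let ?g = "pvar VX ^ i * pvar VY ^ j"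
    have "\<forall>m\<in>Poly_Mapping.keys ?g. normal_monomial m"
      using 4 by (simp add: pvar_power mult_single normal_monomial_def lookup_add lookup_single)
    moreover have "?g - ?g \<in> fibre_ideal"
      by (rule fibre_idealI[of _ 0 0 0 0]) simp
    ultimately show ?thesis
      unfolding has_normal_form_def by blast
  qed
qed

lemma has_normal_form: "has_normal_form f"
proof (induction f rule: poly_mapping_additive_induct)
  case (single m c)
  show ?case
  proof (cases "Poly_Mapping.lookup m VV")
    case 0
    define n where "n = Poly_Mapping.single VZ (Poly_Mapping.lookup m VZ)
      + Poly_Mapping.single VU (Poly_Mapping.lookup m VU) + Poly_Mapping.single VW (Poly_Mapping.lookup m VW)"
    have "n + (Poly_Mapping.single VX (Poly_Mapping.lookup m VX) + Poly_Mapping.single VY (Poly_Mapping.lookup m VY)) = m"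
    proof (rule poly_mapping_eqI)
      fix i
      show "Poly_Mapping.lookup (n + (Poly_Mapping.single VX (Poly_Mapping.lookup m VX)
        + Poly_Mapping.single VY (Poly_Mapping.lookup m VY))) i = Poly_Mapping.lookup m i"
        by (cases i) (simp_all add: n_def lookup_add lookup_single 0)
    qed
    hence "Poly_Mapping.single m c
        = Poly_Mapping.single n c * (pvar VX ^ Poly_Mapping.lookup m VX * pvar VY ^ Poly_Mapping.lookup m VY)"
      by (simp add: pvar_power mult_single)
    thus ?thesis
      by (simp only:) (intro has_normal_form_mult_single has_normal_form_xy; simp add: n_def lookup_add lookup_single)
  next
    case (Suc p)
    define h where "h = (const c * pvar VX ^ Poly_Mapping.lookup m VX * pvar VY ^ Poly_Mapping.lookup m VY
      * pvar VZ ^ Poly_Mapping.lookup m VZ * pvar VU ^ Poly_Mapping.lookup m VU * pvar VV ^ p * pvar VW ^ Poly_Mapping.lookup m VW)"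
    have "Poly_Mapping.single m c = h * pvar VV"
      unfolding h_def by (subst single_eq_monomial) (simp add: prod_var Suc mult_ac)
    hence "Poly_Mapping.single m c - 0 \<in> fibre_ideal"
      by (intro fibre_idealI[of _ 0 0 0 h]) simp
    thus ?thesis
      unfolding has_normal_form_def by (intro exI[of _ 0]) simp
  qed
qed (rule has_normal_form_add)

text \<open>
  After substitution the first minor vanishes identically, and the other two are multiples of
  \<open>g^4 - \<alpha>\<^sup>2 + \<beta>\<^sup>2\<close>.
\<close>

lemma cover_fibre_ideal:
  assumes char: "CHAR('k::field) = 3" and f: "f \<in> fibre_ideal"
  shows "cover f = (0 :: 'k poly6)"
proof -
  note e4 = edge_form_power_4[OF char]
  have "cover minor_12 = (0 :: 'k poly6)"
    by (simp add: minor_12_def cover.hom_add cover.hom_minus cover.hom_mult cover.hom_power cover_pvar)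
       Groebner_Basis.algebra
  moreover have "cover minor_13 = (0 :: 'k poly6)"
    using e4
    by (simp add: minor_13_def cover.hom_add cover.hom_minus cover.hom_mult cover.hom_power cover_pvar)
       Groebner_Basis.algebra
  moreover have "cover minor_23 = (0 :: 'k poly6)"
    using e4
    by (simp add: minor_23_def cover.hom_add cover.hom_minus cover.hom_mult cover.hom_power cover_pvar)
       Groebner_Basis.algebra
  ultimately show ?thesis
    using f by (auto elim!: fibre_idealE simp: cover.hom_add cover.hom_mult cover_pvar)
qed

text \<open>
  Distinct orders of vanishing along \<open>F\<close> force linear independence: the term of least order cannot be
  cancelled by the others. The Bezout relations replace the assumption that \<open>F\<close> is prime, since
  \<open>a^4 + 1\<close> is reducible in characteristic 3.
\<close>

lemma independent_by_multiplicity: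
  fixes F :: "'k::field poly"
  assumes "finite M" and inj: "inj_on e M" and F: "degree F > 0"
    and comaximal: "\<And>m. m \<in> M \<Longrightarrow> \<exists>r s. r * U m + s * F = 1"
    and sum: "(\<Sum>m\<in>M. Polynomial.smult (c m) (U m * F ^ e m)) = 0"
  shows "\<forall>m\<in>M. c m = 0"
proof (rule ccontr)
  assume "\<not> ?thesis"
  hence "\<exists>m. m \<in> M \<and> c m \<noteq> 0" by blast
  from exists_least_iff[THEN iffD1, of "\<lambda>n. \<exists>m. m \<in> M \<and> c m \<noteq> 0 \<and> e m = n"] this
  obtain m0 where m0: "m0 \<in> M" "c m0 \<noteq> 0" and least: "\<And>m. m \<in> M \<Longrightarrow> c m \<noteq> 0 \<Longrightarrow> e m0 \<le> e m"
    by (metis linorder_not_less)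
  have dvd: "F ^ Suc (e m0) dvd Polynomial.smult (c m) (U m * F ^ e m)" if m: "m \<in> M - {m0}" for m
  proof (cases "c m = 0")
    case False
    hence "e m0 \<le> e m" "e m \<noteq> e m0"
      using m least inj m0(1) by (auto simp: inj_on_def)
    hence "Suc (e m0) \<le> e m" by simp
    thus ?thesis by (intro dvd_smult dvd_mult le_imp_power_dvd)
  qed simp
  have "F ^ Suc (e m0) dvd (\<Sum>m\<in>M - {m0}. Polynomial.smult (c m) (U m * F ^ e m))"
    by (rule dvd_sum) (rule dvd)
  moreover have "Polynomial.smult (c m0) (U m0 * F ^ e m0)
      = - (\<Sum>m\<in>M - {m0}. Polynomial.smult (c m) (U m * F ^ e m))"
    using sum sum.remove[OF \<open>finite M\<close> m0(1), of "\<lambda>m. Polynomial.smult (c m) (U m * F ^ e m)"]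
    by (simp add: eq_neg_iff_add_eq_0)
  ultimately have "F ^ Suc (e m0) dvd Polynomial.smult (c m0) (U m0 * F ^ e m0)"
    by simp
  hence "F ^ e m0 * F dvd F ^ e m0 * U m0"
    using m0(2) by (simp add: dvd_smult_iff mult_ac)
  moreover have "F \<noteq> 0"
    using F by auto
  ultimately have "F dvd U m0"
    by simp
  moreover obtain r s where "r * U m0 + s * F = 1"
    using comaximal[OF m0(1)] by blast
  ultimately have "F dvd 1"
    by (metis dvd_add dvd_mult dvd_refl)
  thus False
    using F is_unit_iff_degree[of F] by (cases "F = 0") simp_all
qed

lemma comaximal_mult:
  fixes F :: "'a::comm_ring_1"
  assumes "\<exists>r s. r * U + s * F = 1" "\<exists>r s. r * V + s * F = 1"
  shows "\<exists>r s. r * (U * V) + s * F = 1"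
proof -
  obtain r s r' s' where "r * U + s * F = 1" "r' * V + s' * F = 1"
    using assms by blast
  hence "(r * U + s * F) * (r' * V + s' * F) = 1" by simp
  hence "(r * r') * (U * V) + (r * U * s' + s * r' * V + s * F * s') * F = 1"
    by (simp add: algebra_simps)
  thus ?thesis by blast
qed

lemma comaximal_power:
  fixes F :: "'a::comm_ring_1"
  assumes "\<exists>r s. r * U + s * F = 1"
  shows "\<exists>r s. r * U ^ n + s * F = 1"
proof (induction n)
  case 0
  show ?case by (rule exI[of _ 1], rule exI[of _ 0]) simp
qed (simp add: comaximal_mult[OF assms])

text \<open>
  The polynomial \<open>p(a) Y^n\<close>, as a constant in the outermost variable \<open>w\<close>.
\<close>

definition homog :: "'k::field poly \<Rightarrow> nat \<Rightarrow> 'k poly poly poly" where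
  "homog p n = [:Polynomial.monom p n:]"

lemma homog_mult: "homog p n * homog p' n' = homog (p * p') (n + n')"
  by (simp add: homog_def mult_monom mult.commute add.commute)

lemma homog_zero: "homog 0 n = 0"
  by (simp add: homog_def)

lemma homog_one: "homog 1 0 = 1"
  unfolding homog_def monom_0 by (simp only: one_pCons [symmetric])

lemma homog_power: "homog p n ^ k = homog (p ^ k) (k * n)"
  by (induction k) (simp_all add: homog_one homog_mult)

lemma homog_add: "homog p n + homog p' n = homog (p + p') n"
  by (simp add: homog_def add_monom)

lemma homog_diff: "homog p n - homog p' n = homog (p - p') n"
  by (simp add: homog_def diff_monom)

lemma homog_uminus: "- homog p n = homog (- p) n"
  by (simp add: homog_def minus_monom)

text \<open>
  The substitution \<open>a \<mapsto> a Y\<close>, \<open>b \<mapsto> Y\<close>. It loses nothing: \<open>Y\<close> records the degree, and dividing by powers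
  of \<open>Y\<close> turns forms in \<open>a\<close> and \<open>b\<close> into polynomials in one variable.
\<close>

primrec chart_var :: "var \<Rightarrow> 'k::field poly poly poly" where
  "chart_var VX = homog [:0, 1:] 1"
| "chart_var VY = homog 1 1"
| "chart_var VZ = 0"
| "chart_var VU = 0"
| "chart_var VV = 0"
| "chart_var VW = Polynomial.monom 1 1"

definition chart :: "'k::field poly6 \<Rightarrow> 'k poly poly poly" where
  "chart = eval_poly (\<lambda>c. homog [:c:] 0) chart_var"

lemma comm_ring_hom_homog: "comm_ring_hom (\<lambda>c :: 'k::field. homog [:c:] 0)"
  by standard (simp_all add: homog_zero homog_add homog_mult mult.commute flip: homog_one one_pCons)

interpretation chart: comm_ring_hom "chart :: 'k::field poly6 \<Rightarrow> _"
  unfolding chart_def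
  by (rule comm_ring_hom.comm_ring_hom_eval_poly[OF comm_ring_hom_homog])

lemma chart_pvar: "chart (pvar i) = chart_var i"
  unfolding chart_def by (rule eval_poly_var[OF comm_ring_hom_homog])

lemma chart_const: "chart (const c) = homog [:c:] 0"
  unfolding chart_def
  by (simp add: comm_ring_hom.eval_poly_single[OF comm_ring_hom_homog])

definition plus_poly :: "'k::field poly" where
  "plus_poly = [:0, 1:] ^ 4 + 1"

definition minus_poly :: "'k::field poly" where
  "minus_poly = [:0, 1:] ^ 4 - 1"

lemma chart_forms:
  "chart edge_form = homog [:0, 1:] 2" "chart plus_form = homog plus_poly 4"
  "chart minus_form = homog minus_poly 4"
proof -
  show "chart edge_form = homog [:0, 1:] 2"
    by (simp add: edge_form_def chart.hom_mult chart_pvar homog_mult numeral_2_eq_2)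
  show "chart plus_form = homog plus_poly 4"
    by (simp only: plus_form_def chart.hom_add chart.hom_power chart_pvar chart_var.simps homog_power
        homog_add plus_poly_def power_one mult_1_right)
  show "chart minus_form = homog minus_poly 4"
    by (simp only: minus_form_def chart.hom_minus chart.hom_power chart_pvar chart_var.simps homog_power
        homog_diff minus_poly_def power_one mult_1_right)
qed

text \<open>
  The factor of the image of a monomial that is prime to \<open>a^4 + 1\<close>.
\<close>

definition unit_factor_of :: "(var \<Rightarrow>\<^sub>0 nat) \<Rightarrow> 'k::field poly" where
  "unit_factor_of m = (let i = Poly_Mapping.lookup m VX; j = Poly_Mapping.lookup m VY; k = Poly_Mapping.lookup m VZ
     in (- 1) ^ (j + k) * [:0, 1:] ^ (i + 2 * j + 2 * k) * minus_poly ^ (i + 4 * k))"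

text \<open>
  The order of vanishing of the image of a monomial along \<open>\<alpha>\<close>: the images of \<open>x, y, z, u\<close> contain
  \<open>1, 4, 0, 10\<close> factors \<open>\<alpha>\<close>.
\<close>

definition plus_order :: "(var \<Rightarrow>\<^sub>0 nat) \<Rightarrow> nat" where
  "plus_order m = Poly_Mapping.lookup m VX + 4 * Poly_Mapping.lookup m VY + 10 * Poly_Mapping.lookup m VU"

definition form_degree :: "(var \<Rightarrow>\<^sub>0 nat) \<Rightarrow> nat" where
  "form_degree m = 10 * Poly_Mapping.lookup m VX + 20 * Poly_Mapping.lookup m VY
     + 20 * Poly_Mapping.lookup m VZ + 40 * Poly_Mapping.lookup m VU"

lemma chart_cover_single:
  assumes "normal_monomial m"
  shows "chart (cover (Poly_Mapping.single m (c :: 'k::field))) =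
    Polynomial.monom (Polynomial.monom (Polynomial.smult c (unit_factor_of m * plus_poly ^ plus_order m)) (form_degree m))
      (Poly_Mapping.lookup m VW)"
proof -
  define i j k l q where "i = Poly_Mapping.lookup m VX" and "j = Poly_Mapping.lookup m VY"
    and "k = Poly_Mapping.lookup m VZ" and "l = Poly_Mapping.lookup m VU" and "q = Poly_Mapping.lookup m VW"
  note defs = i_def[symmetric] j_def[symmetric] k_def[symmetric] l_def[symmetric] q_def[symmetric]
  have v: "Poly_Mapping.lookup m VV = 0"
    using assms by (simp add: normal_monomial_def)
  have degree: "0 + (i * 10 + j * 20 + k * 20 + l * 40) = form_degree m"
    by (simp add: form_degree_def i_def j_def k_def l_def)
  have "cover (Poly_Mapping.single m c)
      = const c * ((edge_form * plus_form * minus_form) ^ i * (- (edge_form\<^sup>2 * plus_form ^ 4)) ^ j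
        * (- (edge_form\<^sup>2 * minus_form ^ 4)) ^ k * (plus_form ^ 10) ^ l * pvar VW ^ q)"
    by (subst single_eq_monomial)
       (simp add: cover.hom_mult cover_const cover.hom_prod cover.hom_power cover_pvar prod_var v defs mult.assoc)
  also have "chart \<dots> = homog [:c:] 0 * (homog ([:0, 1:] * plus_poly * minus_poly) 10 ^ i * homog (- ([:0, 1:] ^ 2 * plus_poly ^ 4)) 20 ^ j
        * homog (- ([:0, 1:] ^ 2 * minus_poly ^ 4)) 20 ^ k * homog (plus_poly ^ 10) 40 ^ l) * Polynomial.monom 1 q"
    by (simp add: chart.hom_mult chart.hom_power chart.hom_uminus chart_const chart_forms chart_pvar
        homog_mult homog_power homog_uminus monom_power mult.assoc add.assoc)
  also have "\<dots> = homog ([:c:] * (([:0, 1:] * plus_poly * minus_poly) ^ i * (- ([:0, 1:] ^ 2 * plus_poly ^ 4)) ^ j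
        * (- ([:0, 1:] ^ 2 * minus_poly ^ 4)) ^ k * (plus_poly ^ 10) ^ l)) (form_degree m) * Polynomial.monom 1 q"
    by (simp only: homog_mult homog_power degree)
  also have "([:c:] * (([:0, 1:] * plus_poly * minus_poly) ^ i * (- ([:0, 1:] ^ 2 * plus_poly ^ 4)) ^ j
        * (- ([:0, 1:] ^ 2 * minus_poly ^ 4)) ^ k * (plus_poly ^ 10) ^ l))
      = Polynomial.smult c (unit_factor_of m * plus_poly ^ plus_order m)"
  proof -
    have y: "(- ([:0, 1:] ^ 2 * plus_poly ^ 4)) ^ j = (- 1) ^ j * (([:0, 1:] ^ 2 * plus_poly ^ 4) ^ j :: 'k poly)"
      by (rule power_minus)
    have z: "(- ([:0, 1:] ^ 2 * minus_poly ^ 4)) ^ k = (- 1) ^ k * (([:0, 1:] ^ 2 * minus_poly ^ 4) ^ k :: 'k poly)"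
      by (rule power_minus)
    have "([:0, 1:] * plus_poly * minus_poly) ^ i * (- ([:0, 1:] ^ 2 * plus_poly ^ 4)) ^ j
        * (- ([:0, 1:] ^ 2 * minus_poly ^ 4)) ^ k * (plus_poly ^ 10) ^ l
        = (unit_factor_of m * plus_poly ^ plus_order m :: 'k poly)"
      unfolding unit_factor_of_def plus_order_def Let_def defs y z
      by (simp only: power_add power_mult power_mult_distrib) (simp only: mult_ac)
    moreover have "[:c:] * f = Polynomial.smult c f" for f :: "'k poly"
      by simp
    ultimately show ?thesis by (simp only:)
  qed
  also have "homog p n * Polynomial.monom 1 q = Polynomial.monom (Polynomial.monom p n) q" for p :: "'k poly" and n
    by (simp add: homog_def smult_monom)
  finally show ?thesis
    unfolding defs .
qed

text \<open>
  On the ten normal monomials \<open>x^i y^j\<close> the number \<open>i + 4 j\<close> takes each of the values \<open>0, \<dots>, 9\<close> once. Hence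
  the order of vanishing \<open>i + 4 j + 10 l\<close> determines \<open>i\<close>, \<open>j\<close> and the exponent \<open>l\<close> of \<open>u\<close>, and then the
  degree determines the exponent of \<open>z\<close>.
\<close>

lemma normal_monomial_eqI:
  assumes "normal_monomial m" "normal_monomial m'" "plus_order m = plus_order m'"
    "form_degree m = form_degree m'" "Poly_Mapping.lookup m VW = Poly_Mapping.lookup m' VW"
  shows "m = m'"
proof -
  define i j k l where "i = Poly_Mapping.lookup m VX" and "j = Poly_Mapping.lookup m VY"
    and "k = Poly_Mapping.lookup m VZ" and "l = Poly_Mapping.lookup m VU"
  define i' j' k' l' where "i' = Poly_Mapping.lookup m' VX" and "j' = Poly_Mapping.lookup m' VY"
    and "k' = Poly_Mapping.lookup m' VZ" and "l' = Poly_Mapping.lookup m' VU"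
  have n: "i \<le> 3" "j \<le> 2" "i \<le> 1 \<or> j \<le> 1" "i' \<le> 3" "j' \<le> 2" "i' \<le> 1 \<or> j' \<le> 1"
    using assms(1,2) by (simp_all add: normal_monomial_def i_def j_def i'_def j'_def)
  have o: "i + 4 * j + 10 * l = i' + 4 * j' + 10 * l'"
    using assms(3) by (simp add: plus_order_def i_def j_def l_def i'_def j'_def l'_def)
  have "i + 4 * j \<le> 9" "i' + 4 * j' \<le> 9"
    using n by linarith+
  hence l: "l = l'"
    using o by linarith
  hence j: "j = j'"
    using o n by linarith
  hence i: "i = i'"
    using o l by simp
  hence "k = k'"
    using assms(4) l j
    by (simp add: form_degree_def flip: i_def j_def k_def l_def i'_def j'_def k'_def l'_def)
  with i j l assms show ?thesis
    by (intro poly_mapping_eqI, rename_tac a, case_tac a)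
       (simp_all add: normal_monomial_def i_def j_def k_def l_def i'_def j'_def k'_def l'_def)
qed

text \<open>
  Fix the degree and the exponent of \<open>w\<close>. The images of the normal monomials then vanish to different
  orders along \<open>\<alpha>\<close>, so they are independent.
\<close>

lemma cover_injective_on_normal:
  assumes char: "CHAR('k::field) = 3" and normal: "\<forall>m\<in>Poly_Mapping.keys g. normal_monomial m"
    and zero: "cover g = (0 :: 'k poly6)"
  shows "g = 0"
proof (rule ccontr)
  assume "g \<noteq> 0"
  then obtain m0 where m0: "m0 \<in> Poly_Mapping.keys g"
    by (metis ex_in_conv keys_eq_empty)
  define M where "M = {m \<in> Poly_Mapping.keys g. form_degree m = form_degree m0 \<and>
    Poly_Mapping.lookup m VW = Poly_Mapping.lookup m0 VW}"
  let ?U = "\<lambda>m. unit_factor_of m :: 'k poly" and ?F = "plus_poly :: 'k poly"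
  have "0 = chart (cover (\<Sum>m\<in>Poly_Mapping.keys g. Poly_Mapping.single m (Poly_Mapping.lookup g m)))"
    by (simp add: zero chart.hom_zero flip: poly_mapping_eq_sum_single)
  also have "\<dots> = (\<Sum>m\<in>Poly_Mapping.keys g.
      Polynomial.monom (Polynomial.monom (Polynomial.smult (Poly_Mapping.lookup g m)
        (?U m * ?F ^ plus_order m)) (form_degree m)) (Poly_Mapping.lookup m VW))"
    using normal by (simp add: cover.hom_sum chart.hom_sum chart_cover_single)
  finally have "0 = coeff (coeff (\<Sum>m\<in>Poly_Mapping.keys g.
      Polynomial.monom (Polynomial.monom (Polynomial.smult (Poly_Mapping.lookup g m)
        (?U m * ?F ^ plus_order m)) (form_degree m)) (Poly_Mapping.lookup m VW))
      (Poly_Mapping.lookup m0 VW)) (form_degree m0)"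
    by (metis coeff_0)
  also have "\<dots> = (\<Sum>m\<in>Poly_Mapping.keys g. if m \<in> M then
      Polynomial.smult (Poly_Mapping.lookup g m) (?U m * ?F ^ plus_order m) else 0)"
    by (simp add: coeff_sum) (intro sum.cong refl, auto simp: M_def)
  also have "\<dots> = (\<Sum>m\<in>M. Polynomial.smult (Poly_Mapping.lookup g m) (?U m * ?F ^ plus_order m))"
    by (rule sum.mono_neutral_cong_right) (auto simp: M_def)
  finally have sum: "(\<Sum>m\<in>M. Polynomial.smult (Poly_Mapping.lookup g m) (?U m * ?F ^ plus_order m)) = 0" ..
  have three: "3 = (0 :: 'k poly)"
    by (metis semiring_char_poly char of_nat_CHAR of_nat_numeral)
  have F: "degree ?F > 0"
    by (simp add: plus_poly_def degree_add_eq_left degree_power_eq)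
  have "\<forall>m\<in>M. Poly_Mapping.lookup g m = 0"
  proof (rule independent_by_multiplicity[OF _ _ F _ sum])
    show "finite M"
      by (simp add: M_def)
    show "inj_on plus_order M"
      using normal by (auto simp: inj_on_def M_def intro: normal_monomial_eqI)
    fix m
    have c1: "\<exists>r s. r * (- 1) + s * ?F = 1"
      by (rule exI[of _ "- 1"], rule exI[of _ 0]) simp
    have c2: "\<exists>r s. r * [:0, 1:] + s * ?F = 1"
      by (rule exI[of _ "- ([:0, 1:] ^ 3)"], rule exI[of _ 1])
         (simp add: plus_poly_def eval_nat_numeral)
    have "(- 2) * minus_poly + 2 * ?F = 1 + 3 * 1"
      by (simp add: plus_poly_def minus_poly_def algebra_simps)
    hence "(- 2) * minus_poly + 2 * ?F = 1"
      unfolding three by simp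
    hence c3: "\<exists>r s. r * minus_poly + s * ?F = 1"
      by blast
    show "\<exists>r s. r * ?U m + s * ?F = 1"
      unfolding unit_factor_of_def Let_def
      by (intro comaximal_mult comaximal_power c1 c2 c3)
  qed
  thus False
    using m0 by (auto simp: M_def in_keys_iff)
qed

text \<open>
  Modulo the ideal every polynomial is a combination of normal monomials, and these have independent
  images.
\<close>

lemma cover_eq_0_iff:
  assumes char: "CHAR('k::field) = 3"
  shows "cover f = (0 :: 'k poly6) \<longleftrightarrow> f \<in> fibre_ideal"
proof
  assume f: "cover f = 0"
  obtain g where g: "f - g \<in> fibre_ideal" "\<forall>m\<in>Poly_Mapping.keys g. normal_monomial m"
    using has_normal_form[of f] unfolding has_normal_form_def by blast
  have "cover f - cover g = 0"
    using cover_fibre_ideal[OF char g(1)] by (simp add: cover.hom_minus)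
  hence "g = 0"
    using f by (intro cover_injective_on_normal[OF char g(2)]) simp
  thus "f \<in> fibre_ideal"
    using g(1) by simp
qed (rule cover_fibre_ideal[OF char])

section \<open>Subrings of a type, quotients and splittings\<close>

text \<open>
  The localization of the statement has this shape, which allows to compute in it with the operations of
  the type.
\<close>

abbreviation type_subring :: "'a::comm_ring_1 set \<Rightarrow> 'a ring" where
  "type_subring H \<equiv> (ring_of_type_algebra :: 'a ring) \<lparr>carrier := H\<rparr>"

lemma ring_of_type_algebra_simps [simp]:
  fixes a b :: "'a::comm_ring_1"
  shows "carrier (ring_of_type_algebra :: 'a ring) = UNIV"
    "a \<otimes>\<^bsub>ring_of_type_algebra\<^esub> b = a * b" "a \<oplus>\<^bsub>ring_of_type_algebra\<^esub> b = a + b"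
    "\<one>\<^bsub>ring_of_type_algebra\<^esub> = (1 :: 'a)" "\<zero>\<^bsub>ring_of_type_algebra\<^esub> = (0 :: 'a)"
  by (simp_all add: ring_of_type_algebra_def)

lemma type_ring_a_inv: "a_inv (ring_of_type_algebra :: 'a::comm_ring_1 ring) a = - a"
proof -
  interpret cring "ring_of_type_algebra :: 'a ring" by (rule cring_from_type_algebra)
  show ?thesis by (rule minus_equality) simp_all
qed

lemma cring_type_subring:
  assumes "1 \<in> H" "\<And>a. a \<in> H \<Longrightarrow> - a \<in> H" "\<And>a b. a \<in> H \<Longrightarrow> b \<in> H \<Longrightarrow> a * b \<in> H"
    "\<And>a b. a \<in> H \<Longrightarrow> b \<in> H \<Longrightarrow> a + b \<in> H"
  shows "cring (type_subring (H :: 'a::comm_ring_1 set))"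
proof -
  interpret cring "ring_of_type_algebra :: 'a ring" by (rule cring_from_type_algebra)
  have "subring H (ring_of_type_algebra :: 'a ring)"
    by (rule subringI) (use assms in \<open>auto simp: type_ring_a_inv\<close>)
  thus ?thesis
    using subcringI' subcring_iff[of H] by auto
qed

lemma type_subring_a_inv:
  assumes "cring (type_subring H)" "a \<in> H" "- a \<in> H"
  shows "a_inv (type_subring H) a = - a"
proof -
  interpret cring "type_subring H" by fact
  show ?thesis by (rule minus_equality) (use assms in simp_all)
qed

lemma type_subring_nat_pow: "a [^]\<^bsub>type_subring H\<^esub> (n :: nat) = a ^ n"
  by (induction n) (simp_all add: mult.commute)

lemma type_subring_idealI:
  assumes "cring (type_subring H)" and uminus: "\<And>a. a \<in> H \<Longrightarrow> - a \<in> H" and "J \<subseteq> H" "0 \<in> J"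
    and add: "\<And>a b. a \<in> J \<Longrightarrow> b \<in> J \<Longrightarrow> a + b \<in> J"
    and mult: "\<And>a b. a \<in> J \<Longrightarrow> b \<in> H \<Longrightarrow> b * a \<in> J"
  shows "ideal J (type_subring H)"
proof -
  interpret R: cring "type_subring H" by fact
  have "1 \<in> H"
    using R.one_closed by simp
  show ?thesis
  proof (rule idealI)
    show "ring (type_subring H)" by (rule R.ring_axioms)
    show "subgroup J (add_monoid (type_subring H))"
    proof (rule R.add.subgroupI)
      show "a_inv (type_subring H) a \<in> J" if "a \<in> J" for a
        using mult[OF that, of "- 1"] uminus[OF \<open>1 \<in> H\<close>] uminus that \<open>J \<subseteq> H\<close>
        by (subst type_subring_a_inv[OF assms(1)]) auto
    qed (use assms in auto)
  qed (use mult in \<open>auto simp: mult.commute\<close>)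
qed

text \<open>
  The quotient of a quotient is presented by a single surjection from the original ring, with an explicit
  kernel. It spares all computations with cosets of cosets.
\<close>

lemma principal_quotient_projection:
  assumes "cring S" and I: "ideal I S" and d: "d \<in> carrier S"
  defines "R \<equiv> S Quot I"
  defines "Q \<equiv> R Quot PIdl\<^bsub>R\<^esub> (I +>\<^bsub>S\<^esub> d)"
  obtains p where "cring Q" "p \<in> Ring.ring_hom S Q" "p ` carrier S = carrier Q"
    "\<And>s. s \<in> carrier S \<Longrightarrow> p s = \<zero>\<^bsub>Q\<^esub> \<longleftrightarrow> (\<exists>r\<in>carrier S. s \<ominus>\<^bsub>S\<^esub> r \<otimes>\<^bsub>S\<^esub> d \<in> I)"
proof -
  interpret S: cring S by fact
  interpret I: ideal I S by fact
  interpret R: cring R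
    unfolding R_def by (rule I.quotient_is_cring) (rule S.is_cring)
  have proj: "(+>\<^bsub>S\<^esub>) I \<in> Ring.ring_hom S R"
    unfolding R_def by (rule I.rcos_ring_hom)
  have carrier_R: "carrier R = (+>\<^bsub>S\<^esub>) I ` carrier S"
    unfolding R_def by (auto simp: FactRing_def A_RCOSETS_def')
  have dR: "I +>\<^bsub>S\<^esub> d \<in> carrier R"
    using d by (simp add: carrier_R)
  define J where "J = PIdl\<^bsub>R\<^esub> (I +>\<^bsub>S\<^esub> d)"
  interpret J: ideal J R
    unfolding J_def by (rule R.cgenideal_ideal[OF dR])
  have Q: "Q = R Quot J"
    by (simp add: Q_def J_def)
  have cring: "cring Q"
    unfolding Q by (rule J.quotient_is_cring) (rule R.is_cring)
  have proj': "(+>\<^bsub>R\<^esub>) J \<in> Ring.ring_hom R Q"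
    unfolding Q by (rule J.rcos_ring_hom)
  have carrier_Q: "carrier Q = (+>\<^bsub>R\<^esub>) J ` carrier R"
    unfolding Q by (auto simp: FactRing_def A_RCOSETS_def')
  define p where "p s = J +>\<^bsub>R\<^esub> (I +>\<^bsub>S\<^esub> s)" for s
  have hom: "p \<in> Ring.ring_hom S Q"
    using ring_hom_trans[OF proj proj'] unfolding p_def comp_def .
  have surj: "p ` carrier S = carrier Q"
    unfolding carrier_Q carrier_R p_def by (simp add: image_image)
  have kernel: "p s = \<zero>\<^bsub>Q\<^esub> \<longleftrightarrow> (\<exists>r\<in>carrier S. s \<ominus>\<^bsub>S\<^esub> r \<otimes>\<^bsub>S\<^esub> d \<in> I)" if s: "s \<in> carrier S" for s
  proof -
    have sR: "I +>\<^bsub>S\<^esub> s \<in> carrier R"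
      using s by (simp add: carrier_R)
    have "p s = \<zero>\<^bsub>Q\<^esub> \<longleftrightarrow> J +>\<^bsub>R\<^esub> (I +>\<^bsub>S\<^esub> s) = J"
      by (simp add: p_def Q FactRing_def)
    also have "\<dots> \<longleftrightarrow> I +>\<^bsub>S\<^esub> s \<in> J"
      using J.rcos_const_imp_mem[OF sR] J.a_rcos_const by blast
    also have "\<dots> \<longleftrightarrow> (\<exists>r\<in>carrier S. I +>\<^bsub>S\<^esub> s = (I +>\<^bsub>S\<^esub> r) \<otimes>\<^bsub>R\<^esub> (I +>\<^bsub>S\<^esub> d))"
      unfolding J_def cgenideal_def carrier_R by blast
    also have "\<dots> \<longleftrightarrow> (\<exists>r\<in>carrier S. I +>\<^bsub>S\<^esub> s = I +>\<^bsub>S\<^esub> (r \<otimes>\<^bsub>S\<^esub> d))"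
      using ring_hom_mult[OF proj _ d] by simp
    also have "\<dots> \<longleftrightarrow> (\<exists>r\<in>carrier S. s \<ominus>\<^bsub>S\<^esub> r \<otimes>\<^bsub>S\<^esub> d \<in> I)"
      using S.quotient_eq_iff_same_a_r_cos[OF I s] d by simp
    finally show ?thesis .
  qed
  show thesis
    by (rule that[OF cring hom surj kernel])
qed

text \<open>
  A ring that embeds into a field is a domain, so \<open>0\<close> is its only minimal prime and the condition on \<open>c\<close>
  becomes \<open>c \<noteq> 0\<close>. The splittings can then be given on the image of the embedding.
\<close>

lemma strongly_F_regular_if_embedded:
  fixes g :: "'a \<Rightarrow> 'f::field"
  assumes "cring Q" and inj: "inj_on g (carrier Q)"
    and g_mult: "\<And>a b. a \<in> carrier Q \<Longrightarrow> b \<in> carrier Q \<Longrightarrow> g (a \<otimes>\<^bsub>Q\<^esub> b) = g a * g b"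
    and g_add: "\<And>a b. a \<in> carrier Q \<Longrightarrow> b \<in> carrier Q \<Longrightarrow> g (a \<oplus>\<^bsub>Q\<^esub> b) = g a + g b"
    and g_one: "g \<one>\<^bsub>Q\<^esub> = 1"
    and split: "\<And>c. c \<in> g ` carrier Q \<Longrightarrow> c \<noteq> 0 \<Longrightarrow>
      \<exists>e\<ge>1. \<exists>\<Phi>. (\<forall>a\<in>g ` carrier Q. \<forall>b\<in>g ` carrier Q. \<Phi> (a + b) = \<Phi> a + \<Phi> b) \<and>
        (\<forall>a\<in>g ` carrier Q. \<Phi> a \<in> g ` carrier Q) \<and>
        (\<forall>a\<in>g ` carrier Q. \<forall>b\<in>g ` carrier Q. \<Phi> (a ^ (p ^ e) * b) = a * \<Phi> b) \<and> \<Phi> c = 1"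
  shows "strongly_F_regular p Q"
proof -
  interpret Q: cring Q by fact
  have g_zero: "g \<zero>\<^bsub>Q\<^esub> = 0"
  proof -
    have "g \<zero>\<^bsub>Q\<^esub> + g \<zero>\<^bsub>Q\<^esub> = g \<zero>\<^bsub>Q\<^esub> + 0"
      using g_add[OF Q.zero_closed Q.zero_closed] by (simp only: Q.r_zero[OF Q.zero_closed] add_0_right)
    thus ?thesis by (simp only: add_left_cancel)
  qed
  have g_pow: "g (a [^]\<^bsub>Q\<^esub> n) = g a ^ n" if "a \<in> carrier Q" for a and n :: nat
    using that by (induction n) (simp_all add: g_one g_mult mult.commute)
  have g_eq_0: "a = \<zero>\<^bsub>Q\<^esub>" if "a \<in> carrier Q" "g a = 0" for a
    using inj_onD[OF inj, of a "\<zero>\<^bsub>Q\<^esub>"] that g_zero by simp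
  have "domain Q"
  proof (rule domain.intro[OF \<open>cring Q\<close>], rule domain_axioms.intro)
    show "\<one>\<^bsub>Q\<^esub> \<noteq> \<zero>\<^bsub>Q\<^esub>"
      using g_one g_zero by auto
    show "a = \<zero>\<^bsub>Q\<^esub> \<or> b = \<zero>\<^bsub>Q\<^esub>" if "a \<otimes>\<^bsub>Q\<^esub> b = \<zero>\<^bsub>Q\<^esub>" "a \<in> carrier Q" "b \<in> carrier Q" for a b
    proof -
      have "g a * g b = 0"
        using g_mult[OF that(2,3)] that(1) g_zero by simp
      thus ?thesis
        using g_eq_0 that(2,3) by auto
    qed
  qed
  hence prime: "primeideal {\<zero>\<^bsub>Q\<^esub>} Q"
    by (rule domain.zeroprimeideal)
  have minimal: "minimal_prime {\<zero>\<^bsub>Q\<^esub>} Q"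
    unfolding minimal_prime_def
  proof (intro conjI allI impI)
    fix P assume "primeideal P Q \<and> P \<subseteq> {\<zero>\<^bsub>Q\<^esub>}"
    moreover from this have "\<zero>\<^bsub>Q\<^esub> \<in> P"
      by (meson additive_subgroup.zero_closed ideal.axioms(1) primeideal.axioms(1))
    ultimately show "P = {\<zero>\<^bsub>Q\<^esub>}" by blast
  qed (rule prime)
  show ?thesis
    unfolding strongly_F_regular_def
  proof (intro ballI impI)
    fix c assume c: "c \<in> carrier Q" "\<forall>P. minimal_prime P Q \<longrightarrow> c \<notin> P"
    have "c \<notin> {\<zero>\<^bsub>Q\<^esub>}"
      using c(2) minimal by blast
    hence "g c \<noteq> 0"
      using g_eq_0[OF c(1)] by auto
    from split[OF imageI[OF c(1)] this] obtain e \<Phi> where e: "e \<ge> 1" and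
      *: "(\<forall>a\<in>g ` carrier Q. \<forall>b\<in>g ` carrier Q. \<Phi> (a + b) = \<Phi> a + \<Phi> b) \<and>
        (\<forall>a\<in>g ` carrier Q. \<Phi> a \<in> g ` carrier Q) \<and>
        (\<forall>a\<in>g ` carrier Q. \<forall>b\<in>g ` carrier Q. \<Phi> (a ^ (p ^ e) * b) = a * \<Phi> b) \<and> \<Phi> (g c) = 1"
      by (elim exE conjE) (rule that, assumption, intro conjI)
    have \<Phi>: "\<And>a b. a \<in> g ` carrier Q \<Longrightarrow> b \<in> g ` carrier Q \<Longrightarrow> \<Phi> (a + b) = \<Phi> a + \<Phi> b"
        "\<And>a. a \<in> g ` carrier Q \<Longrightarrow> \<Phi> a \<in> g ` carrier Q"
        "\<And>a b. a \<in> g ` carrier Q \<Longrightarrow> b \<in> g ` carrier Q \<Longrightarrow> \<Phi> (a ^ (p ^ e) * b) = a * \<Phi> b"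
        "\<Phi> (g c) = 1"
      using * by blast+
    define \<phi> where "\<phi> a = inv_into (carrier Q) g (\<Phi> (g a))" for a
    have \<phi>_closed: "\<phi> a \<in> carrier Q" and g_\<phi>: "g (\<phi> a) = \<Phi> (g a)" if "a \<in> carrier Q" for a
      unfolding \<phi>_def using \<Phi>(2)[OF imageI[OF that]]
      by (simp_all add: inv_into_into f_inv_into_f)
    have "\<phi> (a \<oplus>\<^bsub>Q\<^esub> b) = \<phi> a \<oplus>\<^bsub>Q\<^esub> \<phi> b" if "a \<in> carrier Q" "b \<in> carrier Q" for a b
      by (rule inj_onD[OF inj]) (use that in \<open>simp_all add: g_\<phi> \<phi>_closed g_add \<Phi>(1)\<close>)
    hence "\<phi> \<in> hom (add_monoid Q) (add_monoid Q)"
      by (intro homI) (simp_all add: \<phi>_closed)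
    moreover have "\<phi> (r [^]\<^bsub>Q\<^esub> (p ^ e) \<otimes>\<^bsub>Q\<^esub> s) = r \<otimes>\<^bsub>Q\<^esub> \<phi> s" if "r \<in> carrier Q" "s \<in> carrier Q" for r s
      by (rule inj_onD[OF inj]) (use that in \<open>simp_all add: g_\<phi> \<phi>_closed g_mult g_pow \<Phi>(3)\<close>)
    ultimately have linear: "p_linear_map p e Q \<phi>"
      unfolding p_linear_map_def by blast
    have "\<phi> (c \<otimes>\<^bsub>Q\<^esub> r [^]\<^bsub>Q\<^esub> (p ^ e)) = r" if r: "r \<in> carrier Q" for r
    proof (rule inj_onD[OF inj])
      show "g (\<phi> (c \<otimes>\<^bsub>Q\<^esub> r [^]\<^bsub>Q\<^esub> (p ^ e))) = g r"
        using r c(1) \<Phi>(3)[OF imageI[OF r] imageI[OF c(1)]] \<Phi>(4)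
        by (simp add: g_\<phi> g_mult g_pow mult.commute)
    qed (use r c(1) in \<open>simp_all add: \<phi>_closed\<close>)
    with e linear show "\<exists>e\<ge>1. \<exists>\<phi>. p_linear_map p e Q \<phi> \<and>
        (\<forall>r\<in>carrier Q. \<phi> (c \<otimes>\<^bsub>Q\<^esub> r [^]\<^bsub>Q\<^esub> (p ^ e)) = r)"
      by blast
  qed
qed

text \<open>
  For \<open>c = 1\<close> one obtains a splitting \<open>\<phi>\<close> of some power \<open>F^e\<close> with \<open>e \<ge> 1\<close>, and then \<open>\<phi> \<circ> F^(e-1)\<close>
  splits \<open>F\<close>; its additivity is that of Frobenius.
\<close>

lemma strongly_F_regular_imp_F_pure:
  assumes "cring Q"
    and frobenius: "\<And>a b n. a \<in> carrier Q \<Longrightarrow> b \<in> carrier Q \<Longrightarrow>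
      (a \<oplus>\<^bsub>Q\<^esub> b) [^]\<^bsub>Q\<^esub> (p ^ n) = a [^]\<^bsub>Q\<^esub> (p ^ n) \<oplus>\<^bsub>Q\<^esub> b [^]\<^bsub>Q\<^esub> (p ^ n)"
    and sfr: "strongly_F_regular p Q"
  shows "F_pure p Q"
proof -
  interpret Q: cring Q by fact
  have "\<one>\<^bsub>Q\<^esub> \<notin> P" if "minimal_prime P Q" for P
    using that primeideal.I_notcarr ideal.one_imp_carrier unfolding minimal_prime_def
    by (metis primeideal.axioms(1))
  then obtain e \<phi> where e: "e \<ge> 1" and \<phi>: "p_linear_map p e Q \<phi>"
    "\<And>r. r \<in> carrier Q \<Longrightarrow> \<phi> (\<one>\<^bsub>Q\<^esub> \<otimes>\<^bsub>Q\<^esub> r [^]\<^bsub>Q\<^esub> (p ^ e)) = r"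
    using sfr Q.one_closed unfolding strongly_F_regular_def by meson
  define \<psi> where "\<psi> s = \<phi> (s [^]\<^bsub>Q\<^esub> (p ^ (e - 1)))" for s
  have hom: "\<phi> \<in> hom (add_monoid Q) (add_monoid Q)"
    and linear: "\<And>r s. r \<in> carrier Q \<Longrightarrow> s \<in> carrier Q \<Longrightarrow> \<phi> (r [^]\<^bsub>Q\<^esub> (p ^ e) \<otimes>\<^bsub>Q\<^esub> s) = r \<otimes>\<^bsub>Q\<^esub> \<phi> s"
    using \<phi>(1) unfolding p_linear_map_def by blast+
  have "\<psi> \<in> hom (add_monoid Q) (add_monoid Q)"
  proof (rule homI)
    fix a b assume ab: "a \<in> carrier (add_monoid Q)" "b \<in> carrier (add_monoid Q)"
    show "\<psi> a \<in> carrier (add_monoid Q)"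
      unfolding \<psi>_def using hom_in_carrier[OF hom] ab by simp
    show "\<psi> (a \<otimes>\<^bsub>add_monoid Q\<^esub> b) = \<psi> a \<otimes>\<^bsub>add_monoid Q\<^esub> \<psi> b"
      unfolding \<psi>_def using hom_mult[OF hom] ab by (simp add: frobenius)
  qed
  moreover have pe: "p * p ^ (e - Suc 0) = p ^ e"
    using e by (cases e) simp_all
  have "\<psi> (r [^]\<^bsub>Q\<^esub> (p ^ 1) \<otimes>\<^bsub>Q\<^esub> s) = r \<otimes>\<^bsub>Q\<^esub> \<psi> s" if "r \<in> carrier Q" "s \<in> carrier Q" for r s
    using that linear[of r "s [^]\<^bsub>Q\<^esub> (p ^ (e - 1))"]
    by (simp add: \<psi>_def Q.nat_pow_distrib Q.nat_pow_pow pe)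
  ultimately have "p_linear_map p 1 Q \<psi>"
    unfolding p_linear_map_def by blast
  moreover have "\<psi> (r [^]\<^bsub>Q\<^esub> p) = r" if "r \<in> carrier Q" for r
    using \<phi>(2)[OF that] that by (simp add: \<psi>_def Q.nat_pow_pow pe)
  ultimately show ?thesis
    unfolding F_pure_def by blast
qed

text \<open>
  Apply the splitting to the equation: in an F-pure ring \<open>f^p \<in> (a^p, b^p)\<close> implies \<open>f \<in> (a, b)\<close>.
\<close>

lemma F_pure_ideal_frobenius_closed:
  assumes "cring Q" "F_pure p Q"
    and carr: "f \<in> carrier Q" "a \<in> carrier Q" "b \<in> carrier Q" "h \<in> carrier Q" "k \<in> carrier Q"
    and eq: "f [^]\<^bsub>Q\<^esub> p = a [^]\<^bsub>Q\<^esub> p \<otimes>\<^bsub>Q\<^esub> h \<oplus>\<^bsub>Q\<^esub> b [^]\<^bsub>Q\<^esub> p \<otimes>\<^bsub>Q\<^esub> k"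
  obtains h' k' where "h' \<in> carrier Q" "k' \<in> carrier Q" "f = a \<otimes>\<^bsub>Q\<^esub> h' \<oplus>\<^bsub>Q\<^esub> b \<otimes>\<^bsub>Q\<^esub> k'"
proof -
  interpret Q: cring Q by fact
  obtain \<phi> where \<phi>: "p_linear_map p 1 Q \<phi>" "\<And>r. r \<in> carrier Q \<Longrightarrow> \<phi> (r [^]\<^bsub>Q\<^esub> p) = r"
    using assms(2) unfolding F_pure_def by blast
  have hom: "\<phi> \<in> hom (add_monoid Q) (add_monoid Q)"
    and linear: "\<And>r s. r \<in> carrier Q \<Longrightarrow> s \<in> carrier Q \<Longrightarrow> \<phi> (r [^]\<^bsub>Q\<^esub> p \<otimes>\<^bsub>Q\<^esub> s) = r \<otimes>\<^bsub>Q\<^esub> \<phi> s"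
    using \<phi>(1) unfolding p_linear_map_def by auto
  have "f = \<phi> (a [^]\<^bsub>Q\<^esub> p \<otimes>\<^bsub>Q\<^esub> h \<oplus>\<^bsub>Q\<^esub> b [^]\<^bsub>Q\<^esub> p \<otimes>\<^bsub>Q\<^esub> k)"
    using \<phi>(2)[OF carr(1)] eq by simp
  also have "\<dots> = \<phi> (a [^]\<^bsub>Q\<^esub> p \<otimes>\<^bsub>Q\<^esub> h) \<oplus>\<^bsub>Q\<^esub> \<phi> (b [^]\<^bsub>Q\<^esub> p \<otimes>\<^bsub>Q\<^esub> k)"
    using hom_mult[OF hom, of "a [^]\<^bsub>Q\<^esub> p \<otimes>\<^bsub>Q\<^esub> h" "b [^]\<^bsub>Q\<^esub> p \<otimes>\<^bsub>Q\<^esub> k"] carr by simp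
  also have "\<dots> = a \<otimes>\<^bsub>Q\<^esub> \<phi> h \<oplus>\<^bsub>Q\<^esub> b \<otimes>\<^bsub>Q\<^esub> \<phi> k"
    using carr by (simp add: linear)
  finally show thesis
    using that[of "\<phi> h" "\<phi> k"] hom_in_carrier[OF hom] carr by simp
qed

lemma unique_maximalideal_if_local:
  assumes "cring R" "ideal M R" "M \<noteq> carrier R"
    and units: "\<And>a. a \<in> carrier R \<Longrightarrow> a \<notin> M \<Longrightarrow> a \<in> Units R"
  shows "the_maxideal R = M"
  unfolding the_maxideal_def
proof (rule the_equality)
  interpret R: cring R by fact
  interpret M: ideal M R by fact
  have sub: "J \<subseteq> M" if J: "ideal J R" "J \<noteq> carrier R" for J
  proof
    fix a assume a: "a \<in> J"
    show "a \<in> M"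
    proof (rule ccontr)
      assume "a \<notin> M"
      hence "a \<in> Units R"
        using units[OF ideal.Icarr[OF J(1) a]] by blast
      hence "\<one>\<^bsub>R\<^esub> \<in> J"
        using ideal.I_l_closed[OF J(1) a, of "inv\<^bsub>R\<^esub> a"] by simp
      thus False
        using ideal.one_imp_carrier[OF J(1)] J(2) by simp
    qed
  qed
  show max: "maximalideal M R"
  proof (rule maximalidealI)
    show "J = M \<or> J = carrier R" if "ideal J R" "M \<subseteq> J" "J \<subseteq> carrier R" for J
      using sub[OF that(1)] that(2) by blast
  qed (use assms in auto)
  fix N assume N: "maximalideal N R"
  interpret N: maximalideal N R by fact
  have "N \<subseteq> M"
    by (rule sub[OF N.is_ideal]) (use N.I_notcarr in auto)
  thus "N = M"
    using N.I_maximal[OF assms(2)] assms(3) M.a_subset by blast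
qed

lemma power_in_ideals_set_power:
  assumes "cring R" "ideal M R" "a \<in> M"
  shows "a [^]\<^bsub>R\<^esub> (n :: nat) \<in> M [^]\<^bsub>ideals_set R\<^esub> n"
proof (induction n)
  case 0
  interpret R: cring R by fact
  show ?case by (simp add: ideals_set_def)
next
  case (Suc n)
  thus ?case
    using ideal_prod.prod[OF Suc assms(3)] by (simp add: ideals_set_def)
qed

section \<open>The determinantal ring at the origin\<close>

lemma det_2x2:
  assumes "A \<in> carrier_mat 2 2"
  shows "det A = A $$ (0, 0) * A $$ (1, 1) - A $$ (0, 1) * (A $$ (1, 0) :: 'a::comm_ring_1)"
proof -
  have del: "mat_delete A 0 j \<in> carrier_mat 1 1" for j
    using assms by (simp add: mat_delete_def)
  have "det A = (\<Sum>j<2. A $$ (0, j) * cofactor A 0 j)"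
    by (rule laplace_expansion_row[OF assms]) simp
  also have "\<dots> = A $$ (0, 0) * mat_delete A 0 0 $$ (0, 0) - A $$ (0, 1) * mat_delete A 0 1 $$ (0, 0)"
    unfolding cofactor_def det_single[OF del] by (simp add: numeral_2_eq_2)
  also have "\<dots> = A $$ (0, 0) * A $$ (1, 1) - A $$ (0, 1) * A $$ (1, 0)"
    using assms by (simp add: mat_delete_def)
  finally show ?thesis .
qed

lemma pick_pair:
  assumes "i < (j :: nat)"
  shows "pick {i, j} 0 = i" "pick {i, j} (Suc 0) = j"
proof -
  show 0: "pick {i, j} 0 = i"
    using assms by (auto intro!: Least_equality)
  show "pick {i, j} (Suc 0) = j"
    unfolding pick.simps(2) 0 using assms by (auto intro!: Least_equality)
qed

lemma det_submatrix_pair: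
  assumes "i < i'" "i' < dim_row A" "j < j'" "j' < dim_col A"
  shows "det (submatrix A {i, i'} {j, j'}) = A $$ (i, j) * A $$ (i', j') - A $$ (i, j') * (A $$ (i', j) :: 'a::comm_ring_1)"
proof -
  have rows: "{a. a < dim_row A \<and> a \<in> {i, i'}} = {i, i'}" and cols: "{a. a < dim_col A \<and> a \<in> {j, j'}} = {j, j'}"
    using assms by auto
  have card: "card {i, i'} = 2" "card {j, j'} = 2"
    using assms by simp_all
  have M: "submatrix A {i, i'} {j, j'} \<in> carrier_mat 2 2"
    by (rule carrier_matI) (simp_all only: dim_submatrix rows cols card)
  have entry: "submatrix A {i, i'} {j, j'} $$ (a, b) = A $$ (pick {i, i'} a, pick {j, j'} b)" if "a < 2" "b < 2" for a b
    by (rule submatrix_index) (simp_all only: rows cols card that)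
  show ?thesis
    using pick_pair[OF assms(1)] pick_pair[OF assms(3)]
    by (simp add: det_2x2[OF M] entry)
qed

lemma card_2_nat:
  assumes "card (J :: nat set) = 2"
  obtains i j where "J = {i, j}" "i < j"
proof -
  obtain i j where "J = {i, j}" "i \<noteq> j"
    using assms by (auto simp: card_2_iff)
  thus thesis
    using that[of i j] that[of j i] by (cases "i < j") (auto simp: insert_commute)
qed

lemma minors_2_of_2x3:
  fixes A :: "'a::comm_ring_1 mat"
  assumes "dim_row A = 2" "dim_col A = 3"
  shows "minors 2 A = {A $$ (0, 0) * A $$ (1, 1) - A $$ (0, 1) * A $$ (1, 0),
     A $$ (0, 0) * A $$ (1, 2) - A $$ (0, 2) * A $$ (1, 0),
     A $$ (0, 1) * A $$ (1, 2) - A $$ (0, 2) * A $$ (1, 1)}" (is "_ = ?M")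
proof
  show "minors 2 A \<subseteq> ?M"
  proof
    fix f assume "f \<in> minors 2 A"
    then obtain I J where f: "f = det (submatrix A I J)" and IJ: "I \<subseteq> {..<2}" "J \<subseteq> {..<3}" "card I = 2" "card J = 2"
      unfolding minors_def assms by auto
    obtain i i' where I: "I = {i, i'}" "i < i'"
      by (rule card_2_nat[OF IJ(3)])
    obtain j j' where J: "J = {j, j'}" "j < j'"
      by (rule card_2_nat[OF IJ(4)])
    have "i = 0" "i' = 1"
      using I IJ(1) by auto
    moreover have "j = 0 \<and> j' = 1 \<or> j = 0 \<and> j' = 2 \<or> j = 1 \<and> j' = 2"
      using J IJ(2) by auto
    ultimately show "f \<in> ?M"
      using det_submatrix_pair[of i i' A j j'] assms unfolding f I(1) J(1) by auto
  qed
  show "?M \<subseteq> minors 2 A"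
  proof -
    have mem: "A $$ (0, j) * A $$ (1, j') - A $$ (0, j') * A $$ (1, j) \<in> minors 2 A"
      if j: "j < j'" "j' < 3" for j j'
    proof -
      have "A $$ (0, j) * A $$ (1, j') - A $$ (0, j') * A $$ (1, j) = det (submatrix A {0, 1} {j, j'})"
        using det_submatrix_pair[of 0 1 A j j'] j assms by simp
      moreover have "{0, 1} \<subseteq> {..<dim_row A}" "{j, j'} \<subseteq> {..<dim_col A}" "card {0, 1 :: nat} = 2" "card {j, j'} = 2"
        using j assms by auto
      ultimately show ?thesis
        unfolding minors_def by blast
    qed
    from mem[of 0 1] mem[of 0 2] mem[of 1 2] show ?thesis by simp
  qed
qed

lemma minors_eq:
  fixes x y z u v :: "'k::field poly6"
  assumes "x = pvar VX" "y = pvar VY" "z = pvar VZ" "u = pvar VU" "v = pvar VV"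
  shows "minors 2 (mat_of_rows_list 3 [[x\<^sup>2 + v ^ 5, y, u], [z, x\<^sup>2, y\<^sup>2 - u]]) = {minor_12, minor_13, minor_23}"
  by (subst minors_2_of_2x3)
     (simp_all add: mat_of_rows_list_def minor_12_def minor_13_def minor_23_def assms)

definition constant_term :: "'k::field poly6 \<Rightarrow> 'k" where
  "constant_term = eval_poly (\<lambda>c. c) (\<lambda>_. 0)"

lemma comm_ring_hom_id: "comm_ring_hom (\<lambda>c :: 'a::comm_ring_1. c)"
  by standard simp_all

interpretation constant_term: comm_ring_hom "constant_term :: 'k::field poly6 \<Rightarrow> 'k"
  unfolding constant_term_def
  by (rule comm_ring_hom.comm_ring_hom_eval_poly[OF comm_ring_hom_id])

lemma constant_term_pvar: "constant_term (pvar i) = 0"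
  unfolding constant_term_def by (rule eval_poly_var[OF comm_ring_hom_id])

lemma constant_term_const: "constant_term (const c) = c"
  unfolding constant_term_def
  by (simp add: comm_ring_hom.eval_poly_single[OF comm_ring_hom_id])

lemma constant_term_cover: "constant_term (cover f) = constant_term f"
proof -
  have zero: "constant_term (cover_var i) = 0" for i
    by (cases i) (simp_all add: edge_form_def plus_form_def minus_form_def constant_term.hom_mult
        constant_term.hom_add constant_term.hom_minus constant_term.hom_uminus constant_term.hom_power
        constant_term_pvar constant_term.hom_zero)
  have "constant_term (cover f) = eval_poly (\<lambda>c. c) (\<lambda>_. 0) f"
    unfolding cover_def eval_poly_comp[OF constant_term.comm_ring_hom_axioms]
    by (simp add: constant_term_const zero)
  thus ?thesis
    by (simp only: constant_term_def)
qed

text \<open>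
  The ideal \<open>n\<close> consists of the polynomials without constant term. This makes visible that it is prime, so
  that the localization is a ring.
\<close>

lemma genideal_variables:
  "Idl\<^bsub>ring_of_type_algebra\<^esub> {pvar VX, pvar VY, pvar VZ, pvar VU, pvar VV, pvar VW}
    = {f :: 'k::field poly6. constant_term f = 0}" (is "Idl\<^bsub>?R\<^esub> ?V = ?n")
proof
  interpret R: cring "?R :: 'k poly6 ring" by (rule cring_from_type_algebra)
  have R: "?R = type_subring (UNIV :: 'k poly6 set)"
    by (simp add: ring_of_type_algebra_def)
  have "ideal ?n (type_subring UNIV)"
    by (rule type_subring_idealI)
       (auto simp: constant_term.hom_zero constant_term.hom_add constant_term.hom_mult cring_type_subring)
  hence "ideal ?n ?R"
    using R by simp
  thus "Idl\<^bsub>?R\<^esub> ?V \<subseteq> ?n"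
    by (rule R.genideal_minimal) (simp add: constant_term_pvar)
  show "?n \<subseteq> Idl\<^bsub>?R\<^esub> ?V"
  proof
    interpret I: ideal "Idl\<^bsub>?R\<^esub> ?V" ?R
      by (rule R.genideal_ideal) simp
    have var: "pvar i \<in> Idl\<^bsub>?R\<^esub> ?V" for i
      using R.genideal_self[of ?V] by (cases i) auto
    have diff: "f - const (constant_term f) \<in> Idl\<^bsub>?R\<^esub> ?V" for f
    proof (induction f rule: poly_mapping_additive_induct)
      case (single m c)
      show ?case
      proof (cases "m = 0")
        case True
        thus ?thesis
          using I.zero_closed by (simp add: constant_term_const)
      next
        case False
        then obtain i where i: "Poly_Mapping.lookup m i \<noteq> 0"
          by (metis lookup_zero poly_mapping_eqI)
        have "Poly_Mapping.single i 1 + (m - Poly_Mapping.single i 1) = m"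
          using i by (intro poly_mapping_eqI) (auto simp: lookup_add lookup_minus lookup_single when_def)
        hence "Poly_Mapping.single m c = pvar i * Poly_Mapping.single (m - Poly_Mapping.single i 1) c"
          by (simp add: pvar_def mult_single)
        thus ?thesis
          using I.I_r_closed[OF var[of i]] by (simp add: constant_term.hom_mult constant_term_pvar)
      qed
    next
      case (add f g)
      thus ?case
        using I.a_closed[OF add.IH] by (simp add: constant_term.hom_add single_add add_diff_add)
    qed
    fix f assume "f \<in> ?n"
    thus "f \<in> Idl\<^bsub>?R\<^esub> ?V"
      using diff[of f] by simp
  qed
qed

definition local_fractions :: "'k::field poly6 fract set" where
  "local_fractions = {Fract a b | a b. constant_term b \<noteq> 0}"

abbreviation origin_ring :: "'k::field poly6 fract ring" where
  "origin_ring \<equiv> type_subring local_fractions"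

lemma localization_at_origin:
  "localization_at {f :: 'k::field poly6. constant_term f = 0} = origin_ring"
  by (simp add: localization_at_def local_fractions_def)

lemma constant_term_nonzero: "constant_term b \<noteq> 0 \<Longrightarrow> b \<noteq> 0"
  using constant_term.hom_zero by metis

lemma local_fractionsI: "constant_term b \<noteq> 0 \<Longrightarrow> Fract a b \<in> local_fractions"
  unfolding local_fractions_def by blast

lemma constant_term_mult_nonzero:
  "constant_term a \<noteq> 0 \<Longrightarrow> constant_term b \<noteq> 0 \<Longrightarrow> constant_term (a * b) \<noteq> 0"
  by (simp add: constant_term.hom_mult)

definition extension_to_origin :: "'k::field poly6 set \<Rightarrow> 'k poly6 fract set" where
  "extension_to_origin J = {Fract a b | a b. a \<in> J \<and> constant_term b \<noteq> 0}"

lemma local_fractionsE: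
  assumes "a \<in> local_fractions"
  obtains f g where "a = Fract f g" "constant_term g \<noteq> 0"
  using assms unfolding local_fractions_def by blast

lemma extension_to_originI:
  "f \<in> J \<Longrightarrow> constant_term g \<noteq> 0 \<Longrightarrow> Fract f g \<in> extension_to_origin J"
  unfolding extension_to_origin_def by blast

lemma extension_to_originE:
  assumes "a \<in> extension_to_origin J"
  obtains f g where "a = Fract f g" "f \<in> J" "constant_term g \<noteq> 0"
  using assms unfolding extension_to_origin_def by blast

lemma local_fractions_uminus: "a \<in> local_fractions \<Longrightarrow> - a \<in> local_fractions"
  by (elim local_fractionsE) (simp add: local_fractionsI)

lemma cring_origin_ring: "cring (origin_ring :: 'k::field poly6 fract ring)"
proof (rule cring_type_subring)
  show "(1 :: 'k poly6 fract) \<in> local_fractions"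
    unfolding One_fract_def by (rule local_fractionsI) (simp add: constant_term.hom_one)
  fix a b :: "'k poly6 fract" assume ab: "a \<in> local_fractions" "b \<in> local_fractions"
  obtain f g where a: "a = Fract f g" "constant_term g \<noteq> 0"
    using ab(1) by (rule local_fractionsE)
  obtain f' g' where b: "b = Fract f' g'" "constant_term g' \<noteq> 0"
    using ab(2) by (rule local_fractionsE)
  note gg' = constant_term_mult_nonzero[OF a(2) b(2)]
  show "a * b \<in> local_fractions"
    using local_fractionsI[OF gg', of "f * f'"] by (simp add: a b)
  show "a + b \<in> local_fractions"
    using local_fractionsI[OF gg', of "f * g' + f' * g"] constant_term_nonzero[OF a(2)] constant_term_nonzero[OF b(2)]
    by (simp add: a b)
qed (rule local_fractions_uminus)

lemma ideal_extension_to_origin: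
  fixes J :: "'k::field poly6 set"
  assumes "0 \<in> J" and add: "\<And>f g. f \<in> J \<Longrightarrow> g \<in> J \<Longrightarrow> f + g \<in> J" and mult: "\<And>f h. f \<in> J \<Longrightarrow> h * f \<in> J"
  shows "ideal (extension_to_origin J) origin_ring"
proof (rule type_subring_idealI[OF cring_origin_ring local_fractions_uminus])
  show "extension_to_origin J \<subseteq> local_fractions"
    unfolding extension_to_origin_def local_fractions_def by blast
  show "0 \<in> extension_to_origin J"
    unfolding Zero_fract_def by (rule extension_to_originI[OF assms(1)]) (simp add: constant_term.hom_one)
  fix a b :: "'k poly6 fract"
  assume "a \<in> extension_to_origin J"
  then obtain f g where a: "a = Fract f g" "f \<in> J" "constant_term g \<noteq> 0"
    by (rule extension_to_originE)
  show "a + b \<in> extension_to_origin J" if b_mem: "b \<in> extension_to_origin J"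
  proof -
    obtain f' g' where b: "b = Fract f' g'" "f' \<in> J" "constant_term g' \<noteq> 0"
      using b_mem by (rule extension_to_originE)
    have "f * g' + f' * g \<in> J"
      using add[OF mult[OF a(2), of g'] mult[OF b(2), of g]] by (simp add: mult.commute)
    from extension_to_originI[OF this constant_term_mult_nonzero[OF a(3) b(3)]] show ?thesis
      using constant_term_nonzero[OF a(3)] constant_term_nonzero[OF b(3)] by (simp add: a(1) b(1))
  qed
  show "b * a \<in> extension_to_origin J" if b_mem: "b \<in> local_fractions"
  proof -
    obtain f' g' where b: "b = Fract f' g'" "constant_term g' \<noteq> 0"
      using b_mem by (rule local_fractionsE)
    from extension_to_originI[OF mult[OF a(2), of f'] constant_term_mult_nonzero[OF b(2) a(3)]]
    show ?thesis by (simp add: a(1) b(1))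
  qed
qed

lemma extension_to_origin_contraction:
  assumes "Fract f s \<in> extension_to_origin J" "s \<noteq> 0" and mult: "\<And>f h. f \<in> J \<Longrightarrow> h * f \<in> J"
  obtains t where "constant_term t \<noteq> 0" "t * f \<in> J"
proof -
  obtain a b where ab: "Fract f s = Fract a b" "a \<in> J" "constant_term b \<noteq> 0"
    using assms(1) by (rule extension_to_originE)
  hence "f * b = a * s"
    using assms(2) constant_term_nonzero[of b] by (simp add: eq_fract)
  hence "b * f \<in> J"
    using mult[OF ab(2), of s] by (simp add: mult.commute)
  thus thesis
    using that ab(3) by blast
qed

text \<open>
  A \<open>p^(-e)\<close>-linear map \<open>\<psi>\<close> extends to fractions by \<open>a / b = a b^(q-1) / b^q \<mapsto> \<psi>(a b^(q-1)) / b\<close>, where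
  \<open>q = p^e\<close>.
\<close>

lemma frobenius_map_extends_to_fractions:
  fixes \<psi> :: "'a::idom \<Rightarrow> 'a"
  assumes A_mult: "\<And>a b. a \<in> A \<Longrightarrow> b \<in> A \<Longrightarrow> a * b \<in> A"
    and A_add: "\<And>a b. a \<in> A \<Longrightarrow> b \<in> A \<Longrightarrow> a + b \<in> A"
    and D: "D \<subseteq> A" "0 \<notin> D" "\<And>a b. a \<in> D \<Longrightarrow> b \<in> D \<Longrightarrow> a * b \<in> D"
    and q: "q > 0"
    and \<psi>_add: "\<And>a b. \<psi> (a + b) = \<psi> a + \<psi> b"
    and \<psi>_linear: "\<And>r s. r \<in> A \<Longrightarrow> \<psi> (r ^ q * s) = r * \<psi> s"
  obtains \<Phi> where "\<And>a b. a \<in> A \<Longrightarrow> b \<in> D \<Longrightarrow> \<Phi> (Fract a b) = Fract (\<psi> (a * b ^ (q - 1))) b"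
    "\<And>a b a' b'. a \<in> A \<Longrightarrow> b \<in> D \<Longrightarrow> a' \<in> A \<Longrightarrow> b' \<in> D \<Longrightarrow>
      \<Phi> (Fract a b + Fract a' b') = \<Phi> (Fract a b) + \<Phi> (Fract a' b')"
    "\<And>a b a' b'. a \<in> A \<Longrightarrow> b \<in> D \<Longrightarrow> a' \<in> A \<Longrightarrow> b' \<in> D \<Longrightarrow>
      \<Phi> (Fract a b ^ q * Fract a' b') = Fract a b * \<Phi> (Fract a' b')"
proof -
  have pow: "b ^ q = b * b ^ (q - 1)" for b :: 'a
    using q by (cases q) simp_all
  have A_pow: "a ^ n \<in> A" if "a \<in> A" "n > 0" for a and n :: nat
    using that(2)
  proof (induction n)
    case (Suc n)
    thus ?case using A_mult[OF that(1)] that(1) by (cases "n = 0") simp_all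
  qed simp
  have swap: "b' * \<psi> (a * b ^ (q - 1)) = \<psi> (a * b' * (b * b') ^ (q - 1))" if "a \<in> A" "b \<in> D" "b' \<in> D" for a b b'
  proof -
    have "b' * \<psi> (a * b ^ (q - 1)) = \<psi> (b' ^ q * (a * b ^ (q - 1)))"
      using \<psi>_linear[of b'] that D(1) by auto
    thus ?thesis
      by (simp add: pow power_mult_distrib mult_ac)
  qed
  have well_defined: "Fract (\<psi> (a * b ^ (q - 1))) b = Fract (\<psi> (a' * b' ^ (q - 1))) b'"
    if "a \<in> A" "b \<in> D" "a' \<in> A" "b' \<in> D" "Fract a b = Fract a' b'" for a b a' b'
  proof -
    have nz: "b \<noteq> 0" "b' \<noteq> 0"
      using that D(2) by auto
    hence "a * b' = a' * b"
      using that(5) by (simp add: eq_fract)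
    hence "b' * \<psi> (a * b ^ (q - 1)) = b * \<psi> (a' * b' ^ (q - 1))"
      using swap[of a b b'] swap[of a' b' b] that by (simp add: mult.commute)
    thus ?thesis
      using nz by (simp add: eq_fract mult.commute)
  qed
  define \<Phi> where "\<Phi> r = (SOME t. \<exists>a b. a \<in> A \<and> b \<in> D \<and> r = Fract a b \<and> t = Fract (\<psi> (a * b ^ (q - 1))) b)" for r
  have \<Phi>: "\<Phi> (Fract a b) = Fract (\<psi> (a * b ^ (q - 1))) b" if "a \<in> A" "b \<in> D" for a b
    unfolding \<Phi>_def
  proof (rule some_equality)
    fix t assume "\<exists>a' b'. a' \<in> A \<and> b' \<in> D \<and> Fract a b = Fract a' b' \<and> t = Fract (\<psi> (a' * b' ^ (q - 1))) b'"
    thus "t = Fract (\<psi> (a * b ^ (q - 1))) b"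
      using well_defined[OF that] by metis
  qed (use that in blast)
  show thesis
  proof (rule that[OF \<Phi>])
    fix a b a' b' assume *: "a \<in> A" "b \<in> D" "a' \<in> A" "b' \<in> D"
    hence nz: "b \<noteq> 0" "b' \<noteq> 0"
      using D(2) by auto
    have bb': "b \<in> A" "b' \<in> A" "b * b' \<in> D"
      using * D by auto
    have "\<Phi> (Fract a b + Fract a' b') = Fract (\<psi> ((a * b' + a' * b) * (b * b') ^ (q - 1))) (b * b')"
      using \<Phi>[of "a * b' + a' * b" "b * b'"] * bb' nz by (simp add: A_add A_mult)
    also have "\<psi> ((a * b' + a' * b) * (b * b') ^ (q - 1)) = b' * \<psi> (a * b ^ (q - 1)) + b * \<psi> (a' * b' ^ (q - 1))"
      using swap[of a b b'] swap[of a' b' b] * by (simp add: distrib_right \<psi>_add mult.commute)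
    finally show "\<Phi> (Fract a b + Fract a' b') = \<Phi> (Fract a b) + \<Phi> (Fract a' b')"
      using nz by (simp add: \<Phi> * mult.commute)
    have D_pow: "b ^ q \<in> D" if "b \<in> D" for b
    proof -
      have "b ^ Suc n \<in> D" for n
        by (induction n) (use that D(3) in auto)
      thus ?thesis using q by (cases q) auto
    qed
    have "Fract a b ^ q = Fract (a ^ q) (b ^ q)"
      by (induction q) (simp_all add: One_fract_def)
    hence "\<Phi> (Fract a b ^ q * Fract a' b') = Fract (\<psi> (a ^ q * a' * (b ^ q * b') ^ (q - 1))) (b ^ q * b')"
      using \<Phi>[of "a ^ q * a'" "b ^ q * b'"] * D_pow D(3) A_pow q A_mult by simp
    also have "a ^ q * a' * (b ^ q * b') ^ (q - 1) = (a * b ^ (q - 1)) ^ q * (a' * b' ^ (q - 1))"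
      by (simp add: power_mult_distrib mult_ac flip: power_mult)
    also have "\<psi> \<dots> = a * b ^ (q - 1) * \<psi> (a' * b' ^ (q - 1))"
    proof (rule \<psi>_linear)
      show "a * b ^ (q - 1) \<in> A"
        using * bb' A_pow[of b "q - 1"] by (cases "q - 1 = 0") (auto intro: A_mult)
    qed
    also have "Fract (a * b ^ (q - 1) * \<psi> (a' * b' ^ (q - 1))) (b ^ q * b') = Fract a b * Fract (\<psi> (a' * b' ^ (q - 1))) b'"
      using nz by (simp add: eq_fract pow mult_ac)
    finally show "\<Phi> (Fract a b ^ q * Fract a' b') = Fract a b * \<Phi> (Fract a' b')"
      by (simp add: \<Phi> *)
  qed
qed

definition minors_ideal :: "'k::field poly6 fract set" where
  "minors_ideal = Idl\<^bsub>origin_ring\<^esub> ((\<lambda>f. Fract f 1) ` {minor_12, minor_13, minor_23})"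

lemma Fract_1_in_local_fractions: "Fract f 1 \<in> (local_fractions :: 'k::field poly6 fract set)"
  by (rule local_fractionsI) (simp add: constant_term.hom_one)

lemma ideal_minors_ideal: "ideal minors_ideal (origin_ring :: 'k::field poly6 fract ring)"
proof -
  interpret S: cring "origin_ring :: 'k poly6 fract ring" by (rule cring_origin_ring)
  show ?thesis
    unfolding minors_ideal_def by (rule S.genideal_ideal) (auto intro: Fract_1_in_local_fractions)
qed

text \<open>
  Membership in the ideal of the minors is refuted by exhibiting a larger ideal of polynomials.
\<close>

lemma minors_ideal_subset_extension:
  fixes J :: "'k::field poly6 set"
  assumes J: "0 \<in> J" "\<And>f g. f \<in> J \<Longrightarrow> g \<in> J \<Longrightarrow> f + g \<in> J" "\<And>f h. f \<in> J \<Longrightarrow> h * f \<in> J"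
    and minors: "minor_12 \<in> J" "minor_13 \<in> J" "minor_23 \<in> J"
  shows "minors_ideal \<subseteq> extension_to_origin J"
proof -
  interpret S: cring "origin_ring :: 'k poly6 fract ring" by (rule cring_origin_ring)
  show ?thesis
    unfolding minors_ideal_def
    by (rule S.genideal_minimal[OF ideal_extension_to_origin[OF J]])
       (use minors in \<open>auto intro!: extension_to_originI simp: constant_term.hom_one\<close>)
qed

lemma minors_ideal_combination:
  assumes b: "constant_term b \<noteq> (0 :: 'k::field)"
  shows "Fract (c1 * minor_12 + c2 * minor_13 + c3 * minor_23) b \<in> minors_ideal"
proof -
  interpret S: cring "origin_ring :: 'k poly6 fract ring" by (rule cring_origin_ring)
  interpret I: ideal minors_ideal "origin_ring :: 'k poly6 fract ring" by (rule ideal_minors_ideal)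
  have gens: "Fract f 1 \<in> minors_ideal" if "f \<in> {minor_12, minor_13, minor_23}" for f :: "'k poly6"
    using S.genideal_self[of "(\<lambda>f. Fract f 1) ` {minor_12, minor_13, minor_23}"] that
    unfolding minors_ideal_def by (auto intro: Fract_1_in_local_fractions)
  have "Fract c b * Fract f 1 \<in> minors_ideal" if "f \<in> {minor_12, minor_13, minor_23}" for c f :: "'k poly6"
    using I.I_l_closed[OF gens[OF that], of "Fract c b"] local_fractionsI[OF b] by simp
  hence frac: "Fract (c * f) b \<in> minors_ideal" if "f \<in> {minor_12, minor_13, minor_23}" for c f :: "'k poly6"
    using that by simp
  have "Fract (c1 * minor_12) b + Fract (c2 * minor_13) b + Fract (c3 * minor_23) b \<in> minors_ideal"
    using I.a_closed[OF I.a_closed[OF frac frac] frac] by simp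
  moreover have "Fract (c1 * minor_12) b + Fract (c2 * minor_13) b + Fract (c3 * minor_23) b
      = Fract (c1 * minor_12 + c2 * minor_13 + c3 * minor_23) b"
    using constant_term_nonzero[OF b] by (simp add: eq_fract algebra_simps)
  ultimately show ?thesis by simp
qed

lemma origin_ring_minus:
  assumes "a \<in> local_fractions" "b \<in> local_fractions"
  shows "a \<ominus>\<^bsub>origin_ring\<^esub> b = a - (b :: 'k::field poly6 fract)"
  using assms type_subring_a_inv[OF cring_origin_ring assms(2) local_fractions_uminus[OF assms(2)]]
  by (simp add: a_minus_def)

lemma ring_hom_power:
  assumes "p \<in> Ring.ring_hom S Q" "cring S" "cring Q" "s \<in> carrier S"
  shows "p (s [^]\<^bsub>S\<^esub> (n :: nat)) = p s [^]\<^bsub>Q\<^esub> n"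
proof -
  interpret ring_hom_cring S Q p
    using assms by (intro ring_hom_cring.intro ring_hom_cring_axioms.intro)
  show ?thesis using assms(4) by (induction n) simp_all
qed

lemma frobenius_add_quotient:
  fixes p :: "'k::field poly6 fract \<Rightarrow> 'q"
  assumes char: "CHAR('k) = 3" and p: "p \<in> Ring.ring_hom origin_ring Q" "cring Q"
    "p ` local_fractions = carrier Q" and ab: "a \<in> carrier Q" "b \<in> carrier Q"
  shows "(a \<oplus>\<^bsub>Q\<^esub> b) [^]\<^bsub>Q\<^esub> ((3 :: nat) ^ n) = a [^]\<^bsub>Q\<^esub> ((3 :: nat) ^ n) \<oplus>\<^bsub>Q\<^esub> b [^]\<^bsub>Q\<^esub> ((3 :: nat) ^ n)"
proof -
  obtain s t where st: "s \<in> local_fractions" "t \<in> local_fractions" "a = p s" "b = p t"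
    using ab p(3) by (metis imageE)
  interpret S: cring "origin_ring :: 'k poly6 fract ring" by (rule cring_origin_ring)
  have pow: "p (r ^ m) = p r [^]\<^bsub>Q\<^esub> m" if "r \<in> local_fractions" for r and m :: nat
    using ring_hom_power[OF p(1) S.is_cring p(2), of r m] that by (simp add: type_subring_nat_pow)
  have closed: "s + t \<in> local_fractions" "\<And>m. s ^ m \<in> local_fractions" "\<And>m. t ^ m \<in> local_fractions"
    using S.a_closed[of s t] S.nat_pow_closed[of s] S.nat_pow_closed[of t] st
    by (simp_all add: type_subring_nat_pow)
  have "(s + t) ^ (3 ^ n) = s ^ (3 ^ n) + t ^ (3 ^ n)"
    by (rule freshmans_dream') (simp_all add: CHAR_fract CHAR_poly_mapping char)
  hence "p ((s + t) ^ (3 ^ n)) = p (s ^ (3 ^ n)) \<oplus>\<^bsub>Q\<^esub> p (t ^ (3 ^ n))"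
    using ring_hom_add[OF p(1), of "s ^ (3 ^ n)" "t ^ (3 ^ n)"] closed by simp
  moreover have "p (s + t) = a \<oplus>\<^bsub>Q\<^esub> b"
    using ring_hom_add[OF p(1), of s t] st by simp
  ultimately show ?thesis
    using pow[OF closed(1), of "3 ^ n"] pow[OF st(1), of "3 ^ n"] pow[OF st(2), of "3 ^ n"] st(3,4) by simp
qed

section \<open>Failure of F-purity\<close>

text \<open>
  Write \<open>I\<close> for the ideal of the minors. Modulo \<open>I\<close> one has \<open>y^6 = u\<^sup>2 (x\<^sup>2 + y)\<^sup>2\<close> and
  \<open>v^5 y\<^sup>2 = u (z + q) - x\<^sup>2 y\<^sup>2\<close>, which lies in \<open>(u, x\<^sup>2)\<close>. Multiply the former by \<open>v^12\<close> and use the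
  latter repeatedly: each of the terms \<open>u\<^sup>2 y\<^sup>2 v^12\<close> and \<open>u\<^sup>2 x\<^sup>2 y v^12\<close> then becomes a combination of
  \<open>u^3\<close> and \<open>x^3\<close>, and \<open>u\<^sup>2 x^4 v^12\<close> is a multiple of \<open>x^3\<close> already.
\<close>

lemma frobenius_power_identity:
  fixes x y z u v :: "'a::idom"
  defines "q \<equiv> x ^ 2 + v ^ 5"
  defines "m12 \<equiv> q * x ^ 2 - y * z" and "m13 \<equiv> q * (y ^ 2 - u) - u * z" and "m23 \<equiv> y * (y ^ 2 - u) - u * x ^ 2"
  shows "\<exists>h k c1 c2 c3. (y ^ 2 * v ^ 4) ^ 3 = x ^ 3 * h + u ^ 3 * k + (c1 * m12 + c2 * m13 + c3 * m23)"
proof -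
  define A where "A = u * (x ^ 2 + y)"
  define E where "E = u * (z + q)"
  define F where "F = x ^ 2 * y ^ 2"
  have r1: "v ^ 5 * y ^ 2 = E - F + m13"
    unfolding E_def F_def m13_def q_def by Groebner_Basis.algebra
  have r2: "y ^ 3 = A + m23"
    unfolding A_def m23_def by Groebner_Basis.algebra
  have r3: "y * z = q * x ^ 2 - m12"
    unfolding m12_def by Groebner_Basis.algebra
  \<comment> \<open>Each of the following equations expresses a product through multiples of \<open>x^3\<close>, of \<open>u^3\<close> and of the
     minors; \<open>T2\<close> trades \<open>u x\<^sup>2\<close> for \<open>y^3 - u y\<close>. The coefficients at the end are collected from them.\<close>
  have T0: "v ^ 2 * u ^ 2 * x ^ 2 * (v ^ 5 * y ^ 2)
      = u ^ 3 * (v ^ 2 * x ^ 2 * (z + q)) - x ^ 3 * (x * v ^ 2 * u ^ 2 * y ^ 2) + v ^ 2 * u ^ 2 * x ^ 2 * m13"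
    unfolding r1 E_def F_def by Groebner_Basis.algebra
  have T3: "v ^ 12 * u ^ 2 * y ^ 2 = u ^ 3 * ((v ^ 7 - v ^ 2 * x ^ 2) * (z + q)) + x ^ 3 * (x * v ^ 2 * u ^ 2 * y ^ 2)
      + (v ^ 7 * u ^ 2 - v ^ 2 * u ^ 2 * x ^ 2) * m13"
  proof -
    have "v ^ 12 * u ^ 2 * y ^ 2 = v ^ 7 * u ^ 2 * (v ^ 5 * y ^ 2)"
      by Groebner_Basis.algebra
    also have "\<dots> = u ^ 3 * (v ^ 7 * (z + q)) - v ^ 2 * u ^ 2 * x ^ 2 * (v ^ 5 * y ^ 2) + v ^ 7 * u ^ 2 * m13"
      by (subst r1) (unfold E_def F_def, Groebner_Basis.algebra)
    also have "\<dots> = u ^ 3 * ((v ^ 7 - v ^ 2 * x ^ 2) * (z + q)) + x ^ 3 * (x * v ^ 2 * u ^ 2 * y ^ 2)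
      + (v ^ 7 * u ^ 2 - v ^ 2 * u ^ 2 * x ^ 2) * m13"
      unfolding T0 by Groebner_Basis.algebra
    finally show ?thesis .
  qed
  have G1: "u ^ 2 * v ^ 2 * x ^ 2 * y ^ 2 * (z + q) = x ^ 3 * (u ^ 2 * v ^ 2 * x * y * q) - u ^ 2 * v ^ 2 * x ^ 2 * y * m12
      + u ^ 3 * (v ^ 2 * x ^ 2 * (z + q)) + v ^ 2 * u ^ 2 * x ^ 2 * m13"
  proof -
    have "u ^ 2 * v ^ 2 * x ^ 2 * y ^ 2 * (z + q) = u ^ 2 * v ^ 2 * x ^ 2 * y * (y * z)
        + x ^ 3 * (x * v ^ 2 * u ^ 2 * y ^ 2) + v ^ 2 * u ^ 2 * x ^ 2 * (v ^ 5 * y ^ 2)"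
      unfolding q_def by Groebner_Basis.algebra
    also have "\<dots> = x ^ 3 * (u ^ 2 * v ^ 2 * x * y * q) - u ^ 2 * v ^ 2 * x ^ 2 * y * m12
      + u ^ 3 * (v ^ 2 * x ^ 2 * (z + q)) + v ^ 2 * u ^ 2 * x ^ 2 * m13"
      unfolding T0 r3 by Groebner_Basis.algebra
    finally show ?thesis .
  qed
  have first: "u * v ^ 12 * y ^ 4 = u ^ 3 * (v ^ 2 * (z + q) ^ 2) + x ^ 3 * (u * v ^ 2 * x * y ^ 4)
      - 2 * (u ^ 2 * v ^ 2 * x ^ 2 * y ^ 2 * (z + q)) + u * v ^ 2 * (2 * (E - F) + m13) * m13"
  proof -
    have "u * v ^ 12 * y ^ 4 = u * v ^ 2 * (v ^ 5 * y ^ 2) ^ 2"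
      by Groebner_Basis.algebra
    also have "\<dots> = u * v ^ 2 * (E - F) ^ 2 + u * v ^ 2 * (2 * (E - F) + m13) * m13"
      unfolding r1 by Groebner_Basis.algebra
    also have "u * v ^ 2 * (E - F) ^ 2 = u ^ 3 * (v ^ 2 * (z + q) ^ 2) + x ^ 3 * (u * v ^ 2 * x * y ^ 4)
      - 2 * (u ^ 2 * v ^ 2 * x ^ 2 * y ^ 2 * (z + q))"
      unfolding E_def F_def by Groebner_Basis.algebra
    finally show ?thesis .
  qed
  have T2: "v ^ 12 * u ^ 2 * x ^ 2 * y = u * v ^ 12 * y ^ 4 - v ^ 12 * u ^ 2 * y ^ 2 - u * y * v ^ 12 * m23"
    unfolding m23_def by Groebner_Basis.algebra
  have "(y ^ 2 * v ^ 4) ^ 3 = v ^ 12 * (y ^ 3) ^ 2"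
    by Groebner_Basis.algebra
  also have "\<dots> = x ^ 3 * (v ^ 12 * u ^ 2 * x) + 2 * (v ^ 12 * u ^ 2 * x ^ 2 * y) + v ^ 12 * u ^ 2 * y ^ 2
      + v ^ 12 * (2 * A + m23) * m23"
    unfolding r2 A_def by Groebner_Basis.algebra
  finally show ?thesis
    unfolding T2 first T3 G1
    by - (rule exI[of _ "v ^ 12 * u ^ 2 * x - x * v ^ 2 * u ^ 2 * y ^ 2 + 2 * (u * v ^ 2 * x * y ^ 4 - 2 * (u ^ 2 * v ^ 2 * x * y * q))"],
        rule exI[of _ "- ((v ^ 7 - v ^ 2 * x ^ 2) * (z + q)) + 2 * (v ^ 2 * (z + q) ^ 2 - 2 * (v ^ 2 * x ^ 2 * (z + q)))"],
        rule exI[of _ "4 * u ^ 2 * v ^ 2 * x ^ 2 * y"],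
        rule exI[of _ "- (v ^ 7 * u ^ 2 - v ^ 2 * u ^ 2 * x ^ 2) + 2 * (u * v ^ 2 * (2 * (E - F) + m13) - 2 * (v ^ 2 * u ^ 2 * x ^ 2))"],
        rule exI[of _ "v ^ 12 * (2 * A + m23) - 2 * (u * y * v ^ 12)"], Groebner_Basis.algebra)
qed

text \<open>
  The quotient by \<open>x, z, u\<close> and \<open>v - w^N\<close>, with values in the polynomials in \<open>y\<close> over the polynomials in
  \<open>w\<close>.
\<close>

definition curve_chart_var :: "nat \<Rightarrow> var \<Rightarrow> 'k::field poly poly" where
  "curve_chart_var N i = (case i of VY \<Rightarrow> [:0, 1:] | VV \<Rightarrow> [:[:0, 1:]:] ^ N | VW \<Rightarrow> [:[:0, 1:]:] | _ \<Rightarrow> 0)"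

definition curve_chart :: "nat \<Rightarrow> 'k::field poly6 \<Rightarrow> 'k poly poly" where
  "curve_chart N = eval_poly (\<lambda>c. [:[:c:]:]) (curve_chart_var N)"

lemma comm_ring_hom_const_poly_poly: "comm_ring_hom (\<lambda>c :: 'k::field. [:[:c:]:])"
  by standard (simp_all add: mult.commute flip: one_pCons)

interpretation curve_chart: comm_ring_hom "curve_chart N :: 'k::field poly6 \<Rightarrow> 'k poly poly" for N
  unfolding curve_chart_def
  by (rule comm_ring_hom.comm_ring_hom_eval_poly[OF comm_ring_hom_const_poly_poly])

lemma curve_chart_pvar: "curve_chart N (pvar i) = curve_chart_var N i"
  unfolding curve_chart_def by (rule eval_poly_var[OF comm_ring_hom_const_poly_poly])

lemma curve_chart_at_origin:
  assumes "N \<ge> 1"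
  shows "poly (poly (curve_chart N f) 0) 0 = constant_term f"
proof -
  have hom: "comm_ring_hom (\<lambda>g :: 'a poly poly. poly (poly g 0) 0)"
    by standard simp_all
  have zero: "poly (poly (curve_chart_var N i) 0) 0 = (0 :: 'a)" for i
    using assms by (cases i) (simp_all add: curve_chart_var_def)
  have "poly (poly (curve_chart N f) 0) 0 = eval_poly (\<lambda>c. c) (\<lambda>_. 0) f"
    unfolding curve_chart_def eval_poly_comp[OF hom] by (simp add: zero)
  thus ?thesis
    by (simp only: constant_term_def)
qed

text \<open>
  The ideal generated by the minors, by \<open>x, z, u\<close> and by \<open>v - w^N\<close>: the images of the minors under the
  quotient map are \<open>0\<close>, \<open>w^(5N) y\<^sup>2\<close> and \<open>y^3\<close>.
\<close>

definition obstruction_ideal :: "nat \<Rightarrow> 'k::field poly6 set" where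
  "obstruction_ideal N = {f. \<exists>A B. curve_chart N f = A * ([:[:0, 1:]:] ^ (5 * N) * [:0, 1:] ^ 2) + B * [:0, 1:] ^ 3}"

lemma obstruction_idealI:
  "curve_chart N f = A * ([:[:0, 1:]:] ^ (5 * N) * [:0, 1:] ^ 2) + B * [:0, 1:] ^ 3 \<Longrightarrow> f \<in> obstruction_ideal N"
  unfolding obstruction_ideal_def by blast

lemma obstruction_idealE:
  assumes "f \<in> obstruction_ideal N"
  obtains A B where "curve_chart N f = A * ([:[:0, 1:]:] ^ (5 * N) * [:0, 1:] ^ 2) + B * [:0, 1:] ^ 3"
  using assms unfolding obstruction_ideal_def by blast

lemma obstruction_ideal_add:
  assumes "f \<in> obstruction_ideal N" "g \<in> obstruction_ideal N"
  shows "f + g \<in> obstruction_ideal N"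
proof -
  obtain A B where f: "curve_chart N f = A * ([:[:0, 1:]:] ^ (5 * N) * [:0, 1:] ^ 2) + B * [:0, 1:] ^ 3"
    using assms(1) by (rule obstruction_idealE)
  obtain A' B' where g: "curve_chart N g = A' * ([:[:0, 1:]:] ^ (5 * N) * [:0, 1:] ^ 2) + B' * [:0, 1:] ^ 3"
    using assms(2) by (rule obstruction_idealE)
  show ?thesis
    by (rule obstruction_idealI[of _ _ "A + A'" "B + B'"]) (simp only: curve_chart.hom_add f g distrib_right add_ac)
qed

lemma obstruction_ideal_mult:
  assumes "f \<in> obstruction_ideal N"
  shows "h * f \<in> obstruction_ideal N"
proof -
  obtain A B where f: "curve_chart N f = A * ([:[:0, 1:]:] ^ (5 * N) * [:0, 1:] ^ 2) + B * [:0, 1:] ^ 3"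
    using assms by (rule obstruction_idealE)
  show ?thesis
    by (rule obstruction_idealI[of _ _ "curve_chart N h * A" "curve_chart N h * B"])
       (simp only: curve_chart.hom_mult f distrib_left mult.assoc)
qed

lemma obstruction_ideal_members:
  shows "0 \<in> obstruction_ideal N" "minor_12 \<in> obstruction_ideal N" "minor_13 \<in> obstruction_ideal N"
    "minor_23 \<in> obstruction_ideal N" "pvar VX \<in> obstruction_ideal N" "pvar VU \<in> obstruction_ideal N"
    "pvar VV - pvar VW ^ N \<in> obstruction_ideal N"
proof -
  note homs = curve_chart.hom_zero curve_chart.hom_add curve_chart.hom_minus curve_chart.hom_mult
    curve_chart.hom_power curve_chart_pvar curve_chart_var_def var.case
  note I = obstruction_idealI[where A = 0 and B = 0]
  show "0 \<in> obstruction_ideal N"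
    by (rule I) (simp add: homs)
  show "pvar VX \<in> obstruction_ideal N"
    by (rule I) (simp add: homs)
  show "pvar VU \<in> obstruction_ideal N"
    by (rule I) (simp add: homs)
  show "pvar VV - pvar VW ^ N \<in> obstruction_ideal N"
    by (rule I) (simp add: homs)
  show "minor_12 \<in> obstruction_ideal N"
    by (rule I) (simp add: minor_12_def homs)
  show "minor_13 \<in> obstruction_ideal N"
    by (rule obstruction_idealI[where A = 1 and B = 0])
       (simp only: minor_13_def homs mult_zero_left mult_zero_right diff_0_right add_0_right mult_1_left
          zero_power2 add_0_left mult.commute[of N 5] flip: power_mult)
  show "minor_23 \<in> obstruction_ideal N"
    by (rule obstruction_idealI[where A = 0 and B = 1])
       (simp only: minor_23_def homs mult_zero_left mult_zero_right diff_0_right add_0_right mult_1_left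
          zero_power2 add_0_left power2_eq_square power3_eq_cube mult.assoc)
qed

text \<open>
  Compare the coefficients of \<open>y\<^sup>2\<close>: membership would give \<open>w^(4N) t(0, w) \<in> (w^(5N))\<close>, hence
  \<open>t(0, 0) = 0\<close>. The factor \<open>t\<close> stands for the denominators of the local ring.
\<close>

lemma not_in_obstruction_ideal:
  assumes N: "N \<ge> 1" and t: "constant_term t \<noteq> (0 :: 'k::field)"
  shows "t * (pvar VY ^ 2 * pvar VV ^ 4) \<notin> obstruction_ideal N"
proof
  assume "t * (pvar VY ^ 2 * pvar VV ^ 4) \<in> obstruction_ideal N"
  then obtain A B where "curve_chart N (t * (pvar VY ^ 2 * pvar VV ^ 4))
      = A * ([:[:0, 1:]:] ^ (5 * N) * [:0, 1:] ^ 2) + B * [:0, 1:] ^ 3"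
    by (rule obstruction_idealE)
  hence "curve_chart N t * ([:0, 1:] ^ 2 * ([:[:0, 1:]:] ^ N) ^ 4)
      = A * ([:[:0, 1:]:] ^ (5 * N) * [:0, 1:] ^ 2) + B * [:0, 1:] ^ 3"
    by (simp only: curve_chart.hom_mult curve_chart.hom_power curve_chart_pvar curve_chart_var_def var.case)
  hence "[:0, 1:] ^ 2 * ([:[:0, 1:]:] ^ (4 * N) * (curve_chart N t - [:[:0, 1:]:] ^ N * A) - [:0, 1:] * B) = 0"
    by (simp add: algebra_simps eval_nat_numeral power_add power_mult)
  hence "[:[:0, 1:]:] ^ (4 * N) * (curve_chart N t - [:[:0, 1:]:] ^ N * A) = [:0, 1:] * B"
    by simp
  hence "poly ([:[:0, 1:]:] ^ (4 * N) * (curve_chart N t - [:[:0, 1:]:] ^ N * A)) 0 = poly ([:0, 1:] * B) 0"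
    by simp
  hence "poly (curve_chart N t) 0 = [:0, 1:] ^ N * poly A 0"
    by simp
  hence "poly (poly (curve_chart N t) 0) 0 = poly ([:0, 1:] ^ N * poly A 0) 0"
    by simp
  also have "\<dots> = 0"
    using N by simp
  finally show False
    using t by (simp add: curve_chart_at_origin[OF N])
qed

lemma deformed_quotient_not_F_pure:
  fixes I :: "'k::field poly6 fract set" and N :: nat
  defines "I \<equiv> minors_ideal" and "R \<equiv> (origin_ring :: 'k poly6 fract ring) Quot minors_ideal"
  assumes N: "N \<ge> 1"
  shows "\<not> F_pure 3 (R Quot PIdl\<^bsub>R\<^esub> (I +>\<^bsub>origin_ring\<^esub> Fract (pvar VV - pvar VW ^ N) 1))"
proof
  let ?S = "origin_ring :: 'k poly6 fract ring"
  define d :: "'k poly6 fract" where "d = Fract (pvar VV - pvar VW ^ N) 1"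
  define Q where "Q = R Quot PIdl\<^bsub>R\<^esub> (I +>\<^bsub>?S\<^esub> d)"
  have Q_eq: "Q = ?S Quot minors_ideal Quot PIdl\<^bsub>?S Quot minors_ideal\<^esub> (minors_ideal +>\<^bsub>?S\<^esub> d)"
    by (simp add: Q_def R_def I_def)
  assume "F_pure 3 (R Quot PIdl\<^bsub>R\<^esub> (I +>\<^bsub>?S\<^esub> Fract (pvar VV - pvar VW ^ N) 1))"
  hence pure: "F_pure 3 Q"
    by (simp add: Q_def d_def)
  interpret S: cring ?S by (rule cring_origin_ring)
  have d: "d \<in> carrier ?S"
    by (simp add: d_def Fract_1_in_local_fractions)
  obtain p where cring: "cring Q" and hom: "p \<in> Ring.ring_hom ?S Q" and surj: "p ` carrier ?S = carrier Q"
    and kernel: "\<And>s. s \<in> carrier ?S \<Longrightarrow> p s = \<zero>\<^bsub>Q\<^esub> \<longleftrightarrow> (\<exists>r\<in>carrier ?S. s \<ominus>\<^bsub>?S\<^esub> r \<otimes>\<^bsub>?S\<^esub> d \<in> minors_ideal)"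
    by (rule principal_quotient_projection[OF cring_origin_ring ideal_minors_ideal d, folded Q_eq]) (rule that)
  interpret Q: cring Q by (rule cring)
  interpret p: ring_hom_cring ?S Q p
    by (intro ring_hom_cring.intro ring_hom_cring_axioms.intro cring cring_origin_ring hom)
  have p_mult: "p (a * b) = p a \<otimes>\<^bsub>Q\<^esub> p b" and p_add: "p (a + b) = p a \<oplus>\<^bsub>Q\<^esub> p b"
    if "a \<in> local_fractions" "b \<in> local_fractions" for a b
    using p.hom_mult[of a b] p.hom_add[of a b] that by simp_all
  have p_pow: "p (a ^ n) = p a [^]\<^bsub>Q\<^esub> n" if "a \<in> local_fractions" for a and n :: nat
    using ring_hom_power[OF hom cring_origin_ring cring, of a n] that by (simp add: type_subring_nat_pow)
  have closed: "a * b \<in> local_fractions" "a + b \<in> local_fractions" "a - b \<in> local_fractions"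
    if "a \<in> local_fractions" "b \<in> local_fractions" for a b :: "'k poly6 fract"
    using S.m_closed[of a b] S.a_closed[of a b] S.minus_closed[of a b] that
    by (simp_all add: origin_ring_minus)
  have closed_pow: "a ^ n \<in> local_fractions" if "a \<in> local_fractions" for a :: "'k poly6 fract" and n :: nat
    using S.nat_pow_closed[of a n] that by (simp add: type_subring_nat_pow)
  have p_combination: "p (a * b + (a' * b' + r)) = (p a \<otimes>\<^bsub>Q\<^esub> p b) \<oplus>\<^bsub>Q\<^esub> (p a' \<otimes>\<^bsub>Q\<^esub> p b' \<oplus>\<^bsub>Q\<^esub> p r)"
    if "a \<in> local_fractions" "b \<in> local_fractions" "a' \<in> local_fractions" "b' \<in> local_fractions" "r \<in> local_fractions"
    for a b a' b' r
    using p_add[OF closed(1)[OF that(1,2)] closed(2)[OF closed(1)[OF that(3,4)] that(5)]]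
      p_add[OF closed(1)[OF that(3,4)] that(5)] p_mult[OF that(1,2)] p_mult[OF that(3,4)] by simp
  let ?f = "\<lambda>g. Fract g 1 :: 'k poly6 fract"
  note mem = Fract_1_in_local_fractions
  have frac_mult: "?f (g * h) = ?f g * ?f h" and frac_add: "?f (g + h) = ?f g + ?f h" for g h :: "'k poly6"
    by simp_all
  have frac_pow: "?f (g ^ n) = ?f g ^ n" for g :: "'k poly6" and n :: nat
  proof (induction n)
    case (Suc n)
    thus ?case by (simp only: power_Suc frac_mult)
  qed (simp add: One_fract_def)
  obtain h k c1 c2 c3 where identity: "(pvar VY ^ 2 * pvar VV ^ 4) ^ 3
      = pvar VX ^ 3 * h + pvar VU ^ 3 * k + (c1 * minor_12 + c2 * minor_13 + c3 * minor_23 :: 'k poly6)"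
    using frobenius_power_identity[of "pvar VY :: 'k poly6" "pvar VV" "pvar VX" "pvar VU" "pvar VZ"]
    unfolding minor_12_def minor_13_def minor_23_def by blast
  define m where "m = c1 * minor_12 + c2 * minor_13 + c3 * minor_23"
  have "?f m \<in> minors_ideal"
    unfolding m_def by (rule minors_ideal_combination) (simp add: constant_term.hom_one)
  hence m_zero: "p (?f m) = \<zero>\<^bsub>Q\<^esub>"
    using kernel[of "?f m"] mem[of m] by (auto intro!: bexI[of _ 0] S.zero_closed[simplified] simp: origin_ring_minus S.zero_closed[simplified])
  have carr: "p (?f g) \<in> carrier Q" for g
    using p.hom_closed[of "?f g"] mem[of g] by simp
  let ?y = "pvar VY ^ 2 * pvar VV ^ 4 :: 'k poly6"
  have "p (?f ?y) [^]\<^bsub>Q\<^esub> (3 :: nat) = p (?f (pvar VX ^ 3 * h + pvar VU ^ 3 * k + m))"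
    using p_pow[OF mem, of ?y 3] by (simp only: identity m_def flip: frac_pow)
  also have "\<dots> = p (?f (pvar VX)) [^]\<^bsub>Q\<^esub> (3 :: nat) \<otimes>\<^bsub>Q\<^esub> p (?f h) \<oplus>\<^bsub>Q\<^esub> p (?f (pvar VU)) [^]\<^bsub>Q\<^esub> (3 :: nat) \<otimes>\<^bsub>Q\<^esub> p (?f k)"
    using p_combination[OF closed_pow[OF mem] mem closed_pow[OF mem] mem mem, of "pvar VX" 3 h "pvar VU" 3 k m]
      p_pow[OF mem, of "pvar VX" 3] p_pow[OF mem, of "pvar VU" 3] carr m_zero
    unfolding frac_add frac_mult frac_pow by (simp only: add.assoc) simp
  finally have power: "p (?f ?y) [^]\<^bsub>Q\<^esub> (3 :: nat) = p (?f (pvar VX)) [^]\<^bsub>Q\<^esub> (3 :: nat) \<otimes>\<^bsub>Q\<^esub> p (?f h) \<oplus>\<^bsub>Q\<^esub> p (?f (pvar VU)) [^]\<^bsub>Q\<^esub> (3 :: nat) \<otimes>\<^bsub>Q\<^esub> p (?f k)" .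
  obtain h' k' where h'k': "h' \<in> carrier Q" "k' \<in> carrier Q"
    "p (?f ?y) = p (?f (pvar VX)) \<otimes>\<^bsub>Q\<^esub> h' \<oplus>\<^bsub>Q\<^esub> p (?f (pvar VU)) \<otimes>\<^bsub>Q\<^esub> k'"
    by (rule F_pure_ideal_frobenius_closed[OF cring pure carr carr carr carr carr power])
  obtain hs ks where hs: "hs \<in> local_fractions" "h' = p hs" and ks: "ks \<in> local_fractions" "k' = p ks"
    using h'k'(1,2) surj by (auto simp flip: surj)
  define s where "s = ?f ?y - (?f (pvar VX) * hs + ?f (pvar VU) * ks)"
  have s: "s \<in> local_fractions"
    unfolding s_def by (intro closed mem hs ks)
  have carr_s: "p s \<in> carrier Q"
    using p.hom_closed[of s] s by simp
  have "p (?f (pvar VX) * hs + (?f (pvar VU) * ks + s)) = p (?f ?y) \<oplus>\<^bsub>Q\<^esub> p s"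
    using p_combination[OF mem hs(1) mem ks(1) s, of "pvar VX" "pvar VU"] h'k' hs(2) ks(2) carr carr_s
    by (simp add: Q.a_assoc)
  hence "p (?f ?y) = p s \<oplus>\<^bsub>Q\<^esub> p (?f ?y)"
    using carr[of ?y] carr_s by (simp add: s_def Q.a_comm)
  hence "p s = \<zero>\<^bsub>Q\<^esub>"
    using Q.add.r_cancel_one'[OF carr[of ?y], of "p s"] p.hom_closed[of s] s by simp
  then obtain r where r: "r \<in> local_fractions" "s - r * d \<in> minors_ideal"
    using kernel[of s] s d closed by (auto simp: origin_ring_minus)
  let ?J = "obstruction_ideal N :: 'k poly6 set"
  interpret E: ideal "extension_to_origin ?J" ?S
    by (rule ideal_extension_to_origin[OF obstruction_ideal_members(1) obstruction_ideal_add obstruction_ideal_mult])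
  have "minors_ideal \<subseteq> extension_to_origin ?J"
    by (rule minors_ideal_subset_extension[OF obstruction_ideal_members(1) obstruction_ideal_add
          obstruction_ideal_mult obstruction_ideal_members(2-4)])
  hence 1: "s - r * d \<in> extension_to_origin ?J"
    using r(2) by blast
  have gen: "?f g \<in> extension_to_origin ?J" if "g \<in> ?J" for g
    by (rule extension_to_originI[OF that]) (simp add: constant_term.hom_one)
  have 2: "r * d \<in> extension_to_origin ?J"
    using E.I_l_closed[OF gen[OF obstruction_ideal_members(7)], of r] r(1) by (simp add: d_def)
  have 3: "?f (pvar VX) * hs \<in> extension_to_origin ?J" "?f (pvar VU) * ks \<in> extension_to_origin ?J"
    using E.I_r_closed[OF gen[OF obstruction_ideal_members(5)], of hs]
      E.I_r_closed[OF gen[OF obstruction_ideal_members(6)], of ks] hs(1) ks(1) by simp_all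
  have "(s - r * d) + r * d + (?f (pvar VX) * hs + ?f (pvar VU) * ks) \<in> extension_to_origin ?J"
    using E.a_closed[OF E.a_closed[OF 1 2] E.a_closed[OF 3]] by simp
  hence "?f ?y \<in> extension_to_origin ?J"
    by (simp add: s_def)
  then obtain t where "constant_term t \<noteq> 0" "t * ?y \<in> ?J"
    by (rule extension_to_origin_contraction) (auto intro: obstruction_ideal_mult)
  thus False
    using not_in_obstruction_ideal[OF N] by blast
qed

section \<open>Strong F-regularity of the special fibre\<close>

text \<open>
  The homomorphism \<open>cover\<close> preserves constant terms, so that it extends to the local ring at the origin.
\<close>

lemma obtain_fraction_cover:
  obtains \<Theta> :: "'k::field poly6 fract \<Rightarrow> 'k poly6 fract"
  where "\<And>a b. constant_term b \<noteq> 0 \<Longrightarrow> \<Theta> (Fract a b) = Fract (cover a) (cover b)"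
proof -
  have nz: "cover b \<noteq> 0" if "constant_term b \<noteq> 0" for b :: "'k poly6"
    using that constant_term_nonzero[of "cover b"] by (simp add: constant_term_cover)
  define \<Theta> :: "'k poly6 fract \<Rightarrow> 'k poly6 fract"
    where "\<Theta> r = (SOME t. \<exists>a b. constant_term b \<noteq> 0 \<and> r = Fract a b \<and> t = Fract (cover a) (cover b))" for r
  have "\<Theta> (Fract a b) = Fract (cover a) (cover b)" if b: "constant_term b \<noteq> 0" for a b
    unfolding \<Theta>_def
  proof (rule some_equality)
    fix t assume "\<exists>a' b'. constant_term b' \<noteq> 0 \<and> Fract a b = Fract a' b' \<and> t = Fract (cover a') (cover b')"
    then obtain a' b' where *: "constant_term b' \<noteq> 0" "Fract a b = Fract a' b'" "t = Fract (cover a') (cover b')"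
      by blast
    hence "a * b' = a' * b"
      using b constant_term_nonzero by (simp add: eq_fract constant_term_nonzero)
    hence "cover a * cover b' = cover a' * cover b"
      by (simp flip: cover.hom_mult)
    thus "t = Fract (cover a) (cover b)"
      using nz[OF b] nz[OF *(1)] by (simp add: *(3) eq_fract)
  qed (use b in blast)
  thus thesis by (rule that)
qed

text \<open>
  The homomorphism \<open>cover\<close> identifies \<open>R / (v)\<close> with the ring of fractions of its range whose denominators are
  the images of polynomials with nonzero constant term. A splitting on the range that is \<open>1\<close> at the
  numerator of \<open>c\<close> extends to these fractions; precomposing it with the multiplication by the denominator
  of \<open>c\<close> makes it \<open>1\<close> at \<open>c\<close>.
\<close>

lemma special_fibre_strongly_F_regular:
  fixes I :: "'k::field poly6 fract set"
  defines "I \<equiv> minors_ideal" and "R \<equiv> (origin_ring :: 'k poly6 fract ring) Quot minors_ideal"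
  assumes char: "CHAR('k) = 3"
  shows "strongly_F_regular 3 (R Quot PIdl\<^bsub>R\<^esub> (I +>\<^bsub>origin_ring\<^esub> Fract (pvar VV) 1))"
proof -
  let ?S = "origin_ring :: 'k poly6 fract ring"
  define d :: "'k poly6 fract" where "d = Fract (pvar VV) 1"
  define Q where "Q = R Quot PIdl\<^bsub>R\<^esub> (I +>\<^bsub>?S\<^esub> d)"
  have Q_eq: "Q = ?S Quot minors_ideal Quot PIdl\<^bsub>?S Quot minors_ideal\<^esub> (minors_ideal +>\<^bsub>?S\<^esub> d)"
    by (simp add: Q_def R_def I_def)
  interpret S: cring ?S by (rule cring_origin_ring)
  have d: "d \<in> carrier ?S"
    by (simp add: d_def Fract_1_in_local_fractions)
  obtain p where cring: "cring Q" and hom: "p \<in> Ring.ring_hom ?S Q" and surj: "p ` carrier ?S = carrier Q"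
    and kernel: "\<And>s. s \<in> carrier ?S \<Longrightarrow> p s = \<zero>\<^bsub>Q\<^esub> \<longleftrightarrow> (\<exists>r\<in>carrier ?S. s \<ominus>\<^bsub>?S\<^esub> r \<otimes>\<^bsub>?S\<^esub> d \<in> minors_ideal)"
    by (rule principal_quotient_projection[OF cring_origin_ring ideal_minors_ideal d, folded Q_eq]) (rule that)
  interpret Q: cring Q by (rule cring)
  interpret p: ring_hom_cring ?S Q p
    by (intro ring_hom_cring.intro ring_hom_cring_axioms.intro cring cring_origin_ring hom)
  obtain \<Theta> :: "'k poly6 fract \<Rightarrow> 'k poly6 fract"
    where \<Theta>: "\<And>a b. constant_term b \<noteq> 0 \<Longrightarrow> \<Theta> (Fract a b) = Fract (cover a) (cover b)"
    by (rule obtain_fraction_cover) (rule that)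
  have cover_nz: "cover b \<noteq> 0" if "constant_term b \<noteq> 0" for b :: "'k poly6"
    using that constant_term_nonzero[of "cover b"] by (simp add: constant_term_cover)
  have \<Theta>_add: "\<Theta> (r + s) = \<Theta> r + \<Theta> s" and \<Theta>_mult: "\<Theta> (r * s) = \<Theta> r * \<Theta> s"
    if rs: "r \<in> local_fractions" "s \<in> local_fractions" for r s
  proof -
    obtain a b where r: "r = Fract a b" "constant_term b \<noteq> 0"
      using rs(1) by (rule local_fractionsE)
    obtain a' b' where s: "s = Fract a' b'" "constant_term b' \<noteq> 0"
      using rs(2) by (rule local_fractionsE)
    note bb' = constant_term_mult_nonzero[OF r(2) s(2)]
    show "\<Theta> (r + s) = \<Theta> r + \<Theta> s"
      using \<Theta>[OF bb', of "a * b' + a' * b"] \<Theta>[OF r(2)] \<Theta>[OF s(2)] cover_nz[OF r(2)] cover_nz[OF s(2)]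
        constant_term_nonzero[OF r(2)] constant_term_nonzero[OF s(2)]
      by (simp add: r(1) s(1) cover.hom_add cover.hom_mult)
    show "\<Theta> (r * s) = \<Theta> r * \<Theta> s"
      using \<Theta>[OF bb', of "a * a'"] \<Theta>[OF r(2)] \<Theta>[OF s(2)]
      by (simp add: r(1) s(1) cover.hom_mult)
  qed
  have \<Theta>_one: "\<Theta> 1 = 1"
    using \<Theta>[of 1 1] by (simp add: One_fract_def constant_term.hom_one cover.hom_one)
  have \<Theta>_zero_iff: "\<Theta> (Fract a b) = 0 \<longleftrightarrow> a \<in> fibre_ideal" if "constant_term b \<noteq> 0" for a b
    using cover_nz[OF that] by (simp add: \<Theta>[OF that] Zero_fract_def eq_fract cover_eq_0_iff[OF char])
  have fibre_zero: "0 \<in> (fibre_ideal :: 'k poly6 set)"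
    by (rule fibre_idealI[of _ 0 0 0 0]) simp
  have kernel_\<Theta>: "p s = \<zero>\<^bsub>Q\<^esub> \<longleftrightarrow> \<Theta> s = 0" if s: "s \<in> local_fractions" for s
  proof
    assume "p s = \<zero>\<^bsub>Q\<^esub>"
    then obtain r where r: "r \<in> local_fractions" "s - r * d \<in> minors_ideal"
      using kernel[of s] s d S.m_closed[of _ d] by (auto simp: origin_ring_minus)
    interpret E: ideal "extension_to_origin fibre_ideal" ?S
      by (rule ideal_extension_to_origin[OF fibre_zero fibre_ideal_add fibre_ideal_mult])
    have "minors_ideal \<subseteq> extension_to_origin (fibre_ideal :: 'k poly6 set)"
    proof (rule minors_ideal_subset_extension[OF fibre_zero fibre_ideal_add fibre_ideal_mult])
      show "minor_12 \<in> (fibre_ideal :: 'k poly6 set)"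
        by (rule fibre_idealI[of _ 1 0 0 0]) simp
      show "minor_13 \<in> (fibre_ideal :: 'k poly6 set)"
        by (rule fibre_idealI[of _ 0 1 0 0]) simp
      show "minor_23 \<in> (fibre_ideal :: 'k poly6 set)"
        by (rule fibre_idealI[of _ 0 0 1 0]) simp
    qed
    hence 1: "s - r * d \<in> extension_to_origin fibre_ideal"
      using r(2) by blast
    have "pvar VV \<in> (fibre_ideal :: 'k poly6 set)"
      by (rule fibre_idealI[of _ 0 0 0 1]) simp
    hence "d \<in> extension_to_origin fibre_ideal"
      unfolding d_def by (rule extension_to_originI) (simp add: constant_term.hom_one)
    from E.a_closed[OF 1 E.I_l_closed[OF this, of r]] r(1)
    have "s \<in> extension_to_origin fibre_ideal" by simp
    then obtain a b where "s = Fract a b" "a \<in> fibre_ideal" "constant_term b \<noteq> 0"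
      by (rule extension_to_originE)
    thus "\<Theta> s = 0" using \<Theta>_zero_iff by simp
  next
    assume zero: "\<Theta> s = 0"
    obtain a b where ab: "s = Fract a b" "constant_term b \<noteq> 0"
      using s by (rule local_fractionsE)
    have "a \<in> fibre_ideal"
      using zero \<Theta>_zero_iff[OF ab(2)] ab(1) by simp
    then obtain c1 c2 c3 c4 where a: "a = c1 * minor_12 + c2 * minor_13 + c3 * minor_23 + c4 * pvar VV"
      by (rule fibre_idealE)
    have "s - Fract c4 b * d = Fract (c1 * minor_12 + c2 * minor_13 + c3 * minor_23) b"
      using constant_term_nonzero[OF ab(2)] by (simp add: ab(1) a d_def eq_fract algebra_simps)
    hence "s - Fract c4 b * d \<in> minors_ideal"
      using minors_ideal_combination[OF ab(2)] by simp
    thus "p s = \<zero>\<^bsub>Q\<^esub>"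
      using kernel[of s] s d S.m_closed[of "Fract c4 b" d] local_fractionsI[OF ab(2), of c4]
      by (auto simp: origin_ring_minus intro!: bexI[of _ "Fract c4 b"])
  qed
  have p_eq_iff: "p s = p t \<longleftrightarrow> \<Theta> s = \<Theta> t" if st: "s \<in> local_fractions" "t \<in> local_fractions" for s t
  proof -
    define r where "r = s - t"
    have r: "r \<in> local_fractions" and s: "s = r + t"
      using S.minus_closed[of s t] st by (simp_all add: r_def origin_ring_minus)
    have carr: "p r \<in> carrier Q" "p t \<in> carrier Q"
      using p.hom_closed r st by simp_all
    have "p s = p r \<oplus>\<^bsub>Q\<^esub> p t"
      using p.hom_add[of r t] r st by (simp add: s)
    hence "p s = p t \<longleftrightarrow> p r = \<zero>\<^bsub>Q\<^esub>"
      using carr by simp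
    also have "\<dots> \<longleftrightarrow> \<Theta> r = 0"
      by (rule kernel_\<Theta>[OF r])
    also have "\<dots> \<longleftrightarrow> \<Theta> s = \<Theta> t"
      using \<Theta>_add[OF r st(2)] by (simp add: s)
    finally show ?thesis .
  qed
  define g where "g q = \<Theta> (SOME s. s \<in> local_fractions \<and> p s = q)" for q
  have g_p: "g (p s) = \<Theta> s" if "s \<in> local_fractions" for s
  proof -
    have "\<exists>t. t \<in> local_fractions \<and> p t = p s"
      using that by blast
    from someI_ex[OF this] show ?thesis
      unfolding g_def using p_eq_iff[OF _ that] by blast
  qed
  have carrier_Q: "carrier Q = p ` local_fractions"
    using surj by simp
  have image_g: "g ` carrier Q = {Fract a b | a b. a \<in> range cover \<and> b \<in> cover ` {b. constant_term b \<noteq> 0}}"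
    (is "_ = ?C")
  proof -
    have "g ` carrier Q = \<Theta> ` local_fractions"
      unfolding carrier_Q image_image by (rule image_cong) (simp_all add: g_p)
    also have "\<dots> = ?C"
    proof
      show "\<Theta> ` local_fractions \<subseteq> ?C"
      proof
        fix r assume "r \<in> \<Theta> ` local_fractions"
        then obtain a b where "r = \<Theta> (Fract a b)" "constant_term b \<noteq> 0"
          by (auto elim: local_fractionsE)
        hence "r = Fract (cover a) (cover b)" "cover b \<in> cover ` {b. constant_term b \<noteq> 0}"
          by (simp_all add: \<Theta>)
        thus "r \<in> ?C" by blast
      qed
      show "?C \<subseteq> \<Theta> ` local_fractions"
        by (auto simp flip: \<Theta> intro: local_fractionsI)
    qed
    finally show ?thesis .
  qed
  have "strongly_F_regular 3 Q"
  proof (rule strongly_F_regular_if_embedded[OF cring, of g])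
    show "inj_on g (carrier Q)"
      unfolding carrier_Q by (auto simp: inj_on_def g_p p_eq_iff)
    show "g (a \<otimes>\<^bsub>Q\<^esub> b) = g a * g b" if ab: "a \<in> carrier Q" "b \<in> carrier Q" for a b
    proof -
      obtain s t where st: "s \<in> local_fractions" "t \<in> local_fractions" "a = p s" "b = p t"
        using ab unfolding carrier_Q by blast
      thus ?thesis
        using p.hom_mult[of s t] S.m_closed[of s t] g_p[of "s * t"] by (simp add: g_p \<Theta>_mult)
    qed
    show "g (a \<oplus>\<^bsub>Q\<^esub> b) = g a + g b" if ab: "a \<in> carrier Q" "b \<in> carrier Q" for a b
    proof -
      obtain s t where st: "s \<in> local_fractions" "t \<in> local_fractions" "a = p s" "b = p t"
        using ab unfolding carrier_Q by blast
      thus ?thesis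
        using p.hom_add[of s t] S.a_closed[of s t] g_p[of "s + t"] by (simp add: g_p \<Theta>_add)
    qed
    show "g \<one>\<^bsub>Q\<^esub> = 1"
      using g_p[of 1] p.hom_one S.one_closed \<Theta>_one by simp
  next
    fix c assume "c \<in> g ` carrier Q" "c \<noteq> 0"
    then obtain f0 t0 where c: "c = Fract (cover f0) (cover t0)" and t0: "constant_term t0 \<noteq> 0"
      unfolding image_g by auto
    have "cover f0 \<noteq> 0"
      using \<open>c \<noteq> 0\<close> unfolding c by (metis fract_collapse(1))
    then obtain e \<psi> where e: "e \<ge> 1" and \<psi>: "\<And>g h. \<psi> (g + h) = \<psi> g + \<psi> h" "\<And>g. \<psi> g \<in> range cover"
      "\<And>r s. r \<in> range cover \<Longrightarrow> \<psi> (r ^ (3 ^ e) * s) = r * \<psi> s" "\<psi> (cover f0) = 1"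
      by (rule cover_range_frobenius_splitting[OF char]) (rule that)
    let ?A = "range (cover :: 'k poly6 \<Rightarrow> _)" and ?D = "cover ` {b :: 'k poly6. constant_term b \<noteq> 0}"
    have D: "?D \<subseteq> ?A" "0 \<notin> ?D" "\<And>a b. a \<in> ?D \<Longrightarrow> b \<in> ?D \<Longrightarrow> a * b \<in> ?D"
    proof -
      show "?D \<subseteq> ?A" by blast
      show "0 \<notin> ?D"
      proof
        assume "0 \<in> ?D"
        then obtain b :: "'k poly6" where "0 = cover b" "constant_term b \<noteq> 0" by blast
        thus False using cover_nz[of b] by simp
      qed
      show "a * b \<in> ?D" if ab: "a \<in> ?D" "b \<in> ?D" for a b
      proof -
        obtain a' b' where "a = cover a'" "b = cover b'" "constant_term a' \<noteq> 0" "constant_term b' \<noteq> 0"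
          using ab by blast
        hence "a * b = cover (a' * b')" "constant_term (a' * b') \<noteq> 0"
          by (simp_all add: cover.hom_mult constant_term.hom_mult)
        thus ?thesis by blast
      qed
    qed
    have q: "(3 :: nat) ^ e > 0" by simp
    obtain \<Phi> where \<Phi>: "\<And>a b. a \<in> ?A \<Longrightarrow> b \<in> ?D \<Longrightarrow> \<Phi> (Fract a b) = Fract (\<psi> (a * b ^ (3 ^ e - 1))) b"
      and \<Phi>_add: "\<And>a b a' b'. a \<in> ?A \<Longrightarrow> b \<in> ?D \<Longrightarrow> a' \<in> ?A \<Longrightarrow> b' \<in> ?D \<Longrightarrow>
        \<Phi> (Fract a b + Fract a' b') = \<Phi> (Fract a b) + \<Phi> (Fract a' b')"
      and \<Phi>_linear: "\<And>a b a' b'. a \<in> ?A \<Longrightarrow> b \<in> ?D \<Longrightarrow> a' \<in> ?A \<Longrightarrow> b' \<in> ?D \<Longrightarrow>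
        \<Phi> (Fract a b ^ (3 ^ e) * Fract a' b') = Fract a b * \<Phi> (Fract a' b')"
      by (rule frobenius_map_extends_to_fractions[of ?A ?D "3 ^ e" \<psi>, OF _ _ D(1,2) _ q \<psi>(1)])
         ((erule (1) range_cover_mult range_cover_add D(3) | erule \<psi>(3) | (rule that, assumption+))+)
    \<comment> \<open>Multiplication by the denominator of \<open>c\<close> comes first, so that \<open>c\<close> itself is sent to \<open>1\<close>.\<close>
    define T where "T = Fract (cover t0) 1"
    have one_D: "1 \<in> ?D"
      using cover.hom_one constant_term.hom_one by (metis (mono_tags, lifting) imageI mem_Collect_eq zero_neq_one)
    have scale: "T * Fract a b = Fract (cover t0 * a) b" for a b
      by (simp add: T_def)
    have in_A: "cover t0 * a \<in> ?A" if "a \<in> ?A" for a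
      using that by (intro range_cover_mult) auto
    show "\<exists>e\<ge>1. \<exists>\<Phi>. (\<forall>a\<in>g ` carrier Q. \<forall>b\<in>g ` carrier Q. \<Phi> (a + b) = \<Phi> a + \<Phi> b) \<and>
        (\<forall>a\<in>g ` carrier Q. \<Phi> a \<in> g ` carrier Q) \<and>
        (\<forall>a\<in>g ` carrier Q. \<forall>b\<in>g ` carrier Q. \<Phi> (a ^ (3 ^ e) * b) = a * \<Phi> b) \<and> \<Phi> c = 1"
    proof (intro exI[of _ e] exI[of _ "\<lambda>r. \<Phi> (T * r)"] conjI ballI e)
      fix a assume "a \<in> g ` carrier Q"
      then obtain f h where a: "a = Fract f h" "f \<in> ?A" "h \<in> ?D"
        unfolding image_g by blast
      show "\<Phi> (T * a) \<in> g ` carrier Q"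
        unfolding image_g a(1) scale \<Phi>[OF in_A[OF a(2)] a(3)] using \<psi>(2) a(3) by blast
      fix b assume "b \<in> g ` carrier Q"
      then obtain f' h' where b: "b = Fract f' h'" "f' \<in> ?A" "h' \<in> ?D"
        unfolding image_g by blast
      show "\<Phi> (T * (a + b)) = \<Phi> (T * a) + \<Phi> (T * b)"
        using \<Phi>_add[OF in_A[OF a(2)] a(3) in_A[OF b(2)] b(3)]
        unfolding distrib_left unfolding a(1) b(1) scale .
      show "\<Phi> (T * (a ^ (3 ^ e) * b)) = a * \<Phi> (T * b)"
        using \<Phi>_linear[OF a(2,3) in_A[OF b(2)] b(3)]
        unfolding mult.left_commute[of T] unfolding a(1) b(1) scale .
    next
      have "T * c = Fract (cover f0) 1"
        using cover_nz[OF t0] by (simp add: T_def c eq_fract mult.commute)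
      thus "\<Phi> (T * c) = 1"
        using \<Phi>[of "cover f0" 1] one_D \<psi>(4) by (simp add: One_fract_def)
    qed
  qed
  thus ?thesis
    by (simp add: Q_def d_def)
qed

section \<open>Instability under perturbation of the parameter\<close>

definition origin_maxideal :: "'k::field poly6 fract set set" where
  "origin_maxideal = (+>\<^bsub>origin_ring\<^esub>) minors_ideal ` extension_to_origin {f. constant_term f = 0}"

lemma constant_term_minors:
  "constant_term minor_12 = 0" "constant_term minor_13 = 0" "constant_term minor_23 = 0"
  by (simp_all add: minor_12_def minor_13_def minor_23_def constant_term.hom_add constant_term.hom_minus
      constant_term.hom_mult constant_term.hom_power constant_term_pvar)

text \<open>
  A fraction whose numerator has nonzero constant term is invertible; hence the ring is local.
\<close>

lemma the_maxideal_quotient: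
  "ideal origin_maxideal ((origin_ring :: 'k::field poly6 fract ring) Quot minors_ideal)"
  "the_maxideal ((origin_ring :: 'k poly6 fract ring) Quot minors_ideal) = origin_maxideal"
proof -
  let ?S = "origin_ring :: 'k poly6 fract ring" and ?n = "{f :: 'k poly6. constant_term f = 0}"
  interpret S: cring ?S by (rule cring_origin_ring)
  interpret I: ideal minors_ideal ?S by (rule ideal_minors_ideal)
  interpret R: cring "?S Quot minors_ideal"
    by (rule I.quotient_is_cring) (rule S.is_cring)
  have n: "0 \<in> ?n" "\<And>f g. f \<in> ?n \<Longrightarrow> g \<in> ?n \<Longrightarrow> f + g \<in> ?n" "\<And>f h. f \<in> ?n \<Longrightarrow> h * f \<in> ?n"
    by (simp_all add: constant_term.hom_zero constant_term.hom_add constant_term.hom_mult)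
  have E: "ideal (extension_to_origin ?n) ?S"
    by (rule ideal_extension_to_origin[OF n])
  have proj: "(+>\<^bsub>?S\<^esub>) minors_ideal \<in> Ring.ring_hom ?S (?S Quot minors_ideal)"
    by (rule I.rcos_ring_hom)
  have carrier_R: "carrier (?S Quot minors_ideal) = (+>\<^bsub>?S\<^esub>) minors_ideal ` local_fractions"
    by (auto simp: FactRing_def A_RCOSETS_def')
  show ideal: "ideal origin_maxideal (?S Quot minors_ideal)"
    unfolding origin_maxideal_def by (rule S.ring_ideal_imp_quot_ideal[OF ideal_minors_ideal E])
  have sub: "minors_ideal \<subseteq> extension_to_origin ?n"
    by (rule minors_ideal_subset_extension[OF n]) (simp_all add: constant_term_minors)
  show "the_maxideal (?S Quot minors_ideal) = origin_maxideal"
  proof (rule unique_maximalideal_if_local[OF R.is_cring ideal])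
    show "origin_maxideal \<noteq> carrier (?S Quot minors_ideal)"
    proof
      assume "origin_maxideal = carrier (?S Quot minors_ideal)"
      moreover have "(1 :: 'k poly6 fract) \<in> local_fractions"
        using S.one_closed by simp
      ultimately have "minors_ideal +>\<^bsub>?S\<^esub> 1 \<in> origin_maxideal"
        unfolding carrier_R by blast
      then obtain s where s: "s \<in> extension_to_origin ?n" "minors_ideal +>\<^bsub>?S\<^esub> 1 = minors_ideal +>\<^bsub>?S\<^esub> s"
        unfolding origin_maxideal_def by blast
      interpret E: ideal "extension_to_origin ?n" ?S by (rule E)
      have s_carr: "s \<in> local_fractions"
        using E.Icarr[OF s(1)] by simp
      have "1 - s \<in> minors_ideal"
        using S.quotient_eq_iff_same_a_r_cos[OF ideal_minors_ideal, of 1 s] s s_carr S.one_closed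
        by (simp add: origin_ring_minus)
      hence "1 - s + s \<in> extension_to_origin ?n"
        using E.a_closed[of "1 - s" s] s(1) sub by auto
      hence "Fract 1 1 \<in> extension_to_origin ?n"
        by (simp add: One_fract_def)
      then obtain t where "constant_term t \<noteq> 0" "t * 1 \<in> ?n"
        by (rule extension_to_origin_contraction) (auto simp: constant_term.hom_mult)
      thus False by simp
    qed
    fix a assume a: "a \<in> carrier (?S Quot minors_ideal)" "a \<notin> origin_maxideal"
    then obtain s where s: "s \<in> local_fractions" "a = minors_ideal +>\<^bsub>?S\<^esub> s"
      unfolding carrier_R by blast
    obtain f g where fg: "s = Fract f g" "constant_term g \<noteq> 0"
      using s(1) by (rule local_fractionsE)
    have f: "constant_term f \<noteq> 0"
      using a(2) s fg extension_to_originI[of f ?n g] unfolding origin_maxideal_def by blast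
    have inv: "Fract g f \<in> local_fractions"
      by (rule local_fractionsI[OF f])
    have "s * Fract g f = 1"
      using constant_term_nonzero[OF f] constant_term_nonzero[OF fg(2)]
      by (simp add: fg(1) One_fract_def eq_fract mult.commute)
    hence "a \<otimes>\<^bsub>?S Quot minors_ideal\<^esub> (minors_ideal +>\<^bsub>?S\<^esub> Fract g f) = \<one>\<^bsub>?S Quot minors_ideal\<^esub>"
      using ring_hom_mult[OF proj, of s "Fract g f"] ring_hom_one[OF proj] s inv by simp
    thus "a \<in> Units (?S Quot minors_ideal)"
      using a(1) inv R.m_comm[of a "minors_ideal +>\<^bsub>?S\<^esub> Fract g f"]
      unfolding Units_def carrier_R by auto
  qed
qed

theorem theorem5p3:
  fixes x y z u v w :: "'k::field poly6"
    and n :: "'k poly6 set"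
    and S :: "'k poly6 fract ring"
    and I :: "'k poly6 fract set"
    and R :: "'k poly6 fract set ring"
    and v' w' :: "'k poly6 fract set"
    and m :: "'k poly6 fract set set"
  assumes char: "CHAR('k) = 3"
    and F_finite: "F_finite_field TYPE('k)"
    and vars: "x = pvar VX" "y = pvar VY" "z = pvar VZ" "u = pvar VU" "v = pvar VV" "w = pvar VW"
    and n: "n = Idl\<^bsub>ring_of_type_algebra\<^esub> {x, y, z, u, v, w}"
    and S: "S = localization_at n"
    and I: "I = Idl\<^bsub>S\<^esub> ((\<lambda>f. Fract f 1) ` minors 2 (mat_of_rows_list 3
              [[x\<^sup>2 + v ^ 5, y, u],
               [z, x\<^sup>2, y\<^sup>2 - u]]))"
    and R: "R = S Quot I"
    and v': "v' = I +>\<^bsub>S\<^esub> Fract v 1"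
    and w': "w' = I +>\<^bsub>S\<^esub> Fract w 1"
    and m: "m = the_maxideal R"
  shows "strongly_F_regular 3 (R Quot PIdl\<^bsub>R\<^esub> v')
    \<and> (\<forall>N::nat. N \<ge> 1 \<longrightarrow> \<not> F_pure 3 (R Quot PIdl\<^bsub>R\<^esub> (v' \<ominus>\<^bsub>R\<^esub> w' [^]\<^bsub>R\<^esub> N)))
    \<and> \<not> (\<exists>N::nat. \<forall>\<delta> \<in> m [^]\<^bsub>ideals_set R\<^esub> N. F_pure 3 (R Quot PIdl\<^bsub>R\<^esub> (v' \<oplus>\<^bsub>R\<^esub> \<delta>)))
    \<and> \<not> (\<exists>N::nat. \<forall>\<delta> \<in> m [^]\<^bsub>ideals_set R\<^esub> N.
            strongly_F_regular 3 (R Quot PIdl\<^bsub>R\<^esub> (v' \<oplus>\<^bsub>R\<^esub> \<delta>)))"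
proof -
  have S_eq: "S = origin_ring"
    unfolding S n vars genideal_variables by (rule localization_at_origin)
  have I_eq: "I = minors_ideal"
    unfolding I S_eq minors_eq[OF vars(1-5)] minors_ideal_def ..
  interpret S: cring S
    unfolding S_eq by (rule cring_origin_ring)
  interpret I: ideal I S
    unfolding S_eq I_eq by (rule ideal_minors_ideal)
  interpret R: cring R
    unfolding R by (rule I.quotient_is_cring) (rule S.is_cring)
  interpret proj: ring_hom_cring S R "(+>\<^bsub>S\<^esub>) I"
    unfolding R by (intro ring_hom_cring.intro ring_hom_cring_axioms.intro S.is_cring I.rcos_ring_hom)
      (use R.is_cring R in simp)
  have carrier_S: "Fract f 1 \<in> carrier S" for f :: "'k poly6"
    by (simp add: S_eq Fract_1_in_local_fractions)
  have v'R: "v' \<in> carrier R" and w'R: "w' \<in> carrier R"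
    unfolding v' w' using proj.hom_closed carrier_S by blast+
  have frac_pow: "Fract w 1 [^]\<^bsub>S\<^esub> N = Fract (w ^ N) 1" for N :: nat
    by (induction N) (simp_all add: S_eq One_fract_def mult.commute)
  have difference: "v' \<ominus>\<^bsub>R\<^esub> w' [^]\<^bsub>R\<^esub> N = I +>\<^bsub>S\<^esub> Fract (v - w ^ N) 1" for N :: nat
  proof -
    have "Fract (v - w ^ N) 1 = Fract v 1 \<ominus>\<^bsub>S\<^esub> Fract (w ^ N) 1"
      using origin_ring_minus[of "Fract v 1" "Fract (w ^ N) 1"] by (simp add: S_eq Fract_1_in_local_fractions)
    hence "I +>\<^bsub>S\<^esub> Fract (v - w ^ N) 1 = v' \<ominus>\<^bsub>R\<^esub> (I +>\<^bsub>S\<^esub> Fract (w ^ N) 1)"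
      using carrier_S by (simp add: a_minus_def v')
    also have "I +>\<^bsub>S\<^esub> Fract (w ^ N) 1 = w' [^]\<^bsub>R\<^esub> N"
      using ring_hom_power[OF proj.homh S.is_cring R.is_cring carrier_S, of w N] by (simp add: w' frac_pow)
    finally show ?thesis by simp
  qed
  have not_pure: "\<not> F_pure 3 (R Quot PIdl\<^bsub>R\<^esub> (v' \<ominus>\<^bsub>R\<^esub> w' [^]\<^bsub>R\<^esub> N))" if "N \<ge> 1" for N :: nat
    using deformed_quotient_not_F_pure[OF that, where 'k = 'k]
    unfolding difference by (simp add: R S_eq I_eq vars)
  have not_regular: "\<not> strongly_F_regular 3 (R Quot PIdl\<^bsub>R\<^esub> (v' \<ominus>\<^bsub>R\<^esub> w' [^]\<^bsub>R\<^esub> N))" if N: "N \<ge> 1" for N :: nat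
  proof
    let ?Q = "R Quot PIdl\<^bsub>R\<^esub> (v' \<ominus>\<^bsub>R\<^esub> w' [^]\<^bsub>R\<^esub> N)"
    assume sfr: "strongly_F_regular 3 ?Q"
    have Q_eq: "?Q = S Quot I Quot PIdl\<^bsub>S Quot I\<^esub> (I +>\<^bsub>S\<^esub> Fract (v - w ^ N) 1)"
      unfolding difference by (simp only: R)
    obtain p where p: "cring ?Q" "p \<in> Ring.ring_hom S ?Q" "p ` carrier S = carrier ?Q"
      by (rule principal_quotient_projection[OF S.is_cring I.is_ideal carrier_S[of "v - w ^ N"], folded Q_eq])
         (rule that)
    have "F_pure 3 ?Q"
      by (rule strongly_F_regular_imp_F_pure[OF p(1) _ sfr])
         (rule frobenius_add_quotient[OF char _ p(1)], use p S_eq in auto)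
    thus False
      using not_pure[OF N] by blast
  qed
  have max: "m = origin_maxideal"
    unfolding m R S_eq I_eq by (rule the_maxideal_quotient(2))
  have m_ideal: "ideal m R"
    unfolding max R S_eq I_eq by (rule the_maxideal_quotient(1))
  have w'm: "w' \<in> m"
  proof -
    have "Fract w 1 \<in> extension_to_origin {f. constant_term f = 0}"
      by (rule extension_to_originI) (simp_all add: vars constant_term_pvar constant_term.hom_one)
    thus ?thesis
      unfolding max origin_maxideal_def w' S_eq I_eq by blast
  qed
  \<comment> \<open>For \<open>N = 0\<close> the power of the maximal ideal is the whole ring, and \<open>- w\<close> is used.\<close>
  have perturbation: "\<exists>\<delta>\<in>m [^]\<^bsub>ideals_set R\<^esub> N. \<exists>M::nat. M \<ge> 1 \<and> v' \<oplus>\<^bsub>R\<^esub> \<delta> = v' \<ominus>\<^bsub>R\<^esub> w' [^]\<^bsub>R\<^esub> M" for N :: nat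
  proof (cases N)
    case 0
    have "\<ominus>\<^bsub>R\<^esub> (w' [^]\<^bsub>R\<^esub> (1 :: nat)) \<in> m [^]\<^bsub>ideals_set R\<^esub> N"
      using w'R by (simp add: 0 ideals_set_def)
    thus ?thesis
      by (rule bexI[rotated]) (rule exI[of _ 1], simp add: a_minus_def)
  next
    case (Suc N')
    have ideals: "ideal (m [^]\<^bsub>ideals_set R\<^esub> k) R" for k :: nat
      by (induction k) (simp_all add: ideals_set_def R.oneideal R.ideal_prod_is_ideal m_ideal)
    have "\<ominus>\<^bsub>R\<^esub> (w' [^]\<^bsub>R\<^esub> N) \<in> m [^]\<^bsub>ideals_set R\<^esub> N"
      using additive_subgroup.a_inv_closed[OF ideal.axioms(1)[OF ideals]]
        power_in_ideals_set_power[OF R.is_cring m_ideal w'm] by blast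
    thus ?thesis
      by (rule bexI[rotated]) (rule exI[of _ N], simp add: a_minus_def Suc)
  qed
  have "strongly_F_regular 3 (R Quot PIdl\<^bsub>R\<^esub> v')"
    using special_fibre_strongly_F_regular[OF char]
    by (simp add: R S_eq I_eq v' vars)
  moreover have "\<not> (\<exists>N::nat. \<forall>\<delta> \<in> m [^]\<^bsub>ideals_set R\<^esub> N. F_pure 3 (R Quot PIdl\<^bsub>R\<^esub> (v' \<oplus>\<^bsub>R\<^esub> \<delta>)))"
    using perturbation not_pure by metis
  moreover have "\<not> (\<exists>N::nat. \<forall>\<delta> \<in> m [^]\<^bsub>ideals_set R\<^esub> N.
      strongly_F_regular 3 (R Quot PIdl\<^bsub>R\<^esub> (v' \<oplus>\<^bsub>R\<^esub> \<delta>)))"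
    using perturbation not_regular by metis
  ultimately show ?thesis
    using not_pure by blast
qed

end
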